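(* Let $\mathbb{C}$ be a regular category. If $\mathbb{C}$ is a Goursat category, then the category $\mathrm{Conn}(\mathbb{C})$ of connectors in $\mathbb{C}$ is a Goursat category.
   Context: A category is regular if it is finitely complete, regular epimorphisms are stable under pullbacks, and kernel pairs have coequalisers. A relation from $X$ to $Y$ is a subobject $\langle r_1,r_2\rangle : R \rightarrowtail X\times Y$; in a regular category the composite $SR$ of $R\rightarrowtail X\times Y$ and $S\rightarrowtail Y\times Z$ is the image of $(r_1 p_1, s_2 p_2): R\times_Y S\to X\times Z$, where $R\times_Y S$ (with projections $p_1,p_2$) is the pullback of $r_2$ along $s_1$. An equivalence relation on $X$ is a relation from $X$ to $X$ that is (internally) reflexive, symmetric and transitive. A Goursat category is a regular category in which $RSR=SRS$ for any pair of equivalence relations $R,S$ on the same object. Let $(R,r_1,r_2)$ and $(S,s_1,s_2)$ be equivalence relations on an object $X$, and let $R\times_X S$ be the pullback of $r_2$ along $s_1$ (so its generalized elements are triples $(x,y,z)$ with $xRy$ and $ySz$). A connector between $R$ and $S$ is an arrow $p: R\times_X S\to X$ such that (in terms of generalized elements, whenever each term is defined): (1) $x\,S\,p(x,y,z)\,R\,z$; (2) $p(x,x,y)=y$; (3) $p(x,y,y)=x$; (4) $p(x,y,p(z,u,v))=p(p(x,y,z),u,v)$. The category $2\text{-}\mathrm{Eq}(\mathbb{C})$ has as objects triples $(R,S,X)$ where $R$ and $S$ are equivalence relations on the object $X$ of $\mathbb{C}$; an arrow $(R,S,X)\to(\bar R,\bar S,\bar X)$ is a triple of arrows $f_R:R\to\bar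 R$, $f_S:S\to\bar S$, $f:X\to\bar X$ in $\mathbb{C}$ with $\bar r_i f_R=f r_i$ and $\bar s_i f_S=f s_i$ for $i=1,2$. The category $\mathrm{Conn}(\mathbb{C})$ has as objects $(R,S,X,p)$ where $(R,S,X)$ is an object of $2\text{-}\mathrm{Eq}(\mathbb{C})$ and $p:R\times_X S\to X$ is a connector between $R$ and $S$; an arrow $(R,S,X,p)\to(\bar R,\bar S,\bar X,\bar p)$ is an arrow $(f_R,f_S,f)$ of $2\text{-}\mathrm{Eq}(\mathbb{C})$ such that $f p=\bar p\,\bar f$, where $\bar f: R\times_X S\to \bar R\times_{\bar X}\bar S$ is the arrow induced by $f_R$ and $f_S$ on the pullbacks. *)

theory Defs
  imports Main
begin

section \<open>Categories\<close>

record ('o, 'a) cat =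
  Obj :: "'o set"
  Arr :: "'a set"
  Dom :: "'a \<Rightarrow> 'o"
  Cod :: "'a \<Rightarrow> 'o"
  Ide :: "'o \<Rightarrow> 'a"
  Comp :: "'a \<Rightarrow> 'a \<Rightarrow> 'a"  (infixl "\<cdot>\<index>" 70)

definition hom :: "('o, 'a) cat \<Rightarrow> 'o \<Rightarrow> 'o \<Rightarrow> 'a set" where
  "hom C X Y = {f \<in> Arr C. Dom C f = X \<and> Cod C f = Y}"

text \<open>Composition is written in applicative order and is only meaningful on composable arrows.\<close>

locale category =
  fixes C :: "('o, 'a) cat" (structure)
  assumes Dom_in_Obj: "f \<in> Arr C \<Longrightarrow> Dom C f \<in> Obj C"
    and Cod_in_Obj: "f \<in> Arr C \<Longrightarrow> Cod C f \<in> Obj C"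
    and Ide_in_hom: "X \<in> Obj C \<Longrightarrow> Ide C X \<in> hom C X X"
    and Comp_in_hom: "\<lbrakk>f \<in> hom C X Y; g \<in> hom C Y Z\<rbrakk> \<Longrightarrow> g \<cdot> f \<in> hom C X Z"
    and Comp_Ide_right: "f \<in> hom C X Y \<Longrightarrow> f \<cdot> Ide C X = f"
    and Comp_Ide_left: "f \<in> hom C X Y \<Longrightarrow> Ide C Y \<cdot> f = f"
    and Comp_assoc: "\<lbrakk>f \<in> hom C X Y; g \<in> hom C Y Z; h \<in> hom C Z W\<rbrakk>
          \<Longrightarrow> h \<cdot> (g \<cdot> f) = (h \<cdot> g) \<cdot> f"

definition monic :: "('o, 'a) cat \<Rightarrow> 'a \<Rightarrow> bool" where
  "monic C m \<longleftrightarrow> m \<in> Arr C \<and>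
     (\<forall>T\<in>Obj C. \<forall>u \<in> hom C T (Dom C m). \<forall>v \<in> hom C T (Dom C m).
        m \<cdot>\<^bsub>C\<^esub> u = m \<cdot>\<^bsub>C\<^esub> v \<longrightarrow> u = v)"

definition isomorphism :: "('o, 'a) cat \<Rightarrow> 'a \<Rightarrow> bool" where
  "isomorphism C f \<longleftrightarrow> f \<in> Arr C \<and>
     (\<exists>g \<in> hom C (Cod C f) (Dom C f).
        g \<cdot>\<^bsub>C\<^esub> f = Ide C (Dom C f) \<and> f \<cdot>\<^bsub>C\<^esub> g = Ide C (Cod C f))"

section \<open>Finite limits\<close>

definition is_functor ::
    "('i, 'j) cat \<Rightarrow> ('o, 'a) cat \<Rightarrow> ('i \<Rightarrow> 'o) \<Rightarrow> ('j \<Rightarrow> 'a) \<Rightarrow> bool" where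
  "is_functor J C F\<^sub>o F\<^sub>a \<longleftrightarrow>
     (\<forall>i\<in>Obj J. F\<^sub>o i \<in> Obj C) \<and>
     (\<forall>f\<in>Arr J. F\<^sub>a f \<in> hom C (F\<^sub>o (Dom J f)) (F\<^sub>o (Cod J f))) \<and>
     (\<forall>i\<in>Obj J. F\<^sub>a (Ide J i) = Ide C (F\<^sub>o i)) \<and>
     (\<forall>f\<in>Arr J. \<forall>g\<in>Arr J. Dom J g = Cod J f \<longrightarrow> F\<^sub>a (g \<cdot>\<^bsub>J\<^esub> f) = F\<^sub>a g \<cdot>\<^bsub>C\<^esub> F\<^sub>a f)"

definition is_cone ::
    "('i, 'j) cat \<Rightarrow> ('o, 'a) cat \<Rightarrow> ('i \<Rightarrow> 'o) \<Rightarrow> ('j \<Rightarrow> 'a) \<Rightarrow> 'o \<Rightarrow> ('i \<Rightarrow> 'a) \<Rightarrow> bool" where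
  "is_cone J C F\<^sub>o F\<^sub>a L \<pi> \<longleftrightarrow> L \<in> Obj C \<and>
     (\<forall>i\<in>Obj J. \<pi> i \<in> hom C L (F\<^sub>o i)) \<and>
     (\<forall>f\<in>Arr J. F\<^sub>a f \<cdot>\<^bsub>C\<^esub> \<pi> (Dom J f) = \<pi> (Cod J f))"

definition is_limit ::
    "('i, 'j) cat \<Rightarrow> ('o, 'a) cat \<Rightarrow> ('i \<Rightarrow> 'o) \<Rightarrow> ('j \<Rightarrow> 'a) \<Rightarrow> 'o \<Rightarrow> ('i \<Rightarrow> 'a) \<Rightarrow> bool" where
  "is_limit J C F\<^sub>o F\<^sub>a L \<pi> \<longleftrightarrow> is_cone J C F\<^sub>o F\<^sub>a L \<pi> \<and>
     (\<forall>T \<tau>. is_cone J C F\<^sub>o F\<^sub>a T \<tau> \<longrightarrow>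
        (\<exists>!u. u \<in> hom C T L \<and> (\<forall>i\<in>Obj J. \<pi> i \<cdot>\<^bsub>C\<^esub> u = \<tau> i)))"

text \<open>Every finite category is isomorphic to one whose objects and arrows are natural numbers,
  so it suffices to consider index categories of that type.\<close>

definition finitely_complete :: "('o, 'a) cat \<Rightarrow> bool" where
  "finitely_complete C \<longleftrightarrow>
     (\<forall>(J :: (nat, nat) cat) F\<^sub>o F\<^sub>a.
        category J \<and> finite (Obj J) \<and> finite (Arr J) \<and> is_functor J C F\<^sub>o F\<^sub>a \<longrightarrow>
        (\<exists>L \<pi>. is_limit J C F\<^sub>o F\<^sub>a L \<pi>))"

record ('o, 'a) span =
  apex :: 'o
  leg1 :: 'a
  leg2 :: 'a

definition is_span :: "('o, 'a) cat \<Rightarrow> 'o \<Rightarrow> 'o \<Rightarrow> ('o, 'a) span \<Rightarrow> bool" where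
  "is_span C X Y R \<longleftrightarrow>
     apex R \<in> Obj C \<and> leg1 R \<in> hom C (apex R) X \<and> leg2 R \<in> hom C (apex R) Y"

definition is_product :: "('o, 'a) cat \<Rightarrow> 'o \<Rightarrow> 'o \<Rightarrow> ('o, 'a) span \<Rightarrow> bool" where
  "is_product C X Y P \<longleftrightarrow> is_span C X Y P \<and>
     (\<forall>Q. is_span C X Y Q \<longrightarrow>
        (\<exists>!u. u \<in> hom C (apex Q) (apex P) \<and>
              leg1 P \<cdot>\<^bsub>C\<^esub> u = leg1 Q \<and> leg2 P \<cdot>\<^bsub>C\<^esub> u = leg2 Q))"

definition is_commuting_span :: "('o, 'a) cat \<Rightarrow> 'a \<Rightarrow> 'a \<Rightarrow> ('o, 'a) span \<Rightarrow> bool" where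
  "is_commuting_span C f g P \<longleftrightarrow> f \<in> Arr C \<and> g \<in> Arr C \<and> Cod C f = Cod C g \<and>
     is_span C (Dom C f) (Dom C g) P \<and> f \<cdot>\<^bsub>C\<^esub> leg1 P = g \<cdot>\<^bsub>C\<^esub> leg2 P"

definition is_pullback :: "('o, 'a) cat \<Rightarrow> 'a \<Rightarrow> 'a \<Rightarrow> ('o, 'a) span \<Rightarrow> bool" where
  "is_pullback C f g P \<longleftrightarrow> is_commuting_span C f g P \<and>
     (\<forall>Q. is_commuting_span C f g Q \<longrightarrow>
        (\<exists>!u. u \<in> hom C (apex Q) (apex P) \<and>
              leg1 P \<cdot>\<^bsub>C\<^esub> u = leg1 Q \<and> leg2 P \<cdot>\<^bsub>C\<^esub> u = leg2 Q))"

text \<open>The chosen pullback of \<open>f\<close> along \<open>g\<close>.\<close>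

definition pullback :: "('o, 'a) cat \<Rightarrow> 'a \<Rightarrow> 'a \<Rightarrow> ('o, 'a) span" where
  "pullback C f g = (SOME P. is_pullback C f g P)"

section \<open>Regular categories\<close>

definition is_coequaliser :: "('o, 'a) cat \<Rightarrow> 'a \<Rightarrow> 'a \<Rightarrow> 'a \<Rightarrow> bool" where
  "is_coequaliser C f g e \<longleftrightarrow>
     f \<in> Arr C \<and> g \<in> Arr C \<and> e \<in> Arr C \<and>
     Dom C f = Dom C g \<and> Cod C f = Dom C e \<and> Cod C g = Dom C e \<and>
     e \<cdot>\<^bsub>C\<^esub> f = e \<cdot>\<^bsub>C\<^esub> g \<and>
     (\<forall>h\<in>Arr C. Dom C h = Dom C e \<and> h \<cdot>\<^bsub>C\<^esub> f = h \<cdot>\<^bsub>C\<^esub> g \<longrightarrow>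
        (\<exists>!u. u \<in> hom C (Cod C e) (Cod C h) \<and> u \<cdot>\<^bsub>C\<^esub> e = h))"

definition regular_epi :: "('o, 'a) cat \<Rightarrow> 'a \<Rightarrow> bool" where
  "regular_epi C e \<longleftrightarrow> (\<exists>f g. is_coequaliser C f g e)"

locale regular_category = category C for C :: "('o, 'a) cat" (structure) +
  assumes finitely_complete: "finitely_complete C"
    and regular_epi_stable:
      "\<lbrakk>is_pullback C e g P; regular_epi C e\<rbrakk> \<Longrightarrow> regular_epi C (leg2 P)"
    and kernel_pair_coequaliser: "is_pullback C f f P \<Longrightarrow> \<exists>e. is_coequaliser C (leg1 P) (leg2 P) e"

text \<open>In a regular category the image of \<open>f\<close> is the monic part of its factorisation as a regular
  epimorphism followed by a monomorphism.\<close>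

definition is_image :: "('o, 'a) cat \<Rightarrow> 'a \<Rightarrow> 'a \<Rightarrow> bool" where
  "is_image C f m \<longleftrightarrow> monic C m \<and>
     (\<exists>e \<in> hom C (Dom C f) (Dom C m). regular_epi C e \<and> m \<cdot>\<^bsub>C\<^esub> e = f)"

section \<open>Relations\<close>

text \<open>\<open>is_pairing C X Y P Q f\<close>: \<open>P\<close> is a product and \<open>f\<close> is the arrow into it with components the legs
  of the span \<open>Q\<close>.\<close>

definition is_pairing ::
    "('o, 'a) cat \<Rightarrow> 'o \<Rightarrow> 'o \<Rightarrow> ('o, 'a) span \<Rightarrow> ('o, 'a) span \<Rightarrow> 'a \<Rightarrow> bool" where
  "is_pairing C X Y P Q f \<longleftrightarrow> is_product C X Y P \<and> f \<in> hom C (apex Q) (apex P) \<and>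
     leg1 P \<cdot>\<^bsub>C\<^esub> f = leg1 Q \<and> leg2 P \<cdot>\<^bsub>C\<^esub> f = leg2 Q"

text \<open>Relations are represented by spans; two spans represent the same relation, i.e. the same
  subobject of the product, when they are related by \<open>same_relation\<close>.\<close>

definition is_relation :: "('o, 'a) cat \<Rightarrow> 'o \<Rightarrow> 'o \<Rightarrow> ('o, 'a) span \<Rightarrow> bool" where
  "is_relation C X Y R \<longleftrightarrow> is_span C X Y R \<and> (\<exists>P m. is_pairing C X Y P R m \<and> monic C m)"

definition same_relation :: "('o, 'a) cat \<Rightarrow> ('o, 'a) span \<Rightarrow> ('o, 'a) span \<Rightarrow> bool" where
  "same_relation C R S \<longleftrightarrow>
     (\<exists>i \<in> hom C (apex R) (apex S). isomorphism C i \<and>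
        leg1 S \<cdot>\<^bsub>C\<^esub> i = leg1 R \<and> leg2 S \<cdot>\<^bsub>C\<^esub> i = leg2 R)"

text \<open>\<open>is_composite C X Y Z S R T\<close>: for relations \<open>R\<close> from \<open>X\<close> to \<open>Y\<close> and \<open>S\<close> from \<open>Y\<close> to \<open>Z\<close>,
  the span \<open>T\<close> represents the composite \<open>SR\<close>.\<close>

definition is_composite ::
    "('o, 'a) cat \<Rightarrow> 'o \<Rightarrow> 'o \<Rightarrow> 'o \<Rightarrow>
     ('o, 'a) span \<Rightarrow> ('o, 'a) span \<Rightarrow> ('o, 'a) span \<Rightarrow> bool" where
  "is_composite C X Y Z S R T \<longleftrightarrow>
     is_relation C X Y R \<and> is_relation C Y Z S \<and> is_span C X Z T \<and>
     (\<exists>W P f m. is_pullback C (leg2 R) (leg1 S) W \<and>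
        is_pairing C X Z P
          \<lparr>apex = apex W, leg1 = leg1 R \<cdot>\<^bsub>C\<^esub> leg1 W, leg2 = leg2 S \<cdot>\<^bsub>C\<^esub> leg2 W\<rparr> f \<and>
        is_pairing C X Z P T m \<and> is_image C f m)"

definition is_equivalence :: "('o, 'a) cat \<Rightarrow> 'o \<Rightarrow> ('o, 'a) span \<Rightarrow> bool" where
  "is_equivalence C X R \<longleftrightarrow> is_relation C X X R \<and>
     (\<exists>d \<in> hom C X (apex R). leg1 R \<cdot>\<^bsub>C\<^esub> d = Ide C X \<and> leg2 R \<cdot>\<^bsub>C\<^esub> d = Ide C X) \<and>
     (\<exists>s \<in> hom C (apex R) (apex R). leg1 R \<cdot>\<^bsub>C\<^esub> s = leg2 R \<and> leg2 R \<cdot>\<^bsub>C\<^esub> s = leg1 R) \<and>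
     (\<exists>W. is_pullback C (leg2 R) (leg1 R) W \<and>
        (\<exists>t \<in> hom C (apex W) (apex R).
           leg1 R \<cdot>\<^bsub>C\<^esub> t = leg1 R \<cdot>\<^bsub>C\<^esub> leg1 W \<and> leg2 R \<cdot>\<^bsub>C\<^esub> t = leg2 R \<cdot>\<^bsub>C\<^esub> leg2 W))"

text \<open>In a regular category composites exist and are unique up to \<open>same_relation\<close>, so it does not
  matter that the law below ranges over all spans representing the composites.\<close>

locale goursat_category = regular_category C for C :: "('o, 'a) cat" (structure) +
  assumes goursat:
    "\<lbrakk>X \<in> Obj C; is_equivalence C X R; is_equivalence C X S;
      is_composite C X X X S R SR; is_composite C X X X R SR RSR;
      is_composite C X X X R S RS; is_composite C X X X S RS SRS\<rbrakk>
     \<Longrightarrow> same_relation C RSR SRS"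

section \<open>Connectors\<close>

text \<open>Generalised elements of \<open>X\<close> at stage \<open>T\<close> are arrows from \<open>T\<close> to \<open>X\<close>.\<close>

definition related :: "('o, 'a) cat \<Rightarrow> ('o, 'a) span \<Rightarrow> 'o \<Rightarrow> 'a \<Rightarrow> 'a \<Rightarrow> bool" where
  "related C R T x y \<longleftrightarrow>
     (\<exists>h \<in> hom C T (apex R). leg1 R \<cdot>\<^bsub>C\<^esub> h = x \<and> leg2 R \<cdot>\<^bsub>C\<^esub> h = y)"

definition in_pullback ::
    "('o, 'a) cat \<Rightarrow> ('o, 'a) span \<Rightarrow> ('o, 'a) span \<Rightarrow> 'o \<Rightarrow> 'a \<Rightarrow> 'a \<Rightarrow> 'a \<Rightarrow> bool" where
  "in_pullback C R S T x y z \<longleftrightarrow> related C R T x y \<and> related C S T y z"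

definition triple ::
    "('o, 'a) cat \<Rightarrow> ('o, 'a) span \<Rightarrow> ('o, 'a) span \<Rightarrow> 'o \<Rightarrow> 'a \<Rightarrow> 'a \<Rightarrow> 'a \<Rightarrow> 'a" where
  "triple C R S T x y z =
     (let W = pullback C (leg2 R) (leg1 S) in
      THE u. u \<in> hom C T (apex W) \<and>
        leg1 R \<cdot>\<^bsub>C\<^esub> (leg1 W \<cdot>\<^bsub>C\<^esub> u) = x \<and>
        leg2 R \<cdot>\<^bsub>C\<^esub> (leg1 W \<cdot>\<^bsub>C\<^esub> u) = y \<and>
        leg1 S \<cdot>\<^bsub>C\<^esub> (leg2 W \<cdot>\<^bsub>C\<^esub> u) = y \<and>
        leg2 S \<cdot>\<^bsub>C\<^esub> (leg2 W \<cdot>\<^bsub>C\<^esub> u) = z)"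

definition is_connector ::
    "('o, 'a) cat \<Rightarrow> 'o \<Rightarrow> ('o, 'a) span \<Rightarrow> ('o, 'a) span \<Rightarrow> 'a \<Rightarrow> bool" where
  "is_connector C X R S p \<longleftrightarrow>
     p \<in> hom C (apex (pullback C (leg2 R) (leg1 S))) X \<and>
     (\<forall>T\<in>Obj C.
        let D = in_pullback C R S T; p' = (\<lambda>x y z. p \<cdot>\<^bsub>C\<^esub> triple C R S T x y z) in
        (\<forall>x y z. D x y z \<longrightarrow> related C S T x (p' x y z) \<and> related C R T (p' x y z) z) \<and>
        (\<forall>x y. D x x y \<longrightarrow> p' x x y = y) \<and>
        (\<forall>x y. D x y y \<longrightarrow> p' x y y = x) \<and>
        (\<forall>x y z u v. D z u v \<and> D x y (p' z u v) \<and> D x y z \<and> D (p' x y z) u v \<longrightarrow>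
           p' x y (p' z u v) = p' (p' x y z) u v))"

section \<open>The categories of pairs of equivalence relations and of connectors\<close>

type_synonym ('o, 'a) eq2 = "('o, 'a) span \<times> ('o, 'a) span \<times> 'o"
type_synonym ('o, 'a) conn = "('o, 'a) span \<times> ('o, 'a) span \<times> 'o \<times> 'a"

text \<open>Arrows carry their domain and codomain in addition to the triple of underlying arrows.\<close>

type_synonym ('b, 'a) arr3 = "'b \<times> 'b \<times> 'a \<times> 'a \<times> 'a"

definition Two_Eq :: "('o, 'a) cat \<Rightarrow> (('o, 'a) eq2, (('o, 'a) eq2, 'a) arr3) cat" where
  "Two_Eq C =
    \<lparr>Obj = {(R, S, X). X \<in> Obj C \<and> is_equivalence C X R \<and> is_equivalence C X S},
     Arr = {((R, S, X), (R', S', X'), f\<^sub>R, f\<^sub>S, f) | R S X R' S' X' f\<^sub>R f\<^sub>S f.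
        X \<in> Obj C \<and> is_equivalence C X R \<and> is_equivalence C X S \<and>
        X' \<in> Obj C \<and> is_equivalence C X' R' \<and> is_equivalence C X' S' \<and>
        f\<^sub>R \<in> hom C (apex R) (apex R') \<and> f\<^sub>S \<in> hom C (apex S) (apex S') \<and> f \<in> hom C X X' \<and>
        leg1 R' \<cdot>\<^bsub>C\<^esub> f\<^sub>R = f \<cdot>\<^bsub>C\<^esub> leg1 R \<and> leg2 R' \<cdot>\<^bsub>C\<^esub> f\<^sub>R = f \<cdot>\<^bsub>C\<^esub> leg2 R \<and>
        leg1 S' \<cdot>\<^bsub>C\<^esub> f\<^sub>S = f \<cdot>\<^bsub>C\<^esub> leg1 S \<and> leg2 S' \<cdot>\<^bsub>C\<^esub> f\<^sub>S = f \<cdot>\<^bsub>C\<^esub> leg2 S},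
     Dom = (\<lambda>(A, B, t). A),
     Cod = (\<lambda>(A, B, t). B),
     Ide = (\<lambda>(R, S, X). ((R, S, X), (R, S, X), Ide C (apex R), Ide C (apex S), Ide C X)),
     Comp = (\<lambda>(B, B', g\<^sub>R, g\<^sub>S, g) (A, A', f\<^sub>R, f\<^sub>S, f).
        (A, B', g\<^sub>R \<cdot>\<^bsub>C\<^esub> f\<^sub>R, g\<^sub>S \<cdot>\<^bsub>C\<^esub> f\<^sub>S, g \<cdot>\<^bsub>C\<^esub> f))\<rparr>"

text \<open>The arrow between the chosen pullbacks induced by \<open>f\<^sub>R\<close> and \<open>f\<^sub>S\<close>.\<close>

definition induced ::
    "('o, 'a) cat \<Rightarrow> ('o, 'a) span \<Rightarrow> ('o, 'a) span \<Rightarrow> ('o, 'a) span \<Rightarrow> ('o, 'a) span \<Rightarrow>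
     'a \<Rightarrow> 'a \<Rightarrow> 'a" where
  "induced C R S R' S' f\<^sub>R f\<^sub>S =
     (let W = pullback C (leg2 R) (leg1 S); W' = pullback C (leg2 R') (leg1 S') in
      THE u. u \<in> hom C (apex W) (apex W') \<and>
        leg1 W' \<cdot>\<^bsub>C\<^esub> u = f\<^sub>R \<cdot>\<^bsub>C\<^esub> leg1 W \<and> leg2 W' \<cdot>\<^bsub>C\<^esub> u = f\<^sub>S \<cdot>\<^bsub>C\<^esub> leg2 W)"

definition Conn :: "('o, 'a) cat \<Rightarrow> (('o, 'a) conn, (('o, 'a) conn, 'a) arr3) cat" where
  "Conn C =
    \<lparr>Obj = {(R, S, X, p). (R, S, X) \<in> Obj (Two_Eq C) \<and> is_connector C X R S p},
     Arr = {((R, S, X, p), (R', S', X', p'), f\<^sub>R, f\<^sub>S, f) | R S X p R' S' X' p' f\<^sub>R f\<^sub>S f.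
        is_connector C X R S p \<and> is_connector C X' R' S' p' \<and>
        ((R, S, X), (R', S', X'), f\<^sub>R, f\<^sub>S, f) \<in> Arr (Two_Eq C) \<and>
        f \<cdot>\<^bsub>C\<^esub> p = p' \<cdot>\<^bsub>C\<^esub> induced C R S R' S' f\<^sub>R f\<^sub>S},
     Dom = (\<lambda>(A, B, t). A),
     Cod = (\<lambda>(A, B, t). B),
     Ide = (\<lambda>(R, S, X, p). ((R, S, X, p), (R, S, X, p), Ide C (apex R), Ide C (apex S), Ide C X)),
     Comp = (\<lambda>(B, B', g\<^sub>R, g\<^sub>S, g) (A, A', f\<^sub>R, f\<^sub>S, f).
        (A, B', g\<^sub>R \<cdot>\<^bsub>C\<^esub> f\<^sub>R, g\<^sub>S \<cdot>\<^bsub>C\<^esub> f\<^sub>S, g \<cdot>\<^bsub>C\<^esub> f))\<rparr>"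

end

theory Submission
  imports Defs
begin

text \<open>
  A regular category is handled through generalised elements, an existence statement being witnessed
  after a regular epimorphism. The Goursat law then reads: \<open>x R y S z R w\<close> implies
  \<open>x S y' R z' S w\<close> locally. It yields the shifting lemma (if the kernel pairs of \<open>f\<close> and \<open>d\<close>
  meet inside that of \<open>c\<close>, then \<open>c\<close> identifies one \<open>d\<close>-side of an \<open>f\<close>-\<open>d\<close>-rectangle as soon as it
  identifies the other) and the stability of equivalence relations under regular images. Two shifts show
  that a connector is compatible with the kernel pair of any arrow, and a third application of the law
  shows that composable triples lift along regular epimorphisms, so connectors descend to quotients.
  Hence limits, regular epimorphisms and images of connectors are all computed componentwise, and the
  Goursat law for connectors follows from the three laws in the base category: an isomorphism between
  the components of two relations is automatically an arrow of connectors because the legs of a relation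
  are jointly monic.
\<close>

section \<open>Categories and finite limits\<close>

text \<open>The obstacle is that a connector lives on a pullback, and pullbacks do not commute with
  quotients: for quotients R -> R', S -> S' over X -> Y, the induced arrow between the objects of
  composable triples need not be a regular epimorphism in an arbitrary regular category. Here it is
  one because the two arrows being glued, the second leg of R and the first leg of S, are split by
  the diagonals, and these sections are compatible with the quotient. The second obstacle is that a
  Goursat category need not be a Mal'tsev category: equivalence relations need not permute in two
  steps, and only the three-step law is at hand. So every argument is arranged as a chain of exactly
  three links, with auxiliary arrows (pairings) manufactured so that their kernel pairs are the
  required relations. Regular epimorphisms of connectors are recognised through images: once images
  are computed componentwise, a regular epimorphism of \<open>Conn C\<close> must coincide with the
  epic part of its componentwise factorisation, and stability under pullback is inherited from the
  base.\<close>

definition cover :: "('o, 'a) cat \<Rightarrow> 'a \<Rightarrow> 'o \<Rightarrow> 'o \<Rightarrow> bool" where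
  "cover C q T' T \<longleftrightarrow> q \<in> hom C T' T \<and> regular_epi C q"

lemma hom_iff: "f \<in> hom C X Y \<longleftrightarrow> f \<in> Arr C \<and> Dom C f = X \<and> Cod C f = Y"
  by (auto simp: hom_def)

context category
begin

lemma hom_Obj: "f \<in> hom C X Y \<Longrightarrow> X \<in> Obj C" "f \<in> hom C X Y \<Longrightarrow> Y \<in> Obj C"
  using Dom_in_Obj Cod_in_Obj by (auto simp: hom_iff)

lemma Comp_simps [simp]:
  assumes "f \<in> Arr C" "g \<in> Arr C" "Cod C f = Dom C g"
  shows "g \<cdot> f \<in> Arr C" "Dom C (g \<cdot> f) = Dom C f" "Cod C (g \<cdot> f) = Cod C g"
  using Comp_in_hom[of f "Dom C f" "Cod C f" g "Cod C g"] assms by (auto simp: hom_iff)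

lemma Ide_simps [simp]:
  assumes "X \<in> Obj C"
  shows "Ide C X \<in> Arr C" "Dom C (Ide C X) = X" "Cod C (Ide C X) = X"
  using Ide_in_hom[OF assms] by (auto simp: hom_iff)

lemma Comp_Ide [simp]:
  assumes "f \<in> Arr C"
  shows "Dom C f = X \<Longrightarrow> f \<cdot> Ide C X = f" "Cod C f = X \<Longrightarrow> Ide C X \<cdot> f = f"
  using assms Comp_Ide_left Comp_Ide_right by (auto simp: hom_iff)

lemma Comp_assoc_right:
  "\<lbrakk>f \<in> Arr C; g \<in> Arr C; h \<in> Arr C; Cod C f = Dom C g; Cod C g = Dom C h\<rbrakk>
    \<Longrightarrow> (h \<cdot> g) \<cdot> f = h \<cdot> (g \<cdot> f)"
  using Comp_assoc by (simp add: hom_iff)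

lemma reassoc:
  "\<lbrakk>a \<cdot> b = c; b \<in> hom C X Y; a \<in> hom C Y Z; d \<in> hom C W X\<rbrakk> \<Longrightarrow> a \<cdot> (b \<cdot> d) = c \<cdot> d"
  using Comp_assoc by metis

lemma monicD:
  "\<lbrakk>monic C m; u \<in> hom C T (Dom C m); v \<in> hom C T (Dom C m); m \<cdot> u = m \<cdot> v\<rbrakk> \<Longrightarrow> u = v"
  unfolding monic_def using hom_Obj(1) by blast

lemma regular_epi_arr: "regular_epi C e \<Longrightarrow> e \<in> Arr C"
  by (auto simp: regular_epi_def is_coequaliser_def)

lemma is_coequaliserD:
  assumes "is_coequaliser C f g e"
  shows "f \<in> hom C (Dom C f) (Dom C e)" "g \<in> hom C (Dom C f) (Dom C e)"
    "e \<in> hom C (Dom C e) (Cod C e)" "e \<cdot> f = e \<cdot> g"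
  using assms unfolding is_coequaliser_def hom_iff by simp_all

lemma coequaliser_lift:
  assumes c: "is_coequaliser C f g e" and h: "h \<in> hom C (Dom C e) Z" and eq: "h \<cdot> f = h \<cdot> g"
  shows "\<exists>!u. u \<in> hom C (Cod C e) Z \<and> u \<cdot> e = h"
proof -
  have "h \<in> Arr C" "Dom C h = Dom C e" "Cod C h = Z" using h by (simp_all add: hom_iff)
  with c eq show ?thesis unfolding is_coequaliser_def by blast
qed

lemma regular_epi_cancel:
  assumes e: "regular_epi C e" and u: "u \<in> hom C (Cod C e) Z" and v: "v \<in> hom C (Cod C e) Z"
    and uv: "u \<cdot> e = v \<cdot> e"
  shows "u = v"
proof -
  from e obtain f g where c: "is_coequaliser C f g e" by (auto simp: regular_epi_def)
  note D = is_coequaliserD[OF c]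
  have h: "u \<cdot> e \<in> hom C (Dom C e) Z" using u D(3) by (rule Comp_in_hom[rotated])
  have "(u \<cdot> e) \<cdot> f = (u \<cdot> e) \<cdot> g"
    using Comp_assoc[OF D(1,3) u] Comp_assoc[OF D(2,3) u] D(4) by metis
  from coequaliser_lift[OF c h this] show ?thesis using u v uv by metis
qed

text \<open>The pair coequalised by \<open>e\<close> is itself identified by \<open>e\<close>, so
  \<open>eq\<close> applies to it. Quantifying over all identified pairs keeps that pair anonymous
  and lets the hypothesis be checked on generalised elements.\<close>

lemma regular_epi_descent:
  assumes e: "regular_epi C e" and a: "a \<in> hom C (Dom C e) Z"
    and eq: "\<And>T u v. \<lbrakk>u \<in> hom C T (Dom C e); v \<in> hom C T (Dom C e); e \<cdot> u = e \<cdot> v\<rbrakk> \<Longrightarrow> a \<cdot> u = a \<cdot> v"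
  obtains b where "b \<in> hom C (Cod C e) Z" "b \<cdot> e = a"
proof -
  from e obtain f g where c: "is_coequaliser C f g e" by (auto simp: regular_epi_def)
  note D = is_coequaliserD[OF c]
  from coequaliser_lift[OF c a eq[OF D(1,2,4)]] show ?thesis using that by blast
qed

lemma cover_epi:
  "\<lbrakk>cover C q T' T; u \<in> hom C T Z; v \<in> hom C T Z; u \<cdot> q = v \<cdot> q\<rbrakk> \<Longrightarrow> u = v"
  using regular_epi_cancel by (auto simp: cover_def hom_iff)

lemma cover_hom: "cover C q T' T \<Longrightarrow> q \<in> hom C T' T"
  by (simp add: cover_def)

text \<open>Serves as the trivial cover when a witness required only locally already exists at the
  given stage.\<close>

lemma cover_Ide:
  assumes "X \<in> Obj C" shows "cover C (Ide C X) X X"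
proof -
  have "is_coequaliser C (Ide C X) (Ide C X) (Ide C X)"
    using assms unfolding is_coequaliser_def by (auto simp: hom_iff)
  thus ?thesis using assms by (auto simp: cover_def regular_epi_def hom_iff)
qed

lemma is_pullbackD:
  assumes "is_pullback C f g P"
  shows "f \<in> Arr C" "g \<in> Arr C" "Cod C f = Cod C g" "apex P \<in> Obj C"
    "leg1 P \<in> hom C (apex P) (Dom C f)" "leg2 P \<in> hom C (apex P) (Dom C g)"
    "f \<cdot> leg1 P = g \<cdot> leg2 P"
  using assms by (auto simp: is_pullback_def is_commuting_span_def is_span_def)

lemma pullback_lift:
  assumes P: "is_pullback C f g P" and a: "a \<in> hom C T (Dom C f)" and b: "b \<in> hom C T (Dom C g)"
    and ab: "f \<cdot> a = g \<cdot> b"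
  obtains u where "u \<in> hom C T (apex P)" "leg1 P \<cdot> u = a" "leg2 P \<cdot> u = b"
proof -
  have "is_commuting_span C f g \<lparr>apex = T, leg1 = a, leg2 = b\<rparr>"
    using is_pullbackD[OF P] a b ab hom_Obj by (auto simp: is_commuting_span_def is_span_def)
  from conjunct2[OF P[unfolded is_pullback_def], rule_format, OF this]
  have "\<exists>!u. u \<in> hom C T (apex P) \<and> leg1 P \<cdot> u = a \<and> leg2 P \<cdot> u = b" by simp
  thus ?thesis using that by blast
qed

lemma pullback_eqI:
  assumes P: "is_pullback C f g P" and u: "u \<in> hom C T (apex P)" and v: "v \<in> hom C T (apex P)"
    and 1: "leg1 P \<cdot> u = leg1 P \<cdot> v" and 2: "leg2 P \<cdot> u = leg2 P \<cdot> v"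
  shows "u = v"
proof -
  note D = is_pullbackD[OF P]
  have "f \<cdot> (leg1 P \<cdot> u) = g \<cdot> (leg2 P \<cdot> u)"
    using reassoc[OF D(7) D(5) _ u, of "Cod C f"] D u by (simp add: hom_iff Comp_assoc_right)
  hence "is_commuting_span C f g \<lparr>apex = T, leg1 = leg1 P \<cdot> u, leg2 = leg2 P \<cdot> u\<rparr>"
    using D u hom_Obj[OF u] by (auto simp: is_commuting_span_def is_span_def hom_iff)
  from conjunct2[OF P[unfolded is_pullback_def], rule_format, OF this]
  have "\<exists>!w. w \<in> hom C T (apex P) \<and> leg1 P \<cdot> w = leg1 P \<cdot> u \<and> leg2 P \<cdot> w = leg2 P \<cdot> u" by simp
  thus ?thesis using u v 1 2 by metis
qed

lemma is_pullbackI: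
  assumes "f \<in> Arr C" "g \<in> Arr C" "Cod C f = Cod C g"
    "leg1 P \<in> hom C (apex P) (Dom C f)" "leg2 P \<in> hom C (apex P) (Dom C g)"
    "f \<cdot> leg1 P = g \<cdot> leg2 P"
    and ex: "\<And>T a b. \<lbrakk>a \<in> hom C T (Dom C f); b \<in> hom C T (Dom C g); f \<cdot> a = g \<cdot> b\<rbrakk>
      \<Longrightarrow> \<exists>u \<in> hom C T (apex P). leg1 P \<cdot> u = a \<and> leg2 P \<cdot> u = b"
    and uq: "\<And>T u v. \<lbrakk>u \<in> hom C T (apex P); v \<in> hom C T (apex P);
        leg1 P \<cdot> u = leg1 P \<cdot> v; leg2 P \<cdot> u = leg2 P \<cdot> v\<rbrakk> \<Longrightarrow> u = v"
  shows "is_pullback C f g P"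
  unfolding is_pullback_def
proof (intro conjI allI impI)
  show "is_commuting_span C f g P"
    using assms(1-6) hom_Obj by (auto simp: is_commuting_span_def is_span_def)
  fix Q assume "is_commuting_span C f g Q"
  hence "\<exists>u \<in> hom C (apex Q) (apex P). leg1 P \<cdot> u = leg1 Q \<and> leg2 P \<cdot> u = leg2 Q"
    by (intro ex) (auto simp: is_commuting_span_def is_span_def)
  thus "\<exists>!u. u \<in> hom C (apex Q) (apex P) \<and> leg1 P \<cdot> u = leg1 Q \<and> leg2 P \<cdot> u = leg2 Q"
    using uq by metis
qed

lemma is_productD:
  assumes "is_product C X Y P"
  shows "X \<in> Obj C" "Y \<in> Obj C" "apex P \<in> Obj C" "leg1 P \<in> hom C (apex P) X" "leg2 P \<in> hom C (apex P) Y"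
  using assms hom_Obj by (auto simp: is_product_def is_span_def)

lemma product_lift:
  assumes P: "is_product C X Y P" and a: "a \<in> hom C T X" and b: "b \<in> hom C T Y"
  obtains u where "u \<in> hom C T (apex P)" "leg1 P \<cdot> u = a" "leg2 P \<cdot> u = b"
proof -
  have "is_span C X Y \<lparr>apex = T, leg1 = a, leg2 = b\<rparr>"
    using a b hom_Obj by (auto simp: is_span_def)
  from conjunct2[OF P[unfolded is_product_def], rule_format, OF this]
  have "\<exists>!u. u \<in> hom C T (apex P) \<and> leg1 P \<cdot> u = a \<and> leg2 P \<cdot> u = b" by simp
  thus ?thesis using that by blast
qed

lemma product_eqI:
  assumes P: "is_product C X Y P" and u: "u \<in> hom C T (apex P)" and v: "v \<in> hom C T (apex P)"
    and 1: "leg1 P \<cdot> u = leg1 P \<cdot> v" and 2: "leg2 P \<cdot> u = leg2 P \<cdot> v"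
  shows "u = v"
proof -
  note D = is_productD[OF P]
  have "is_span C X Y \<lparr>apex = T, leg1 = leg1 P \<cdot> u, leg2 = leg2 P \<cdot> u\<rparr>"
    using D u hom_Obj[OF u] by (auto simp: is_span_def hom_iff)
  from conjunct2[OF P[unfolded is_product_def], rule_format, OF this]
  have "\<exists>!w. w \<in> hom C T (apex P) \<and> leg1 P \<cdot> w = leg1 P \<cdot> u \<and> leg2 P \<cdot> w = leg2 P \<cdot> u" by simp
  thus ?thesis using u v 1 2 by metis
qed

lemma is_productI:
  assumes "leg1 P \<in> hom C (apex P) X" "leg2 P \<in> hom C (apex P) Y"
    and ex: "\<And>T a b. \<lbrakk>a \<in> hom C T X; b \<in> hom C T Y\<rbrakk>
      \<Longrightarrow> \<exists>u \<in> hom C T (apex P). leg1 P \<cdot> u = a \<and> leg2 P \<cdot> u = b"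
    and uq: "\<And>T u v. \<lbrakk>u \<in> hom C T (apex P); v \<in> hom C T (apex P);
        leg1 P \<cdot> u = leg1 P \<cdot> v; leg2 P \<cdot> u = leg2 P \<cdot> v\<rbrakk> \<Longrightarrow> u = v"
  shows "is_product C X Y P"
  unfolding is_product_def
proof (intro conjI allI impI)
  show "is_span C X Y P"
    using assms(1,2) hom_Obj by (auto simp: is_span_def)
  fix Q assume "is_span C X Y Q"
  hence "\<exists>u \<in> hom C (apex Q) (apex P). leg1 P \<cdot> u = leg1 Q \<and> leg2 P \<cdot> u = leg2 Q"
    by (intro ex) (auto simp: is_span_def)
  thus "\<exists>!u. u \<in> hom C (apex Q) (apex P) \<and> leg1 P \<cdot> u = leg1 Q \<and> leg2 P \<cdot> u = leg2 Q"
    using uq by metis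
qed

text \<open>Turns monicity into a limit condition, so that functors preserving pullbacks preserve
  monomorphisms.\<close>

lemma monic_iff_pullback:
  assumes m: "m \<in> Arr C"
  shows "monic C m \<longleftrightarrow> is_pullback C m m \<lparr>apex = Dom C m, leg1 = Ide C (Dom C m), leg2 = Ide C (Dom C m)\<rparr>"
    (is "_ \<longleftrightarrow> is_pullback C m m ?P")
proof
  assume mm: "monic C m"
  show "is_pullback C m m ?P"
  proof (rule is_pullbackI)
    fix T a b assume ab: "a \<in> hom C T (Dom C m)" "b \<in> hom C T (Dom C m)" "m \<cdot> a = m \<cdot> b"
    hence "a = b" using monicD[OF mm] by blast
    thus "\<exists>u\<in>hom C T (apex ?P). leg1 ?P \<cdot> u = a \<and> leg2 ?P \<cdot> u = b"
      using ab by (intro bexI[of _ a]) (auto simp: hom_iff)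
  qed (use m Dom_in_Obj[OF m] in \<open>auto simp: hom_iff\<close>)
next
  assume P: "is_pullback C m m ?P"
  show "monic C m" unfolding monic_def
  proof (intro conjI ballI impI m)
    fix T u v assume uv: "u \<in> hom C T (Dom C m)" "v \<in> hom C T (Dom C m)" "m \<cdot> u = m \<cdot> v"
    then obtain w where "w \<in> hom C T (Dom C m)" "Ide C (Dom C m) \<cdot> w = u" "Ide C (Dom C m) \<cdot> w = v"
      using pullback_lift[OF P, of u T v] by auto
    thus "u = v" by simp
  qed
qed

end

lemma is_limitD:
  assumes "is_limit J C Fo Fa L \<pi>"
  shows "is_cone J C Fo Fa L \<pi>"
    "L \<in> Obj C" "i \<in> Obj J \<Longrightarrow> \<pi> i \<in> hom C L (Fo i)"
    "f \<in> Arr J \<Longrightarrow> Fa f \<cdot>\<^bsub>C\<^esub> \<pi> (Dom J f) = \<pi> (Cod J f)"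
  using assms by (auto simp: is_limit_def is_cone_def)

lemma limit_lift:
  assumes "is_limit J C Fo Fa L \<pi>" "is_cone J C Fo Fa T \<tau>"
  obtains u where "u \<in> hom C T L" "\<And>i. i \<in> Obj J \<Longrightarrow> \<pi> i \<cdot>\<^bsub>C\<^esub> u = \<tau> i"
  using assms unfolding is_limit_def by metis

context category
begin

lemma cone_comp:
  assumes c: "is_cone J C Fo Fa L \<pi>" and J: "category J" and F: "is_functor J C Fo Fa"
    and u: "u \<in> hom C T L"
  shows "is_cone J C Fo Fa T (\<lambda>i. \<pi> i \<cdot> u)"
  unfolding is_cone_def
proof (intro conjI ballI)
  show "T \<in> Obj C" using hom_Obj[OF u] by simp
  show "\<pi> i \<cdot> u \<in> hom C T (Fo i)" if "i \<in> Obj J" for i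
    using c u that by (auto simp: is_cone_def hom_iff)
  fix f assume f: "f \<in> Arr J"
  have D: "Dom J f \<in> Obj J" using J f by (simp add: category.Dom_in_Obj)
  have "Fa f \<in> hom C (Fo (Dom J f)) (Fo (Cod J f))" using F f by (auto simp: is_functor_def)
  moreover have "\<pi> (Dom J f) \<in> hom C L (Fo (Dom J f))" using c D by (auto simp: is_cone_def)
  moreover have "Fa f \<cdot> \<pi> (Dom J f) = \<pi> (Cod J f)" using c f by (auto simp: is_cone_def)
  ultimately show "Fa f \<cdot> (\<pi> (Dom J f) \<cdot> u) = \<pi> (Cod J f) \<cdot> u"
    using u reassoc by blast
qed

lemma limit_eqI:
  assumes l: "is_limit J C Fo Fa L \<pi>" and J: "category J" and F: "is_functor J C Fo Fa"
    and u: "u \<in> hom C T L" and v: "v \<in> hom C T L"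
    and eq: "\<And>i. i \<in> Obj J \<Longrightarrow> \<pi> i \<cdot> u = \<pi> i \<cdot> v"
  shows "u = v"
proof -
  have "is_cone J C Fo Fa T (\<lambda>i. \<pi> i \<cdot> u)"
    using is_limitD(1)[OF l] J F u by (rule cone_comp)
  with l have "\<exists>!w. w \<in> hom C T L \<and> (\<forall>i\<in>Obj J. \<pi> i \<cdot> w = \<pi> i \<cdot> u)"
    unfolding is_limit_def by blast
  thus ?thesis using u v eq by metis
qed

lemma limit_comparison:
  assumes l: "is_limit J C Fo Fa L \<pi>" and l': "is_limit J C Fo Fa L' \<pi>'"
    and J: "category J" and F: "is_functor J C Fo Fa"
  obtains i j where "i \<in> hom C L' L" "j \<in> hom C L L'" "j \<cdot> i = Ide C L'" "i \<cdot> j = Ide C L"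
    "\<And>k. k \<in> Obj J \<Longrightarrow> \<pi> k \<cdot> i = \<pi>' k"
proof -
  obtain i where i: "i \<in> hom C L' L" "\<And>k. k \<in> Obj J \<Longrightarrow> \<pi> k \<cdot> i = \<pi>' k"
    using limit_lift[OF l is_limitD(1)[OF l']] by blast
  obtain j where j: "j \<in> hom C L L'" "\<And>k. k \<in> Obj J \<Longrightarrow> \<pi>' k \<cdot> j = \<pi> k"
    using limit_lift[OF l' is_limitD(1)[OF l]] by blast
  have "i \<cdot> j = Ide C L"
  proof (rule limit_eqI[OF l J F])
    show "i \<cdot> j \<in> hom C L L" "Ide C L \<in> hom C L L" using i j hom_Obj by (auto simp: hom_iff)
    fix k assume k: "k \<in> Obj J"
    show "\<pi> k \<cdot> (i \<cdot> j) = \<pi> k \<cdot> Ide C L"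
      using reassoc[OF i(2)[OF k] i(1) is_limitD(3)[OF l k] j(1)] j(2)[OF k] is_limitD(3)[OF l k]
      by (simp add: hom_iff)
  qed
  moreover have "j \<cdot> i = Ide C L'"
  proof (rule limit_eqI[OF l' J F])
    show "j \<cdot> i \<in> hom C L' L'" "Ide C L' \<in> hom C L' L'" using i j hom_Obj by (auto simp: hom_iff)
    fix k assume k: "k \<in> Obj J"
    show "\<pi>' k \<cdot> (j \<cdot> i) = \<pi>' k \<cdot> Ide C L'"
      using reassoc[OF j(2)[OF k] j(1) is_limitD(3)[OF l' k] i(1)] i(2)[OF k] is_limitD(3)[OF l' k]
      by (simp add: hom_iff)
  qed
  ultimately show ?thesis using that i j by blast
qed

text \<open>Also applied with the identity as isomorphism: a cone is a total function, so two
  presentations of one limit may differ outside \<open>Obj J\<close>, and only agreement on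
  \<open>Obj J\<close> is demanded here.\<close>

lemma limit_transport:
  assumes l: "is_limit J C Fo Fa L \<pi>" and J: "category J" and F: "is_functor J C Fo Fa"
    and i: "i \<in> hom C L' L" and j: "j \<in> hom C L L'" and ji: "j \<cdot> i = Ide C L'" and ij: "i \<cdot> j = Ide C L"
    and eq: "\<And>k. k \<in> Obj J \<Longrightarrow> \<pi> k \<cdot> i = \<pi>' k"
  shows "is_limit J C Fo Fa L' \<pi>'"
  unfolding is_limit_def
proof (intro conjI allI impI)
  have "is_cone J C Fo Fa L' (\<lambda>k. \<pi> k \<cdot> i)" using is_limitD(1)[OF l] J F i by (rule cone_comp)
  moreover have "Dom J f \<in> Obj J" "Cod J f \<in> Obj J" if "f \<in> Arr J" for f
    using J that by (auto simp: category.Dom_in_Obj category.Cod_in_Obj)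
  ultimately show "is_cone J C Fo Fa L' \<pi>'" using eq by (simp add: is_cone_def)
  fix T \<tau> assume "is_cone J C Fo Fa T \<tau>"
  then obtain u where u: "u \<in> hom C T L" "\<And>k. k \<in> Obj J \<Longrightarrow> \<pi> k \<cdot> u = \<tau> k"
    using limit_lift[OF l] by blast
  show "\<exists>!u. u \<in> hom C T L' \<and> (\<forall>k\<in>Obj J. \<pi>' k \<cdot> u = \<tau> k)"
  proof (intro ex1I[of _ "j \<cdot> u"] conjI ballI)
    show "j \<cdot> u \<in> hom C T L'" using u j by (auto simp: hom_iff)
    fix k assume k: "k \<in> Obj J"
    have "i \<cdot> (j \<cdot> u) = u" using reassoc[OF ij j i u(1)] u(1) by (simp add: hom_iff)
    thus "\<pi>' k \<cdot> (j \<cdot> u) = \<tau> k"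
      using reassoc[OF eq[OF k] i is_limitD(3)[OF l k] Comp_in_hom[OF u(1) j]] u(2)[OF k] by simp
  next
    fix v assume v: "v \<in> hom C T L' \<and> (\<forall>k\<in>Obj J. \<pi>' k \<cdot> v = \<tau> k)"
    have "i \<cdot> v = u"
    proof (rule limit_eqI[OF l J F])
      show "i \<cdot> v \<in> hom C T L" "u \<in> hom C T L" using i v u by (auto simp: hom_iff)
      show "\<pi> k \<cdot> (i \<cdot> v) = \<pi> k \<cdot> u" if k: "k \<in> Obj J" for k
        using reassoc[OF eq[OF k] i is_limitD(3)[OF l k], of v T] v u(2)[OF k] k by simp
    qed
    thus "v = j \<cdot> u" using reassoc[OF ji i j, of v T] v by (auto simp: hom_iff)
  qed
qed

end

text \<open>The shape 0 -> 2 <- 1 with non-identity arrows 3 and 4; the numbers 0, 1, 2 double as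
  identities. If \<open>f\<close> is an identity then the composite is \<open>g\<close>; otherwise
  \<open>f\<close> ends at 2, so a composable \<open>g\<close> is the identity of 2 and the
  composite is \<open>f\<close>.\<close>

definition cospan_cat :: "(nat, nat) cat" where
  "cospan_cat = \<lparr>Obj = {0, 1, 2}, Arr = {0, 1, 2, 3, 4},
     Dom = (\<lambda>k. if k = 3 then 0 else if k = 4 then 1 else k), Cod = (\<lambda>k. if k \<ge> 3 then 2 else k),
     Ide = id, Comp = (\<lambda>g f. if f < 3 then g else f)\<rparr>"

definition pair_cat :: "(nat, nat) cat" where
  "pair_cat = \<lparr>Obj = {0, 1}, Arr = {0, 1}, Dom = id, Cod = id, Ide = id, Comp = (\<lambda>g f. f)\<rparr>"

lemma category_cospan_cat: "category cospan_cat"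
  by unfold_locales (auto simp: cospan_cat_def hom_def)

lemma category_pair_cat: "category pair_cat"
  by unfold_locales (auto simp: pair_cat_def hom_def)

context category
begin

definition cospan_Fo :: "'a \<Rightarrow> 'a \<Rightarrow> nat \<Rightarrow> 'o" where
  "cospan_Fo f g i = (if i = 0 then Dom C f else if i = 1 then Dom C g else Cod C f)"

definition cospan_Fa :: "'a \<Rightarrow> 'a \<Rightarrow> nat \<Rightarrow> 'a" where
  "cospan_Fa f g k = (if k = 3 then f else if k = 4 then g else Ide C (cospan_Fo f g k))"

definition cospan_cone :: "'a \<Rightarrow> ('o, 'a) span \<Rightarrow> nat \<Rightarrow> 'a" where
  "cospan_cone f P i = (if i = 0 then leg1 P else if i = 1 then leg2 P else f \<cdot> leg1 P)"

lemma cospan_functor: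
  assumes "f \<in> Arr C" "g \<in> Arr C" "Cod C f = Cod C g"
  shows "is_functor cospan_cat C (cospan_Fo f g) (cospan_Fa f g)"
  using assms Dom_in_Obj[OF assms(1)] Dom_in_Obj[OF assms(2)] Cod_in_Obj[OF assms(2)]
  by (auto simp: is_functor_def cospan_cat_def cospan_Fo_def cospan_Fa_def hom_iff)

lemma cospan_cone_iff:
  assumes "f \<in> Arr C" "g \<in> Arr C" "Cod C f = Cod C g"
  shows "is_cone cospan_cat C (cospan_Fo f g) (cospan_Fa f g) T \<tau> \<longleftrightarrow>
    \<tau> 0 \<in> hom C T (Dom C f) \<and> \<tau> 1 \<in> hom C T (Dom C g) \<and> f \<cdot> \<tau> 0 = g \<cdot> \<tau> 1 \<and> \<tau> 2 = f \<cdot> \<tau> 0"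
  using assms Dom_in_Obj[OF assms(1)] Dom_in_Obj[OF assms(2)] Cod_in_Obj[OF assms(2)] hom_Obj
  by (auto simp: is_cone_def cospan_cat_def cospan_Fo_def cospan_Fa_def hom_iff)

text \<open>Lets one theorem about arbitrary finite limits of connectors cover pullbacks. The leg to
  the vertex 2 carries no information, since a cone forces it to be the composite through either
  foot.\<close>

lemma pullback_iff_limit:
  assumes fg: "f \<in> Arr C" "g \<in> Arr C" "Cod C f = Cod C g"
  shows "is_pullback C f g P \<longleftrightarrow>
    is_limit cospan_cat C (cospan_Fo f g) (cospan_Fa f g) (apex P) (cospan_cone f P)"
    (is "_ \<longleftrightarrow> is_limit ?J C ?Fo ?Fa _ ?\<pi>")
proof
  have J: "i \<in> Obj ?J \<longleftrightarrow> i = 0 \<or> i = 1 \<or> i = 2" for i by (auto simp: cospan_cat_def)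
  note cone = cospan_cone_iff[OF fg]
  {
    assume P: "is_pullback C f g P"
    note D = is_pullbackD[OF P]
    show "is_limit ?J C ?Fo ?Fa (apex P) ?\<pi>" unfolding is_limit_def
    proof (intro conjI allI impI)
      show "is_cone ?J C ?Fo ?Fa (apex P) ?\<pi>" using D by (simp add: cone cospan_cone_def)
      fix T \<tau> assume "is_cone ?J C ?Fo ?Fa T \<tau>"
      hence c: "\<tau> 0 \<in> hom C T (Dom C f)" "\<tau> 1 \<in> hom C T (Dom C g)" "f \<cdot> \<tau> 0 = g \<cdot> \<tau> 1" "\<tau> 2 = f \<cdot> \<tau> 0"
        by (auto simp: cone)
      obtain u where u: "u \<in> hom C T (apex P)" "leg1 P \<cdot> u = \<tau> 0" "leg2 P \<cdot> u = \<tau> 1"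
        by (rule pullback_lift[OF P c(1-3)])
      have fu: "(f \<cdot> leg1 P) \<cdot> u = f \<cdot> \<tau> 0"
        using Comp_assoc[OF u(1) D(5), of f "Cod C f"] D(1) u(2) by (simp only: hom_iff simp_thms)
      show "\<exists>!u. u \<in> hom C T (apex P) \<and> (\<forall>i\<in>Obj ?J. ?\<pi> i \<cdot> u = \<tau> i)"
      proof (intro ex1I[of _ u] conjI ballI u(1))
        show "?\<pi> i \<cdot> u = \<tau> i" if "i \<in> Obj ?J" for i
          using that u(2,3) fu c(4) by (auto simp: J cospan_cone_def)
        fix v assume v: "v \<in> hom C T (apex P) \<and> (\<forall>i\<in>Obj ?J. ?\<pi> i \<cdot> v = \<tau> i)"
        show "v = u"
        proof (rule pullback_eqI[OF P _ u(1)])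
          show "v \<in> hom C T (apex P)" "leg1 P \<cdot> v = leg1 P \<cdot> u" "leg2 P \<cdot> v = leg2 P \<cdot> u"
            using v bspec[OF conjunct2[OF v], of 0] bspec[OF conjunct2[OF v], of 1] u(2,3)
            by (auto simp: J cospan_cone_def)
        qed
      qed
    qed
  next
    assume l: "is_limit ?J C ?Fo ?Fa (apex P) ?\<pi>"
    have c: "leg1 P \<in> hom C (apex P) (Dom C f)" "leg2 P \<in> hom C (apex P) (Dom C g)"
      "f \<cdot> leg1 P = g \<cdot> leg2 P"
      using is_limitD(1)[OF l] by (auto simp: cone cospan_cone_def)
    show "is_pullback C f g P"
    proof (rule is_pullbackI[OF fg c])
      fix T a b assume ab: "a \<in> hom C T (Dom C f)" "b \<in> hom C T (Dom C g)" "f \<cdot> a = g \<cdot> b"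
      let ?\<tau> = "\<lambda>i::nat. if i = 0 then a else if i = 1 then b else f \<cdot> a"
      have "is_cone ?J C ?Fo ?Fa T ?\<tau>" using ab by (simp add: cone)
      then obtain u where "u \<in> hom C T (apex P)" "\<And>i. i \<in> Obj ?J \<Longrightarrow> ?\<pi> i \<cdot> u = ?\<tau> i"
        using limit_lift[OF l] by blast
      from this(1) this(2)[of 0] this(2)[of 1]
      show "\<exists>u\<in>hom C T (apex P). leg1 P \<cdot> u = a \<and> leg2 P \<cdot> u = b"
        by (intro bexI[of _ u]) (auto simp: J cospan_cone_def)
    next
      fix T u v assume uv: "u \<in> hom C T (apex P)" "v \<in> hom C T (apex P)"
        "leg1 P \<cdot> u = leg1 P \<cdot> v" "leg2 P \<cdot> u = leg2 P \<cdot> v"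
      show "u = v"
      proof (rule limit_eqI[OF l category_cospan_cat cospan_functor[OF fg] uv(1,2)])
        show "?\<pi> i \<cdot> u = ?\<pi> i \<cdot> v" if "i \<in> Obj ?J" for i
          using that uv c fg by (auto simp: J cospan_cone_def hom_iff Comp_assoc_right)
      qed
    qed
  }
qed

definition pair_Fo :: "'o \<Rightarrow> 'o \<Rightarrow> nat \<Rightarrow> 'o" where
  "pair_Fo X Y i = (if i = 0 then X else Y)"

definition pair_Fa :: "'o \<Rightarrow> 'o \<Rightarrow> nat \<Rightarrow> 'a" where
  "pair_Fa X Y k = Ide C (pair_Fo X Y k)"

definition pair_cone :: "('o, 'a) span \<Rightarrow> nat \<Rightarrow> 'a" where
  "pair_cone P i = (if i = 0 then leg1 P else leg2 P)"

lemma pair_functor: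
  assumes "X \<in> Obj C" "Y \<in> Obj C"
  shows "is_functor pair_cat C (pair_Fo X Y) (pair_Fa X Y)"
  using assms by (auto simp: is_functor_def pair_cat_def pair_Fo_def pair_Fa_def hom_iff)

lemma pair_cone_iff:
  assumes "X \<in> Obj C" "Y \<in> Obj C"
  shows "is_cone pair_cat C (pair_Fo X Y) (pair_Fa X Y) T \<tau> \<longleftrightarrow> \<tau> 0 \<in> hom C T X \<and> \<tau> 1 \<in> hom C T Y"
  using assms hom_Obj by (auto simp: is_cone_def pair_cat_def pair_Fo_def pair_Fa_def hom_iff)

lemma product_iff_limit:
  assumes XY: "X \<in> Obj C" "Y \<in> Obj C"
  shows "is_product C X Y P \<longleftrightarrow>
    is_limit pair_cat C (pair_Fo X Y) (pair_Fa X Y) (apex P) (pair_cone P)"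
    (is "_ \<longleftrightarrow> is_limit ?J C ?Fo ?Fa _ ?\<pi>")
proof
  have J: "i \<in> Obj ?J \<longleftrightarrow> i = 0 \<or> i = 1" for i by (auto simp: pair_cat_def)
  note cone = pair_cone_iff[OF XY]
  {
    assume P: "is_product C X Y P"
    note D = is_productD[OF P]
    show "is_limit ?J C ?Fo ?Fa (apex P) ?\<pi>" unfolding is_limit_def
    proof (intro conjI allI impI)
      show "is_cone ?J C ?Fo ?Fa (apex P) ?\<pi>" using D by (simp add: cone pair_cone_def)
      fix T \<tau> assume "is_cone ?J C ?Fo ?Fa T \<tau>"
      hence c: "\<tau> 0 \<in> hom C T X" "\<tau> 1 \<in> hom C T Y" by (auto simp: cone)
      obtain u where u: "u \<in> hom C T (apex P)" "leg1 P \<cdot> u = \<tau> 0" "leg2 P \<cdot> u = \<tau> 1"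
        by (rule product_lift[OF P c])
      show "\<exists>!u. u \<in> hom C T (apex P) \<and> (\<forall>i\<in>Obj ?J. ?\<pi> i \<cdot> u = \<tau> i)"
      proof (intro ex1I[of _ u] conjI ballI u(1))
        show "?\<pi> i \<cdot> u = \<tau> i" if "i \<in> Obj ?J" for i
          using that u by (auto simp: J pair_cone_def)
        fix v assume v: "v \<in> hom C T (apex P) \<and> (\<forall>i\<in>Obj ?J. ?\<pi> i \<cdot> v = \<tau> i)"
        show "v = u"
        proof (rule product_eqI[OF P _ u(1)])
          show "v \<in> hom C T (apex P)" "leg1 P \<cdot> v = leg1 P \<cdot> u" "leg2 P \<cdot> v = leg2 P \<cdot> u"
            using v bspec[OF conjunct2[OF v], of 0] bspec[OF conjunct2[OF v], of 1] u(2,3)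
            by (auto simp: J pair_cone_def)
        qed
      qed
    qed
  next
    assume l: "is_limit ?J C ?Fo ?Fa (apex P) ?\<pi>"
    have c: "leg1 P \<in> hom C (apex P) X" "leg2 P \<in> hom C (apex P) Y"
      using is_limitD(1)[OF l] by (auto simp: cone pair_cone_def)
    show "is_product C X Y P"
    proof (rule is_productI[OF c])
      fix T a b assume ab: "a \<in> hom C T X" "b \<in> hom C T Y"
      let ?\<tau> = "\<lambda>i::nat. if i = 0 then a else b"
      have "is_cone ?J C ?Fo ?Fa T ?\<tau>" using ab by (simp add: cone)
      then obtain u where "u \<in> hom C T (apex P)" "\<And>i. i \<in> Obj ?J \<Longrightarrow> ?\<pi> i \<cdot> u = ?\<tau> i"
        using limit_lift[OF l] by blast
      from this(1) this(2)[of 0] this(2)[of 1]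
      show "\<exists>u\<in>hom C T (apex P). leg1 P \<cdot> u = a \<and> leg2 P \<cdot> u = b"
        by (intro bexI[of _ u]) (auto simp: J pair_cone_def)
    next
      fix T u v assume uv: "u \<in> hom C T (apex P)" "v \<in> hom C T (apex P)"
        "leg1 P \<cdot> u = leg1 P \<cdot> v" "leg2 P \<cdot> u = leg2 P \<cdot> v"
      show "u = v"
      proof (rule limit_eqI[OF l category_pair_cat pair_functor[OF XY] uv(1,2)])
        show "?\<pi> i \<cdot> u = ?\<pi> i \<cdot> v" if "i \<in> Obj ?J" for i
          using that uv by (auto simp: J pair_cone_def)
      qed
    qed
  }
qed

end

section \<open>Generalised elements in regular categories\<close>

context category
begin

lemma is_relationD:
  assumes "is_relation C X Y R"
  shows "X \<in> Obj C" "Y \<in> Obj C" "apex R \<in> Obj C" "leg1 R \<in> hom C (apex R) X" "leg2 R \<in> hom C (apex R) Y"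
  using assms hom_Obj by (auto simp: is_relation_def is_span_def)

text \<open>Joint monicity of the legs: the product separates the pairings of the two arrows, and
  the pairing of the legs is monic.\<close>

lemma relation_eqI:
  assumes R: "is_relation C X Y R" and u: "u \<in> hom C T (apex R)" and v: "v \<in> hom C T (apex R)"
    and 1: "leg1 R \<cdot> u = leg1 R \<cdot> v" and 2: "leg2 R \<cdot> u = leg2 R \<cdot> v"
  shows "u = v"
proof -
  obtain P m where P: "is_product C X Y P" and m: "m \<in> hom C (apex R) (apex P)" "monic C m"
    and eq: "leg1 P \<cdot> m = leg1 R" "leg2 P \<cdot> m = leg2 R"
    using R by (auto simp: is_relation_def is_pairing_def)
  note D = is_productD[OF P]
  have "m \<cdot> u = m \<cdot> v"
  proof (rule product_eqI[OF P])
    show "m \<cdot> u \<in> hom C T (apex P)" "m \<cdot> v \<in> hom C T (apex P)"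
      using u v m Comp_in_hom by blast+
    show "leg1 P \<cdot> (m \<cdot> u) = leg1 P \<cdot> (m \<cdot> v)"
      using reassoc[OF eq(1) m(1) D(4) u] reassoc[OF eq(1) m(1) D(4) v] 1 by metis
    show "leg2 P \<cdot> (m \<cdot> u) = leg2 P \<cdot> (m \<cdot> v)"
      using reassoc[OF eq(2) m(1) D(5) u] reassoc[OF eq(2) m(1) D(5) v] 2 by metis
  qed
  moreover have "Dom C m = apex R" using m by (simp add: hom_iff)
  ultimately show ?thesis using monicD[OF m(2), of u T v] u v by simp
qed

lemma relatedI:
  "\<lbrakk>h \<in> hom C T (apex R); leg1 R \<cdot> h = x; leg2 R \<cdot> h = y\<rbrakk> \<Longrightarrow> related C R T x y"
  by (auto simp: related_def)

lemma relatedE: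
  assumes "related C R T x y"
  obtains h where "h \<in> hom C T (apex R)" "leg1 R \<cdot> h = x" "leg2 R \<cdot> h = y"
  using assms by (auto simp: related_def)

lemma related_hom:
  assumes "is_relation C X Y R" "related C R T x y"
  shows "x \<in> hom C T X" "y \<in> hom C T Y"
  using assms(2) is_relationD(4,5)[OF assms(1)] Comp_in_hom by (auto simp: related_def)

lemma related_comp:
  assumes R: "is_relation C X Y R" and r: "related C R T x y" and q: "q \<in> hom C T' T"
  shows "related C R T' (x \<cdot> q) (y \<cdot> q)"
proof -
  obtain h where h: "h \<in> hom C T (apex R)" "leg1 R \<cdot> h = x" "leg2 R \<cdot> h = y"
    using r by (rule relatedE)
  note D = is_relationD[OF R]
  show ?thesis
    using Comp_in_hom[OF q h(1)] reassoc[OF h(2) h(1) D(4) q] reassoc[OF h(3) h(1) D(5) q]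
    by (rule relatedI)
qed

lemma related_legs:
  assumes "is_relation C X Y R"
  shows "related C R (apex R) (leg1 R) (leg2 R)"
proof (rule relatedI)
  show "Ide C (apex R) \<in> hom C (apex R) (apex R)" using Ide_in_hom is_relationD(3)[OF assms] .
  show "leg1 R \<cdot> Ide C (apex R) = leg1 R" "leg2 R \<cdot> Ide C (apex R) = leg2 R"
    using is_relationD(4,5)[OF assms] Comp_Ide_right by auto
qed

lemma is_equivalence_relation: "is_equivalence C X R \<Longrightarrow> is_relation C X X R"
  by (simp add: is_equivalence_def)

lemma related_refl:
  assumes R: "is_equivalence C X R" and x: "x \<in> hom C T X"
  shows "related C R T x x"
proof -
  obtain d where d: "d \<in> hom C X (apex R)" "leg1 R \<cdot> d = Ide C X" "leg2 R \<cdot> d = Ide C X"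
    using R by (auto simp: is_equivalence_def)
  have "related C R X (Ide C X) (Ide C X)" using d by (rule relatedI)
  from related_comp[OF is_equivalence_relation[OF R] this x] show ?thesis
    using Comp_Ide_left[OF x] by simp
qed

lemma related_sym:
  assumes R: "is_equivalence C X R" and r: "related C R T x y"
  shows "related C R T y x"
proof -
  obtain s where s: "s \<in> hom C (apex R) (apex R)" "leg1 R \<cdot> s = leg2 R" "leg2 R \<cdot> s = leg1 R"
    using R by (auto simp: is_equivalence_def)
  obtain h where h: "h \<in> hom C T (apex R)" "leg1 R \<cdot> h = x" "leg2 R \<cdot> h = y"
    using r by (rule relatedE)
  note D = is_relationD[OF is_equivalence_relation[OF R]]
  show ?thesis
    using reassoc[OF s(2) s(1) D(4) h(1)] reassoc[OF s(3) s(1) D(5) h(1)] h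
    by (intro relatedI[of "s \<cdot> h"]) (auto intro: Comp_in_hom[OF h(1) s(1)])
qed

lemma related_trans:
  assumes R: "is_equivalence C X R" and r: "related C R T x y" and r': "related C R T y z"
  shows "related C R T x z"
proof -
  obtain W t where W: "is_pullback C (leg2 R) (leg1 R) W" and t: "t \<in> hom C (apex W) (apex R)"
    "leg1 R \<cdot> t = leg1 R \<cdot> leg1 W" "leg2 R \<cdot> t = leg2 R \<cdot> leg2 W"
    using R by (auto simp: is_equivalence_def)
  obtain h where h: "h \<in> hom C T (apex R)" "leg1 R \<cdot> h = x" "leg2 R \<cdot> h = y"
    using r by (rule relatedE)
  obtain k where k: "k \<in> hom C T (apex R)" "leg1 R \<cdot> k = y" "leg2 R \<cdot> k = z"
    using r' by (rule relatedE)
  note D = is_relationD[OF is_equivalence_relation[OF R]]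
  have dom: "Dom C (leg1 R) = apex R" "Dom C (leg2 R) = apex R" using D by (auto simp: hom_iff)
  obtain w where w: "w \<in> hom C T (apex W)" "leg1 W \<cdot> w = h" "leg2 W \<cdot> w = k"
    using pullback_lift[OF W, of h T k] h k dom by auto
  have l: "leg1 W \<in> hom C (apex W) (apex R)" "leg2 W \<in> hom C (apex W) (apex R)"
    using is_pullbackD(5,6)[OF W] dom by auto
  show ?thesis
  proof (rule relatedI)
    show "t \<cdot> w \<in> hom C T (apex R)" using w(1) t(1) by (rule Comp_in_hom)
    show "leg1 R \<cdot> (t \<cdot> w) = x"
      using reassoc[OF t(2) t(1) D(4) w(1)] Comp_assoc[OF w(1) l(1) D(4)] w(2) h(2) by metis
    show "leg2 R \<cdot> (t \<cdot> w) = z"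
      using reassoc[OF t(3) t(1) D(5) w(1)] Comp_assoc[OF w(1) l(2) D(5)] w(3) k(3) by metis
  qed
qed

lemma finitely_complete_pullback:
  assumes fc: "finitely_complete C" and fg: "f \<in> Arr C" "g \<in> Arr C" "Cod C f = Cod C g"
  obtains P where "is_pullback C f g P"
proof -
  have fin: "finite (Obj cospan_cat)" "finite (Arr cospan_cat)" by (auto simp: cospan_cat_def)
  obtain L \<pi> where l: "is_limit cospan_cat C (cospan_Fo f g) (cospan_Fa f g) L \<pi>"
    using fc category_cospan_cat fin cospan_functor[OF fg]
    unfolding finitely_complete_def by blast
  let ?P = "\<lparr>apex = L, leg1 = \<pi> 0, leg2 = \<pi> 1\<rparr>"
  have "f \<cdot> \<pi> 0 = \<pi> 2"
    using is_limitD(4)[OF l, of 3] by (auto simp: cospan_cat_def cospan_Fa_def)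
  hence "\<pi> k = cospan_cone f ?P k" if "k \<in> Obj cospan_cat" for k
    using that by (auto simp: cospan_cat_def cospan_cone_def)
  moreover have "\<pi> k \<cdot> Ide C L = \<pi> k" if "k \<in> Obj cospan_cat" for k
    using is_limitD(3)[OF l that] by (rule Comp_Ide_right)
  ultimately have "is_limit cospan_cat C (cospan_Fo f g) (cospan_Fa f g) (apex ?P) (cospan_cone f ?P)"
    using is_limitD(2)[OF l] Ide_in_hom[OF is_limitD(2)[OF l]]
    by (intro limit_transport[OF l category_cospan_cat cospan_functor[OF fg], of "Ide C L" _ "Ide C L"])
      auto
  with that show ?thesis using pullback_iff_limit[OF fg] by blast
qed

end

section \<open>Covers, images and local arguments in a regular category\<close>

context regular_category
begin

lemmas pullback_ex = finitely_complete_pullback[OF finitely_complete]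

lemma pullback_is_pullback:
  assumes "f \<in> Arr C" "g \<in> Arr C" "Cod C f = Cod C g"
  shows "is_pullback C f g (pullback C f g)"
  unfolding pullback_def using pullback_ex[OF assms] by (metis someI)

lemma product_ex:
  assumes "X \<in> Obj C" "Y \<in> Obj C"
  obtains P where "is_product C X Y P"
proof -
  have fin: "finite (Obj pair_cat)" "finite (Arr pair_cat)" by (auto simp: pair_cat_def)
  obtain L \<pi> where l: "is_limit pair_cat C (pair_Fo X Y) (pair_Fa X Y) L \<pi>"
    using finitely_complete category_pair_cat fin pair_functor[OF assms]
    unfolding finitely_complete_def by blast
  let ?P = "\<lparr>apex = L, leg1 = \<pi> 0, leg2 = \<pi> 1\<rparr>"
  have "\<pi> k = pair_cone ?P k" if "k \<in> Obj pair_cat" for k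
    using that by (auto simp: pair_cat_def pair_cone_def)
  moreover have "\<pi> k \<cdot> Ide C L = \<pi> k" if "k \<in> Obj pair_cat" for k
    using is_limitD(3)[OF l that] by (rule Comp_Ide_right)
  ultimately have "is_limit pair_cat C (pair_Fo X Y) (pair_Fa X Y) (apex ?P) (pair_cone ?P)"
    using is_limitD(2)[OF l] Ide_in_hom[OF is_limitD(2)[OF l]]
    by (intro limit_transport[OF l category_pair_cat pair_functor[OF assms], of "Ide C L" _ "Ide C L"])
      auto
  with that show ?thesis using product_iff_limit[OF assms] by blast
qed

text \<open>Manufactures an arrow whose kernel pair is the intersection of two given ones. Only this
  kernel pair matters later, so the product itself is hidden.\<close>

lemma pairing_ex:
  assumes a: "a \<in> hom C A X" and b: "b \<in> hom C A Y"
  obtains m Z where "m \<in> hom C A Z"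
    "\<And>T u v. \<lbrakk>u \<in> hom C T A; v \<in> hom C T A\<rbrakk> \<Longrightarrow> m \<cdot> u = m \<cdot> v \<longleftrightarrow> a \<cdot> u = a \<cdot> v \<and> b \<cdot> u = b \<cdot> v"
proof -
  obtain P where P: "is_product C X Y P" using product_ex hom_Obj a b by metis
  note D = is_productD[OF P]
  obtain m where m: "m \<in> hom C A (apex P)" "leg1 P \<cdot> m = a" "leg2 P \<cdot> m = b"
    using product_lift[OF P a b] .
  show ?thesis
  proof (rule that[OF m(1)])
    fix T u v assume u: "u \<in> hom C T A" and v: "v \<in> hom C T A"
    note r = reassoc[OF m(2) m(1) D(4) u] reassoc[OF m(2) m(1) D(4) v]
      reassoc[OF m(3) m(1) D(5) u] reassoc[OF m(3) m(1) D(5) v]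
    show "m \<cdot> u = m \<cdot> v \<longleftrightarrow> a \<cdot> u = a \<cdot> v \<and> b \<cdot> u = b \<cdot> v"
    proof
      show "m \<cdot> u = m \<cdot> v \<Longrightarrow> a \<cdot> u = a \<cdot> v \<and> b \<cdot> u = b \<cdot> v" using r by metis
      assume "a \<cdot> u = a \<cdot> v \<and> b \<cdot> u = b \<cdot> v"
      with r show "m \<cdot> u = m \<cdot> v"
        by (intro product_eqI[OF P Comp_in_hom[OF u m(1)] Comp_in_hom[OF v m(1)]]) metis+
    qed
  qed
qed

text \<open>The pullback of \<open>e\<close> along \<open>b\<close> does it: stability makes its
  second leg a cover, and its first leg is the lift.\<close>

lemma cover_pullback:
  assumes e: "cover C e A B" and b: "b \<in> hom C T B"
  obtains T' q a where "cover C q T' T" "a \<in> hom C T' A" "e \<cdot> a = b \<cdot> q"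
proof -
  have e': "e \<in> hom C A B" "regular_epi C e" using e by (auto simp: cover_def)
  obtain P where P: "is_pullback C e b P"
    using pullback_ex[of e b] e' b by (auto simp: hom_iff)
  note D = is_pullbackD[OF P]
  show ?thesis
    using D e' b regular_epi_stable[OF P e'(2)]
    by (intro that[of "leg2 P" "apex P" "leg1 P"]) (auto simp: cover_def hom_iff)
qed

text \<open>Two arrows into the coequaliser are lifted along it on a common cover, where their equality
  under the comparison arrow becomes membership in the kernel pair.\<close>

lemma coequaliser_kernel_monic:
  assumes P: "is_pullback C f f P" and e: "is_coequaliser C (leg1 P) (leg2 P) e"
    and m: "m \<in> hom C (Cod C e) (Cod C f)" and me: "m \<cdot> e = f"
  shows "monic C m"
  unfolding monic_def
proof (intro conjI ballI impI)
  note D = is_pullbackD[OF P]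
  note E = is_coequaliserD[OF e]
  show "m \<in> Arr C" using m by (simp add: hom_iff)
  have dom: "Dom C e = Dom C f" using D(5) e by (auto simp: is_coequaliser_def hom_iff)
  have e': "e \<in> hom C (Dom C f) (Cod C e)" using E(3) dom by simp
  have cov: "cover C e (Dom C f) (Cod C e)"
    unfolding cover_def using e' e by (auto simp: regular_epi_def)
  fix T u v assume "u \<in> hom C T (Dom C m)" "v \<in> hom C T (Dom C m)" and muv: "m \<cdot> u = m \<cdot> v"
  hence u: "u \<in> hom C T (Cod C e)" and v: "v \<in> hom C T (Cod C e)" using m by (auto simp: hom_iff)
  obtain T1 q1 u1 where 1: "cover C q1 T1 T" "u1 \<in> hom C T1 (Dom C f)" "e \<cdot> u1 = u \<cdot> q1"
    using cover_pullback[OF cov u] .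
  have q1: "q1 \<in> hom C T1 T" using 1 by (simp add: cover_def)
  obtain T2 q2 v2 where 2: "cover C q2 T2 T1" "v2 \<in> hom C T2 (Dom C f)" "e \<cdot> v2 = (v \<cdot> q1) \<cdot> q2"
    using cover_pullback[OF cov Comp_in_hom[OF q1 v]] .
  have q2: "q2 \<in> hom C T2 T1" using 2 by (simp add: cover_def)
  let ?u2 = "u1 \<cdot> q2"
  have u2: "?u2 \<in> hom C T2 (Dom C f)" using q2 1(2) by (rule Comp_in_hom)
  have eu2: "e \<cdot> ?u2 = (u \<cdot> q1) \<cdot> q2" using reassoc[OF 1(3,2) e' q2] .
  have q: "q1 \<cdot> q2 \<in> hom C T2 T" using q2 q1 by (rule Comp_in_hom)
  have eq1: "(u \<cdot> q1) \<cdot> q2 = u \<cdot> (q1 \<cdot> q2)" and eq2: "(v \<cdot> q1) \<cdot> q2 = v \<cdot> (q1 \<cdot> q2)"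
    using Comp_assoc[OF q2 q1 u] Comp_assoc[OF q2 q1 v] by auto
  have "f \<cdot> ?u2 = m \<cdot> (e \<cdot> ?u2)" using reassoc[OF me e' m u2] by simp
  also have "\<dots> = m \<cdot> (u \<cdot> (q1 \<cdot> q2))" using eu2 eq1 by metis
  also have "\<dots> = m \<cdot> (v \<cdot> (q1 \<cdot> q2))"
    using Comp_assoc[OF q u m] Comp_assoc[OF q v m] muv by metis
  also have "\<dots> = m \<cdot> (e \<cdot> v2)" using 2(3) eq2 by metis
  also have "\<dots> = f \<cdot> v2" using reassoc[OF me e' m 2(2)] by simp
  finally obtain w where w: "w \<in> hom C T2 (apex P)" "leg1 P \<cdot> w = ?u2" "leg2 P \<cdot> w = v2"
    using pullback_lift[OF P u2 2(2)] by blast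
  have "e \<cdot> ?u2 = e \<cdot> v2"
    using Comp_assoc[OF w(1) D(5) e'] Comp_assoc[OF w(1) D(6) e'] E(4) w(2,3) by metis
  hence "(u \<cdot> q1) \<cdot> q2 = (v \<cdot> q1) \<cdot> q2" using eu2 2(3) by metis
  hence "u \<cdot> q1 = v \<cdot> q1"
    using cover_epi[OF 2(1) Comp_in_hom[OF q1 u] Comp_in_hom[OF q1 v]] by blast
  thus "u = v" using cover_epi[OF 1(1) u v] by blast
qed

text \<open>The epic part is the coequaliser of the kernel pair of \<open>f\<close>; the remaining
  arrow is monic by \<open>coequaliser_kernel_monic\<close>.\<close>

lemma image_factorisation:
  assumes f: "f \<in> hom C A B"
  obtains I e m where "cover C e A I" "monic C m" "m \<in> hom C I B" "m \<cdot> e = f"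
proof -
  have fa: "f \<in> Arr C" "Dom C f = A" "Cod C f = B" using f by (auto simp: hom_iff)
  obtain P where P: "is_pullback C f f P" using pullback_ex[of f f] fa by blast
  obtain e where e: "is_coequaliser C (leg1 P) (leg2 P) e" using kernel_pair_coequaliser[OF P] ..
  have "Dom C e = A" using is_pullbackD(5)[OF P] e fa by (auto simp: is_coequaliser_def hom_iff)
  hence e': "e \<in> hom C A (Cod C e)" using is_coequaliserD(3)[OF e] by simp
  have "\<exists>!m. m \<in> hom C (Cod C e) B \<and> m \<cdot> e = f"
    using coequaliser_lift[OF e, of f B] f \<open>Dom C e = A\<close> is_pullbackD(7)[OF P] by simp
  then obtain m where m: "m \<in> hom C (Cod C e) B" "m \<cdot> e = f" by blast
  have "monic C m" using coequaliser_kernel_monic[OF P e] m fa by simp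
  moreover have "cover C e A (Cod C e)" using e e' by (auto simp: cover_def regular_epi_def)
  ultimately show ?thesis using that m by blast
qed

text \<open>A monomorphism with a right inverse is invertible, so \<open>m \<cdot> e\<close>
  coequalises the same pair as \<open>e\<close>.\<close>

lemma regular_epi_iso_comp:
  assumes e: "cover C e A I" and m: "monic C m" "m \<in> hom C I B" and c: "c \<in> hom C B I" "m \<cdot> c = Ide C B"
  shows "cover C (m \<cdot> e) A B"
proof -
  have e': "e \<in> hom C A I" using e by (rule cover_hom)
  have domm: "Dom C m = I" using m(2) by (simp add: hom_iff)
  have "m \<cdot> (c \<cdot> m) = m \<cdot> Ide C I"
    using reassoc[OF c(2,1) m(2) m(2)] Comp_Ide_left[OF m(2)] Comp_Ide_right[OF m(2)] by metis
  hence cm: "c \<cdot> m = Ide C I"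
    using monicD[OF m(1), unfolded domm, OF Comp_in_hom[OF m(2) c(1)] Ide_in_hom[OF hom_Obj(1)[OF m(2)]]]
    by blast
  obtain f g where co: "is_coequaliser C f g e" using e by (auto simp: cover_def regular_epi_def)
  have D: "Dom C e = A" "Cod C e = I" using e' by (auto simp: hom_iff)
  note K = is_coequaliserD[OF co, unfolded D]
  have me: "m \<cdot> e \<in> hom C A B" using e' m(2) by (rule Comp_in_hom)
  have ce: "c \<cdot> (m \<cdot> e) = e" using reassoc[OF cm m(2) c(1) e'] Comp_Ide_left[OF e'] by simp
  have "is_coequaliser C f g (m \<cdot> e)"
    unfolding is_coequaliser_def
  proof (intro conjI ballI impI)
    show "(m \<cdot> e) \<cdot> f = (m \<cdot> e) \<cdot> g"
      using Comp_assoc[OF K(1) e' m(2)] Comp_assoc[OF K(2) e' m(2)] K(4) by metis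
    fix h assume h: "h \<in> Arr C" "Dom C h = Dom C (m \<cdot> e) \<and> h \<cdot> f = h \<cdot> g"
    have h': "h \<in> hom C (Dom C e) (Cod C h)" using h me D by (simp add: hom_iff)
    obtain u where u: "u \<in> hom C I (Cod C h)" "u \<cdot> e = h"
      using coequaliser_lift[OF co h'] h D by blast
    have cod: "Cod C (m \<cdot> e) = B" using me by (simp add: hom_iff)
    show "\<exists>!u. u \<in> hom C (Cod C (m \<cdot> e)) (Cod C h) \<and> u \<cdot> (m \<cdot> e) = h"
      unfolding cod
    proof (intro ex1I[of _ "u \<cdot> c"] conjI)
      show "u \<cdot> c \<in> hom C B (Cod C h)" using c(1) u(1) by (rule Comp_in_hom)
      show "(u \<cdot> c) \<cdot> (m \<cdot> e) = h" using Comp_assoc[OF me c(1) u(1)] ce u(2) by simp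
      fix v assume v: "v \<in> hom C B (Cod C h) \<and> v \<cdot> (m \<cdot> e) = h"
      have "(v \<cdot> m) \<cdot> e = u \<cdot> e" using Comp_assoc[OF e' m(2), of v] v u(2) by metis
      hence "v \<cdot> m = u" using cover_epi[OF e Comp_in_hom[OF m(2)] u(1), of v] v by blast
      hence "u \<cdot> c = v \<cdot> (m \<cdot> c)" using Comp_assoc[OF c(1) m(2), of v] v by metis
      thus "v = u \<cdot> c" using c(2) Comp_Ide_right v by metis
    qed
  qed (use K me in \<open>auto simp: hom_iff\<close>)
  thus ?thesis using me by (auto simp: cover_def regular_epi_def)
qed

text \<open>Factor \<open>f\<close> as \<open>m \<cdot> e\<close>. Since \<open>m\<close> is monic,
  \<open>e \<cdot> a\<close> identifies whatever \<open>q\<close> identifies, so it descends along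
  \<open>q\<close> to a right inverse of \<open>m\<close>, which makes \<open>m\<close>
  invertible.\<close>

lemma locally_split_cover:
  assumes f: "f \<in> hom C A B" and q: "cover C q T B" and a: "a \<in> hom C T A" and fa: "f \<cdot> a = q"
  shows "cover C f A B"
proof -
  obtain I e m where i: "cover C e A I" "monic C m" "m \<in> hom C I B" "m \<cdot> e = f"
    using image_factorisation[OF f] .
  have e: "e \<in> hom C A I" using i(1) by (rule cover_hom)
  have q': "q \<in> hom C T B" "regular_epi C q" using q by (auto simp: cover_def)
  have D: "Dom C q = T" "Cod C q = B" "Dom C m = I" using q' i by (auto simp: hom_iff)
  have ea: "e \<cdot> a \<in> hom C T I" using a e by (rule Comp_in_hom)
  have mea: "m \<cdot> (e \<cdot> a) = q" using reassoc[OF i(4) e i(3) a] fa by simp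
  obtain c where c: "c \<in> hom C B I" "c \<cdot> q = e \<cdot> a"
  proof (rule regular_epi_descent[OF q'(2), of "e \<cdot> a" I, unfolded D])
    fix S u v assume uv: "u \<in> hom C S T" "v \<in> hom C S T" "q \<cdot> u = q \<cdot> v"
    have "m \<cdot> ((e \<cdot> a) \<cdot> u) = m \<cdot> ((e \<cdot> a) \<cdot> v)"
      using reassoc[OF mea ea i(3)] uv by metis
    thus "(e \<cdot> a) \<cdot> u = (e \<cdot> a) \<cdot> v"
      using monicD[OF i(2), unfolded D, OF Comp_in_hom[OF uv(1) ea] Comp_in_hom[OF uv(2) ea]] by blast
  qed (use ea in auto)
  have "(m \<cdot> c) \<cdot> q = Ide C B \<cdot> q"
    using Comp_assoc[OF q'(1) c(1) i(3)] c(2) mea Comp_Ide_left[OF q'(1)] by simp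
  hence "m \<cdot> c = Ide C B"
    using cover_epi[OF q Comp_in_hom[OF c(1) i(3)]] Ide_in_hom hom_Obj(2)[OF q'(1)] by blast
  from regular_epi_iso_comp[OF i(1-3) c(1) this] show ?thesis using i(4) by simp
qed

text \<open>Factor \<open>g \<cdot> f\<close> as \<open>m \<cdot> e\<close>. Monicity of
  \<open>m\<close> lets \<open>e\<close> descend along \<open>f\<close> to \<open>b\<close>, and
  \<open>b\<close> along \<open>g\<close> to \<open>c\<close>; the result is a right inverse of
  \<open>m\<close>.\<close>

lemma cover_comp:
  assumes f: "cover C f A B" and g: "cover C g B D"
  shows "cover C (g \<cdot> f) A D"
proof -
  have f': "f \<in> hom C A B" "regular_epi C f" and g': "g \<in> hom C B D" "regular_epi C g"
    using f g by (auto simp: cover_def)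
  have gf: "g \<cdot> f \<in> hom C A D" using f'(1) g'(1) by (rule Comp_in_hom)
  obtain I e m where i: "cover C e A I" "monic C m" "m \<in> hom C I D" "m \<cdot> e = g \<cdot> f"
    using image_factorisation[OF gf] .
  have e: "e \<in> hom C A I" using i(1) by (rule cover_hom)
  have D: "Dom C f = A" "Cod C f = B" "Dom C g = B" "Cod C g = D" "Dom C m = I"
    using f' g' i by (auto simp: hom_iff)
  obtain b where b: "b \<in> hom C B I" "b \<cdot> f = e"
  proof (rule regular_epi_descent[OF f'(2), of e I, unfolded D])
    fix S u v assume uv: "u \<in> hom C S A" "v \<in> hom C S A" "f \<cdot> u = f \<cdot> v"
    have "m \<cdot> (e \<cdot> u) = m \<cdot> (e \<cdot> v)"
      using reassoc[OF i(4) e i(3)] Comp_assoc[OF _ f'(1) g'(1)] uv by metis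
    thus "e \<cdot> u = e \<cdot> v" using monicD[OF i(2), unfolded D] uv e Comp_in_hom by metis
  qed (use e in auto)
  have "(m \<cdot> b) \<cdot> f = g \<cdot> f" using Comp_assoc[OF f'(1) b(1) i(3)] b(2) i(4) by simp
  hence mb: "m \<cdot> b = g" using cover_epi[OF f Comp_in_hom[OF b(1) i(3)] g'(1)] by blast
  obtain c where c: "c \<in> hom C D I" "c \<cdot> g = b"
  proof (rule regular_epi_descent[OF g'(2), of b I, unfolded D])
    fix S u v assume uv: "u \<in> hom C S B" "v \<in> hom C S B" "g \<cdot> u = g \<cdot> v"
    have "m \<cdot> (b \<cdot> u) = m \<cdot> (b \<cdot> v)" using reassoc[OF mb b(1) i(3)] uv by metis
    thus "b \<cdot> u = b \<cdot> v" using monicD[OF i(2), unfolded D] uv b Comp_in_hom by metis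
  qed (use b in auto)
  have "(m \<cdot> c) \<cdot> g = Ide C D \<cdot> g"
    using Comp_assoc[OF g'(1) c(1) i(3)] c(2) mb Comp_Ide_left[OF g'(1)] by simp
  hence "m \<cdot> c = Ide C D"
    using cover_epi[OF g Comp_in_hom[OF c(1) i(3)]] Ide_in_hom hom_Obj(2)[OF g'(1)] by blast
  from regular_epi_iso_comp[OF i(1-3) c(1) this] show ?thesis using i(4) by simp
qed

lemma is_relationI:
  assumes l: "leg1 R \<in> hom C (apex R) X" "leg2 R \<in> hom C (apex R) Y"
    and inj: "\<And>T u v. \<lbrakk>u \<in> hom C T (apex R); v \<in> hom C T (apex R);
      leg1 R \<cdot> u = leg1 R \<cdot> v; leg2 R \<cdot> u = leg2 R \<cdot> v\<rbrakk> \<Longrightarrow> u = v"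
  shows "is_relation C X Y R"
proof -
  obtain P where P: "is_product C X Y P" using product_ex hom_Obj l by metis
  note D = is_productD[OF P]
  obtain m where m: "m \<in> hom C (apex R) (apex P)" "leg1 P \<cdot> m = leg1 R" "leg2 P \<cdot> m = leg2 R"
    using product_lift[OF P l] .
  have "monic C m" unfolding monic_def
  proof (intro conjI ballI impI)
    show "m \<in> Arr C" using m by (simp add: hom_iff)
    fix T u v assume "u \<in> hom C T (Dom C m)" "v \<in> hom C T (Dom C m)" and eq: "m \<cdot> u = m \<cdot> v"
    hence u: "u \<in> hom C T (apex R)" and v: "v \<in> hom C T (apex R)" using m(1) by (auto simp: hom_iff)
    show "u = v"
      using reassoc[OF m(2) m(1) D(4) u] reassoc[OF m(2) m(1) D(4) v]
        reassoc[OF m(3) m(1) D(5) u] reassoc[OF m(3) m(1) D(5) v] eq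
      by (intro inj[OF u v]) metis+
  qed
  thus ?thesis using P m l hom_Obj by (auto simp: is_relation_def is_pairing_def is_span_def)
qed

text \<open>A witness for relatedness is unique by joint monicity, so a witness on a cover is
  constant on the fibres of the cover and descends.\<close>

lemma related_local:
  assumes R: "is_relation C X Y R" and x: "x \<in> hom C T X" and y: "y \<in> hom C T Y"
    and q: "cover C q T' T" and r: "related C R T' (x \<cdot> q) (y \<cdot> q)"
  shows "related C R T x y"
proof -
  note D = is_relationD[OF R]
  have q': "q \<in> hom C T' T" "regular_epi C q" "Dom C q = T'" "Cod C q = T"
    using q by (auto simp: cover_def hom_iff)
  obtain h where h: "h \<in> hom C T' (apex R)" "leg1 R \<cdot> h = x \<cdot> q" "leg2 R \<cdot> h = y \<cdot> q"
    using r by (rule relatedE)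
  obtain k where k: "k \<in> hom C T (apex R)" "k \<cdot> q = h"
  proof (rule regular_epi_descent[OF q'(2), of h "apex R", unfolded q'(3,4)])
    fix S u v assume uv: "u \<in> hom C S T'" "v \<in> hom C S T'" "q \<cdot> u = q \<cdot> v"
    show "h \<cdot> u = h \<cdot> v"
    proof (rule relation_eqI[OF R])
      show "leg1 R \<cdot> (h \<cdot> u) = leg1 R \<cdot> (h \<cdot> v)"
        using reassoc[OF h(2) h(1) D(4)] Comp_assoc[OF _ q'(1) x] uv by metis
      show "leg2 R \<cdot> (h \<cdot> u) = leg2 R \<cdot> (h \<cdot> v)"
        using reassoc[OF h(3) h(1) D(5)] Comp_assoc[OF _ q'(1) y] uv by metis
    qed (use uv h(1) Comp_in_hom in blast)+
  qed (use h in auto)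
  show ?thesis
  proof (rule relatedI[OF k(1)])
    have "(leg1 R \<cdot> k) \<cdot> q = x \<cdot> q" using Comp_assoc[OF q'(1) k(1) D(4)] k(2) h(2) by simp
    thus "leg1 R \<cdot> k = x" using cover_epi[OF q Comp_in_hom[OF k(1) D(4)] x] by blast
    have "(leg2 R \<cdot> k) \<cdot> q = y \<cdot> q" using Comp_assoc[OF q'(1) k(1) D(5)] k(2) h(3) by simp
    thus "leg2 R \<cdot> k = y" using cover_epi[OF q Comp_in_hom[OF k(1) D(5)] y] by blast
  qed
qed

text \<open>The structure arrows are the witnesses at generic elements: the identity of
  \<open>X\<close> for reflexivity, the two legs for symmetry, and the legs over the pullback of
  composable pairs for transitivity.\<close>

lemma is_equivalenceI:
  assumes R: "is_relation C X X R"
    and refl: "\<And>T x. x \<in> hom C T X \<Longrightarrow> related C R T x x"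
    and sym: "\<And>T x y. related C R T x y \<Longrightarrow> related C R T y x"
    and trans: "\<And>T x y z. \<lbrakk>related C R T x y; related C R T y z\<rbrakk> \<Longrightarrow> related C R T x z"
  shows "is_equivalence C X R"
proof -
  note D = is_relationD[OF R]
  have "related C R X (Ide C X) (Ide C X)" using refl Ide_in_hom D(1) by blast
  moreover have "related C R (apex R) (leg2 R) (leg1 R)" using sym related_legs[OF R] by blast
  moreover have "\<exists>W. is_pullback C (leg2 R) (leg1 R) W \<and>
        related C R (apex W) (leg1 R \<cdot> leg1 W) (leg2 R \<cdot> leg2 W)"
  proof -
    obtain W where W: "is_pullback C (leg2 R) (leg1 R) W"
      using pullback_ex[of "leg2 R" "leg1 R"] D by (auto simp: hom_iff)
    have l: "leg1 W \<in> hom C (apex W) (apex R)" "leg2 W \<in> hom C (apex W) (apex R)"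
      using is_pullbackD[OF W] D by (auto simp: hom_iff)
    have "related C R (apex W) (leg1 R \<cdot> leg1 W) (leg2 R \<cdot> leg1 W)"
      "related C R (apex W) (leg1 R \<cdot> leg2 W) (leg2 R \<cdot> leg2 W)"
      using related_comp[OF R related_legs[OF R]] l by blast+
    thus ?thesis using trans is_pullbackD(7)[OF W] W by metis
  qed
  ultimately show ?thesis using R by (auto simp: is_equivalence_def related_def)
qed

lemma kernel_equivalence:
  assumes f: "f \<in> hom C A B"
  obtains E where "is_equivalence C A E"
    "\<And>T x y. related C E T x y \<longleftrightarrow> x \<in> hom C T A \<and> y \<in> hom C T A \<and> f \<cdot> x = f \<cdot> y"
proof -
  have fa: "f \<in> Arr C" "Dom C f = A" "Cod C f = B" using f by (auto simp: hom_iff)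
  obtain E where E: "is_pullback C f f E" using pullback_ex[of f f] fa by blast
  note D = is_pullbackD[OF E, unfolded fa]
  have rel: "is_relation C A A E"
    using D(5,6) pullback_eqI[OF E] by (rule is_relationI)
  have iff: "related C E T x y \<longleftrightarrow> x \<in> hom C T A \<and> y \<in> hom C T A \<and> f \<cdot> x = f \<cdot> y" for T x y
  proof
    assume r: "related C E T x y"
    then obtain h where h: "h \<in> hom C T (apex E)" "leg1 E \<cdot> h = x" "leg2 E \<cdot> h = y"
      by (rule relatedE)
    have "f \<cdot> x = f \<cdot> y"
      using Comp_assoc[OF h(1) D(5) f] Comp_assoc[OF h(1) D(6) f] h(2,3) D(7) by metis
    thus "x \<in> hom C T A \<and> y \<in> hom C T A \<and> f \<cdot> x = f \<cdot> y" using related_hom[OF rel r] by blast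
  next
    assume "x \<in> hom C T A \<and> y \<in> hom C T A \<and> f \<cdot> x = f \<cdot> y"
    thus "related C E T x y"
      using pullback_lift[OF E, of x T y] fa(2) relatedI by metis
  qed
  show ?thesis
  proof (rule that[OF _ iff])
    show "is_equivalence C A E" using rel by (rule is_equivalenceI) (auto simp: iff)
  qed
qed

lemma composite_ex:
  assumes R: "is_relation C X Y R" and S: "is_relation C Y Z S"
  obtains T where "is_composite C X Y Z S R T"
proof -
  note DR = is_relationD[OF R] and DS = is_relationD[OF S]
  obtain W where W: "is_pullback C (leg2 R) (leg1 S) W"
    using pullback_ex[of "leg2 R" "leg1 S"] DR DS by (auto simp: hom_iff)
  have l: "leg1 R \<cdot> leg1 W \<in> hom C (apex W) X" "leg2 S \<cdot> leg2 W \<in> hom C (apex W) Z"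
    using is_pullbackD[OF W] DR DS by (auto simp: hom_iff)
  obtain P where P: "is_product C X Z P" using product_ex DR(1) DS(2) by blast
  note DP = is_productD[OF P]
  obtain f where f: "f \<in> hom C (apex W) (apex P)" "leg1 P \<cdot> f = leg1 R \<cdot> leg1 W"
    "leg2 P \<cdot> f = leg2 S \<cdot> leg2 W"
    using product_lift[OF P l] .
  obtain I e m where i: "cover C e (apex W) I" "monic C m" "m \<in> hom C I (apex P)" "m \<cdot> e = f"
    using image_factorisation[OF f(1)] .
  let ?T = "\<lparr>apex = I, leg1 = leg1 P \<cdot> m, leg2 = leg2 P \<cdot> m\<rparr>"
  have "is_span C X Z ?T"
    using i(3) DP hom_Obj[OF i(3)] Comp_in_hom by (auto simp: is_span_def)
  moreover have "is_image C f m"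
    using i f(1) by (auto simp: is_image_def cover_def hom_iff)
  moreover have "is_pairing C X Z P ?T m" using P i(3) by (simp add: is_pairing_def)
  moreover have "is_pairing C X Z P
          \<lparr>apex = apex W, leg1 = leg1 R \<cdot> leg1 W, leg2 = leg2 S \<cdot> leg2 W\<rparr> f"
    using P f by (simp add: is_pairing_def)
  ultimately show ?thesis using that R S W unfolding is_composite_def by blast
qed

lemma composite_relation: "is_composite C X Y Z S R T \<Longrightarrow> is_relation C X Z T"
  unfolding is_composite_def is_relation_def is_image_def by blast

text \<open>The image in the definition of a composite is an existential quantifier, interpreted by
  passing to a cover on which the middle element exists. One direction pulls the epic part of the
  image back along the witness; the other builds the witness on the cover and descends it by
  \<open>related_local\<close>.\<close>

lemma composite_related:
  assumes T0: "is_composite C X Y Z S R T0"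
  shows "related C T0 T x z \<longleftrightarrow> x \<in> hom C T X \<and> z \<in> hom C T Z \<and>
    (\<exists>T' q y. cover C q T' T \<and> related C R T' (x \<cdot> q) y \<and> related C S T' y (z \<cdot> q))"
proof -
  note rel = composite_relation[OF T0]
  obtain W P f m e where R: "is_relation C X Y R" and S: "is_relation C Y Z S" and
    W: "is_pullback C (leg2 R) (leg1 S) W" and P: "is_product C X Z P"
    and f: "f \<in> hom C (apex W) (apex P)" "leg1 P \<cdot> f = leg1 R \<cdot> leg1 W" "leg2 P \<cdot> f = leg2 S \<cdot> leg2 W"
    and m: "m \<in> hom C (apex T0) (apex P)" "leg1 P \<cdot> m = leg1 T0" "leg2 P \<cdot> m = leg2 T0"
    and e: "e \<in> hom C (Dom C f) (Dom C m)" "regular_epi C e" "m \<cdot> e = f"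
    using T0 unfolding is_composite_def is_pairing_def is_image_def by auto
  note DR = is_relationD[OF R] and DS = is_relationD[OF S] and DP = is_productD[OF P]
    and DT = is_relationD[OF rel]
  have l: "leg1 W \<in> hom C (apex W) (apex R)" "leg2 W \<in> hom C (apex W) (apex S)"
    using is_pullbackD[OF W] DR DS by (auto simp: hom_iff)
  have cov: "cover C e (apex W) (apex T0)" and e': "e \<in> hom C (apex W) (apex T0)"
    using e(1,2) f(1) m(1) by (auto simp: cover_def hom_iff)
  have e1: "leg1 T0 \<cdot> e = leg1 R \<cdot> leg1 W"
    using Comp_assoc[OF e' m(1) DP(4)] e(3) m(2) f(2) by simp
  have e2: "leg2 T0 \<cdot> e = leg2 S \<cdot> leg2 W"
    using Comp_assoc[OF e' m(1) DP(5)] e(3) m(3) f(3) by simp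
  show ?thesis
  proof (intro iffI conjI; (elim conjE exE)?)
    assume r: "related C T0 T x z"
    show x: "x \<in> hom C T X" and z: "z \<in> hom C T Z" using related_hom[OF rel r] .
    obtain h where h: "h \<in> hom C T (apex T0)" "leg1 T0 \<cdot> h = x" "leg2 T0 \<cdot> h = z"
      using r by (rule relatedE)
    obtain T' q w where q: "cover C q T' T" and w: "w \<in> hom C T' (apex W)" "e \<cdot> w = h \<cdot> q"
      using cover_pullback[OF cov h(1)] .
    have q': "q \<in> hom C T' T" using q by (rule cover_hom)
    have "x \<cdot> q = leg1 T0 \<cdot> (e \<cdot> w)" using Comp_assoc[OF q' h(1) DT(4)] h(2) w(2) by simp
    also have "\<dots> = (leg1 R \<cdot> leg1 W) \<cdot> w" using reassoc[OF e1 e' DT(4) w(1)] .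
    also have "\<dots> = leg1 R \<cdot> (leg1 W \<cdot> w)" using Comp_assoc[OF w(1) l(1) DR(4)] by simp
    finally have 1: "leg1 R \<cdot> (leg1 W \<cdot> w) = x \<cdot> q" by simp
    have "z \<cdot> q = leg2 T0 \<cdot> (e \<cdot> w)" using Comp_assoc[OF q' h(1) DT(5)] h(3) w(2) by simp
    also have "\<dots> = (leg2 S \<cdot> leg2 W) \<cdot> w" using reassoc[OF e2 e' DT(5) w(1)] .
    also have "\<dots> = leg2 S \<cdot> (leg2 W \<cdot> w)" using Comp_assoc[OF w(1) l(2) DS(5)] by simp
    finally have 2: "leg2 S \<cdot> (leg2 W \<cdot> w) = z \<cdot> q" by simp
    have 3: "leg1 S \<cdot> (leg2 W \<cdot> w) = leg2 R \<cdot> (leg1 W \<cdot> w)"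
      using is_pullbackD(7)[OF W] Comp_assoc[OF w(1) l(1) DR(5)] Comp_assoc[OF w(1) l(2) DS(4)] by simp
    show "\<exists>T' q y. cover C q T' T \<and> related C R T' (x \<cdot> q) y \<and> related C S T' y (z \<cdot> q)"
      using q relatedI[OF Comp_in_hom[OF w(1) l(1)] 1 refl] relatedI[OF Comp_in_hom[OF w(1) l(2)] 3 2]
      by blast
  next
    fix T' q y assume x: "x \<in> hom C T X" and z: "z \<in> hom C T Z" and q: "cover C q T' T"
      and r: "related C R T' (x \<cdot> q) y" "related C S T' y (z \<cdot> q)"
    obtain h where h: "h \<in> hom C T' (apex R)" "leg1 R \<cdot> h = x \<cdot> q" "leg2 R \<cdot> h = y"
      using r(1) by (rule relatedE)
    obtain k where k: "k \<in> hom C T' (apex S)" "leg1 S \<cdot> k = y" "leg2 S \<cdot> k = z \<cdot> q"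
      using r(2) by (rule relatedE)
    have dom: "Dom C (leg1 S) = apex S" "Dom C (leg2 R) = apex R" using DR DS by (auto simp: hom_iff)
    obtain w where w: "w \<in> hom C T' (apex W)" "leg1 W \<cdot> w = h" "leg2 W \<cdot> w = k"
      using pullback_lift[OF W, of h T' k] h k dom by auto
    have "leg1 T0 \<cdot> (e \<cdot> w) = x \<cdot> q"
      using reassoc[OF e1 e' DT(4) w(1)] Comp_assoc[OF w(1) l(1) DR(4)] w(2) h(2) by metis
    moreover have "leg2 T0 \<cdot> (e \<cdot> w) = z \<cdot> q"
      using reassoc[OF e2 e' DT(5) w(1)] Comp_assoc[OF w(1) l(2) DS(5)] w(3) k(3) by metis
    ultimately have "related C T0 T' (x \<cdot> q) (z \<cdot> q)"
      by (rule relatedI[OF Comp_in_hom[OF w(1) e']])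
    thus "related C T0 T x z" by (rule related_local[OF rel x z q])
  qed
qed

end

section \<open>The Goursat law on generalised elements\<close>

context goursat_category
begin

text \<open>The hypotheses say that \<open>x\<close> and \<open>w\<close> are related by RSR; the
  isomorphism with SRS carries the witness over. Each of the two nested composites in SRS costs one
  cover, and \<open>q\<close> is the composite of the two.\<close>

lemma goursat_related:
  assumes R: "is_equivalence C X R" and S: "is_equivalence C X S"
    and r: "related C R T x y" "related C S T y z" "related C R T z w"
  obtains T' q y' z' where "cover C q T' T" "related C S T' (x \<cdot> q) y'" "related C R T' y' z'"
    "related C S T' z' (w \<cdot> q)"
proof -
  note R' = is_equivalence_relation[OF R] and S' = is_equivalence_relation[OF S]
  obtain SR where SR: "is_composite C X X X S R SR" using composite_ex[OF R' S'] .
  obtain RSR where RSR: "is_composite C X X X R SR RSR" using composite_ex[OF composite_relation[OF SR] R'] .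
  obtain RS where RS: "is_composite C X X X R S RS" using composite_ex[OF S' R'] .
  obtain SRS where SRS: "is_composite C X X X S RS SRS" using composite_ex[OF composite_relation[OF RS] S'] .
  note h = related_hom[OF R' r(1)] related_hom[OF R' r(3)]
  \<comment> \<open>The middle elements \<open>y\<close> and \<open>z\<close> already exist at stage
    \<open>T\<close>, so the identity serves as cover in both composites.\<close>
  note i = cover_Ide[OF hom_Obj(1)[OF h(1)]]
  have "related C SR T x z"
    unfolding composite_related[OF SR] using h i r Comp_Ide_right by metis
  hence "related C RSR T x w"
    unfolding composite_related[OF RSR] using h i r Comp_Ide_right by metis
  then obtain k where k: "k \<in> hom C T (apex RSR)" "leg1 RSR \<cdot> k = x" "leg2 RSR \<cdot> k = w"
    by (rule relatedE)
  have X: "X \<in> Obj C" using is_relationD(1)[OF R'] .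
  obtain j where j: "j \<in> hom C (apex RSR) (apex SRS)" "leg1 SRS \<cdot> j = leg1 RSR" "leg2 SRS \<cdot> j = leg2 RSR"
    using goursat[OF X R S SR RSR RS SRS] by (auto simp: same_relation_def)
  note DS = is_relationD[OF composite_relation[OF SRS]]
  have "related C SRS T x w"
    using reassoc[OF j(2) j(1) DS(4) k(1)] reassoc[OF j(3) j(1) DS(5) k(1)] k(2,3)
    by (intro relatedI[OF Comp_in_hom[OF k(1) j(1)]]) simp_all
  then obtain T1 q1 z' where 1: "cover C q1 T1 T" "related C RS T1 (x \<cdot> q1) z'" "related C S T1 z' (w \<cdot> q1)"
    unfolding composite_related[OF SRS] by blast
  from 1(2) obtain T2 q2 y' where 2: "cover C q2 T2 T1" "related C S T2 ((x \<cdot> q1) \<cdot> q2) y'"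
    "related C R T2 y' (z' \<cdot> q2)"
    unfolding composite_related[OF RS] by blast
  have 3: "related C S T2 (z' \<cdot> q2) ((w \<cdot> q1) \<cdot> q2)"
    using related_comp[OF S' 1(3) cover_hom[OF 2(1)]] .
  have eq: "(x \<cdot> q1) \<cdot> q2 = x \<cdot> (q1 \<cdot> q2)" "(w \<cdot> q1) \<cdot> q2 = w \<cdot> (q1 \<cdot> q2)"
    using Comp_assoc[OF cover_hom[OF 2(1)] cover_hom[OF 1(1)]] h by metis+
  show ?thesis using that cover_comp[OF 2(1) 1(1)] 2(2,3) 3 unfolding eq by blast
qed

text \<open>For kernel pairs, relatedness is an equation between composites, so the law becomes
  usable by rewriting.\<close>

lemma goursat_kernels:
  assumes f: "f \<in> hom C A B" and g: "g \<in> hom C A D"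
    and u: "u0 \<in> hom C T A" "u1 \<in> hom C T A" "u2 \<in> hom C T A" "u3 \<in> hom C T A"
    and eq: "f \<cdot> u0 = f \<cdot> u1" "g \<cdot> u1 = g \<cdot> u2" "f \<cdot> u2 = f \<cdot> u3"
  obtains T' q v w where "cover C q T' T" "v \<in> hom C T' A" "w \<in> hom C T' A"
    "g \<cdot> (u0 \<cdot> q) = g \<cdot> v" "f \<cdot> v = f \<cdot> w" "g \<cdot> w = g \<cdot> (u3 \<cdot> q)"
proof -
  obtain E where E: "is_equivalence C A E"
    "\<And>T x y. related C E T x y \<longleftrightarrow> x \<in> hom C T A \<and> y \<in> hom C T A \<and> f \<cdot> x = f \<cdot> y"
    using kernel_equivalence[OF f] by blast
  obtain F where F: "is_equivalence C A F"
    "\<And>T x y. related C F T x y \<longleftrightarrow> x \<in> hom C T A \<and> y \<in> hom C T A \<and> g \<cdot> x = g \<cdot> y"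
    using kernel_equivalence[OF g] by blast
  have "related C E T u0 u1" "related C F T u1 u2" "related C E T u2 u3"
    using u eq E(2) F(2) by blast+
  from goursat_related[OF E(1) F(1) this] show ?thesis using that E(2) F(2) by metis
qed

text \<open>Gumm's shifting lemma, for kernel pairs: the rectangle has the horizontal sides identified by
  \<^term>\<open>f\<close>, the vertical ones by \<^term>\<open>d\<close>, and \<^term>\<open>c\<close> identifies one vertical side.\<close>

lemma shifting:
  assumes f: "f \<in> hom C A B" and d: "d \<in> hom C A D" and c: "c \<in> hom C A D'"
    and meet: "\<And>T u v. \<lbrakk>u \<in> hom C T A; v \<in> hom C T A; f \<cdot> u = f \<cdot> v; d \<cdot> u = d \<cdot> v\<rbrakk> \<Longrightarrow> c \<cdot> u = c \<cdot> v"
    and u: "u \<in> hom C T A" "u' \<in> hom C T A" "t \<in> hom C T A" "t' \<in> hom C T A"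
    and eq: "d \<cdot> u = d \<cdot> u'" "d \<cdot> t = d \<cdot> t'" "f \<cdot> u = f \<cdot> t" "f \<cdot> u' = f \<cdot> t'" "c \<cdot> t = c \<cdot> t'"
  shows "c \<cdot> u = c \<cdot> u'"
proof -
  \<comment> \<open>The kernel pair of \<open>g\<close> is the intersection of those of
    \<open>c\<close> and \<open>d\<close>. The law for \<open>f\<close> and \<open>g\<close> along
    \<open>u\<close>, \<open>t\<close>, \<open>t'\<close>, \<open>u'\<close> yields \<open>v\<close>
    and \<open>w\<close> with \<open>f\<close> identifying \<open>v\<close> and \<open>w\<close>,
    while \<open>g\<close> ties \<open>v\<close> to \<open>u\<close> and \<open>w\<close> to
    \<open>u'\<close>. As \<open>d\<close> identifies \<open>u\<close> and \<open>u'\<close>, it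
    also identifies \<open>v\<close> and \<open>w\<close>, so \<open>meet\<close> applies to
    them.\<close>
  obtain g Z where g: "g \<in> hom C A Z" "\<And>T u v. \<lbrakk>u \<in> hom C T A; v \<in> hom C T A\<rbrakk>
      \<Longrightarrow> g \<cdot> u = g \<cdot> v \<longleftrightarrow> c \<cdot> u = c \<cdot> v \<and> d \<cdot> u = d \<cdot> v"
    using pairing_ex[OF c d] by blast
  have "g \<cdot> t = g \<cdot> t'" using g(2) u eq by blast
  then obtain T' q v w where q: "cover C q T' T" and vw: "v \<in> hom C T' A" "w \<in> hom C T' A"
    "g \<cdot> (u \<cdot> q) = g \<cdot> v" "f \<cdot> v = f \<cdot> w" "g \<cdot> w = g \<cdot> (u' \<cdot> q)"
    using goursat_kernels[OF f g(1) u(1,3,4,2)] eq by metis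
  have q': "q \<in> hom C T' T" using q by (rule cover_hom)
  have uq: "u \<cdot> q \<in> hom C T' A" "u' \<cdot> q \<in> hom C T' A" using q' u Comp_in_hom by blast+
  have 1: "c \<cdot> (u \<cdot> q) = c \<cdot> v" "d \<cdot> (u \<cdot> q) = d \<cdot> v" "c \<cdot> w = c \<cdot> (u' \<cdot> q)" "d \<cdot> w = d \<cdot> (u' \<cdot> q)"
    using g(2) vw uq by blast+
  have "d \<cdot> (u \<cdot> q) = d \<cdot> (u' \<cdot> q)"
    using Comp_assoc[OF q' u(1) d] Comp_assoc[OF q' u(2) d] eq(1) by metis
  hence "c \<cdot> v = c \<cdot> w" using meet[OF vw(1,2,4)] 1 by metis
  hence "(c \<cdot> u) \<cdot> q = (c \<cdot> u') \<cdot> q"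
    using Comp_assoc[OF q' u(1) c] Comp_assoc[OF q' u(2) c] 1 by metis
  thus ?thesis using cover_epi[OF q Comp_in_hom[OF u(1) c] Comp_in_hom[OF u(2) c]] by blast
qed

end

section \<open>Functors preserving pullbacks, products and regular epimorphisms\<close>

locale exact_functor = source: category D + target: category C
  for D :: "('p, 'b) cat" and C :: "('o, 'a) cat" +
  fixes Uo :: "'p \<Rightarrow> 'o" and Ua :: "'b \<Rightarrow> 'a"
  assumes U_functor: "is_functor D C Uo Ua"
    and U_pullback: "is_pullback D f g P \<Longrightarrow>
      is_pullback C (Ua f) (Ua g) \<lparr>apex = Uo (apex P), leg1 = Ua (leg1 P), leg2 = Ua (leg2 P)\<rparr>"
    and U_product: "is_product D X Y P \<Longrightarrow>
      is_product C (Uo X) (Uo Y) \<lparr>apex = Uo (apex P), leg1 = Ua (leg1 P), leg2 = Ua (leg2 P)\<rparr>"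
    and U_regular_epi: "regular_epi D e \<Longrightarrow> regular_epi C (Ua e)"
begin

abbreviation Us :: "('p, 'b) span \<Rightarrow> ('o, 'a) span" where
  "Us P \<equiv> \<lparr>apex = Uo (apex P), leg1 = Ua (leg1 P), leg2 = Ua (leg2 P)\<rparr>"

lemma U_hom: "f \<in> hom D X Y \<Longrightarrow> Ua f \<in> hom C (Uo X) (Uo Y)"
  using U_functor by (auto simp: is_functor_def hom_iff)

lemma U_Comp: "\<lbrakk>f \<in> hom D X Y; g \<in> hom D Y Z\<rbrakk> \<Longrightarrow> Ua (g \<cdot>\<^bsub>D\<^esub> f) = Ua g \<cdot>\<^bsub>C\<^esub> Ua f"
  using U_functor by (auto simp: is_functor_def hom_iff)

lemma U_Ide: "X \<in> Obj D \<Longrightarrow> Ua (Ide D X) = Ide C (Uo X)"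
  using U_functor by (auto simp: is_functor_def)

lemma U_Obj: "X \<in> Obj D \<Longrightarrow> Uo X \<in> Obj C"
  using U_functor by (auto simp: is_functor_def)

lemma U_monic:
  assumes "monic D m" shows "monic C (Ua m)"
proof -
  have m: "m \<in> Arr D" using assms by (simp add: monic_def)
  have h: "Ua m \<in> hom C (Uo (Dom D m)) (Uo (Cod D m))" using m by (intro U_hom) (simp add: hom_iff)
  have "is_pullback D m m \<lparr>apex = Dom D m, leg1 = Ide D (Dom D m), leg2 = Ide D (Dom D m)\<rparr>"
    using assms source.monic_iff_pullback[OF m] by blast
  from U_pullback[OF this] show ?thesis
    using target.monic_iff_pullback[of "Ua m"] h U_Ide source.Dom_in_Obj[OF m] by (simp add: hom_iff)
qed

lemma U_span: "is_span D X Y R \<Longrightarrow> is_span C (Uo X) (Uo Y) (Us R)"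
  using U_hom U_Obj by (auto simp: is_span_def)

lemma U_pairing:
  assumes "is_pairing D X Y P Q f"
  shows "is_pairing C (Uo X) (Uo Y) (Us P) (Us Q) (Ua f)"
proof -
  have P: "is_product D X Y P" and f: "f \<in> hom D (apex Q) (apex P)"
    and eq: "leg1 P \<cdot>\<^bsub>D\<^esub> f = leg1 Q" "leg2 P \<cdot>\<^bsub>D\<^esub> f = leg2 Q"
    using assms by (auto simp: is_pairing_def)
  note D = source.is_productD[OF P]
  show ?thesis
    using U_product[OF P] U_hom[OF f] U_Comp[OF f D(4)] U_Comp[OF f D(5)] eq by (auto simp: is_pairing_def)
qed

lemma U_relation:
  assumes "is_relation D X Y R" shows "is_relation C (Uo X) (Uo Y) (Us R)"
  using assms U_span U_pairing U_monic unfolding is_relation_def by blast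

lemma U_image:
  assumes "is_image D f m" "f \<in> hom D A B"
  shows "is_image C (Ua f) (Ua m)"
proof -
  obtain e where m: "monic D m" and e: "e \<in> hom D (Dom D f) (Dom D m)" "regular_epi D e" "m \<cdot>\<^bsub>D\<^esub> e = f"
    using assms by (auto simp: is_image_def)
  have m': "m \<in> hom D (Dom D m) (Cod D m)" using m by (auto simp: monic_def hom_iff)
  have f: "f \<in> hom D (Dom D f) (Cod D f)" using assms(2) by (auto simp: hom_iff)
  have "Dom C (Ua m) = Uo (Dom D m)" "Dom C (Ua f) = Uo (Dom D f)"
    using U_hom[OF m'] U_hom[OF f] by (auto simp: hom_iff)
  thus ?thesis
    using U_monic[OF m] U_hom[OF e(1)] U_regular_epi[OF e(2)] U_Comp[OF e(1) m'] e(3)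
    by (auto simp: is_image_def)
qed

text \<open>A composite of relations is assembled from a pullback, two pairings and an image, each
  of which is preserved; the preservation of regular epimorphisms enters through the image.\<close>

lemma U_composite:
  assumes "is_composite D X Y Z S R T"
  shows "is_composite C (Uo X) (Uo Y) (Uo Z) (Us S) (Us R) (Us T)"
proof -
  let ?L = "\<lambda>W. \<lparr>apex = apex W, leg1 = leg1 R \<cdot>\<^bsub>D\<^esub> leg1 W, leg2 = leg2 S \<cdot>\<^bsub>D\<^esub> leg2 W\<rparr>"
  obtain W P f m where R: "is_relation D X Y R" and S: "is_relation D Y Z S" and T: "is_span D X Z T"
    and W: "is_pullback D (leg2 R) (leg1 S) W" and f: "is_pairing D X Z P (?L W) f"
    and m: "is_pairing D X Z P T m" and i: "is_image D f m"
    using assms unfolding is_composite_def by blast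
  note DW = source.is_pullbackD[OF W] and DR = source.is_relationD[OF R] and DS = source.is_relationD[OF S]
  have l: "leg1 W \<in> hom D (apex W) (apex R)" "leg2 W \<in> hom D (apex W) (apex S)"
    using DW DR DS by (auto simp: hom_iff)
  have "is_pairing C (Uo X) (Uo Z) (Us P) \<lparr>apex = apex (Us W), leg1 = leg1 (Us R) \<cdot>\<^bsub>C\<^esub> leg1 (Us W),
      leg2 = leg2 (Us S) \<cdot>\<^bsub>C\<^esub> leg2 (Us W)\<rparr> (Ua f)"
    using U_pairing[OF f] U_Comp[OF l(1) DR(4)] U_Comp[OF l(2) DS(5)] by simp
  moreover have "is_pullback C (leg2 (Us R)) (leg1 (Us S)) (Us W)" using U_pullback[OF W] by simp
  moreover have "is_image C (Ua f) (Ua m)" using U_image[OF i] f by (auto simp: is_pairing_def)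
  ultimately show ?thesis
    using U_relation[OF R] U_relation[OF S] U_span[OF T] U_pairing[OF m] unfolding is_composite_def by blast
qed

lemma U_equivalence:
  assumes "is_equivalence D X R" shows "is_equivalence C (Uo X) (Us R)"
proof -
  obtain d s W t where R: "is_relation D X X R"
    and d: "d \<in> hom D X (apex R)" "leg1 R \<cdot>\<^bsub>D\<^esub> d = Ide D X" "leg2 R \<cdot>\<^bsub>D\<^esub> d = Ide D X"
    and s: "s \<in> hom D (apex R) (apex R)" "leg1 R \<cdot>\<^bsub>D\<^esub> s = leg2 R" "leg2 R \<cdot>\<^bsub>D\<^esub> s = leg1 R"
    and W: "is_pullback D (leg2 R) (leg1 R) W"
    and t: "t \<in> hom D (apex W) (apex R)" "leg1 R \<cdot>\<^bsub>D\<^esub> t = leg1 R \<cdot>\<^bsub>D\<^esub> leg1 W" "leg2 R \<cdot>\<^bsub>D\<^esub> t = leg2 R \<cdot>\<^bsub>D\<^esub> leg2 W"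
    using assms unfolding is_equivalence_def by blast
  note DR = source.is_relationD[OF R] and DW = source.is_pullbackD[OF W]
  have l: "leg1 W \<in> hom D (apex W) (apex R)" "leg2 W \<in> hom D (apex W) (apex R)"
    using DW DR by (auto simp: hom_iff)
  have "leg1 (Us R) \<cdot>\<^bsub>C\<^esub> Ua d = Ide C (Uo X)" "leg2 (Us R) \<cdot>\<^bsub>C\<^esub> Ua d = Ide C (Uo X)"
    using U_Comp[OF d(1) DR(4)] U_Comp[OF d(1) DR(5)] d U_Ide[OF DR(1)] by simp_all
  moreover have "leg1 (Us R) \<cdot>\<^bsub>C\<^esub> Ua s = leg2 (Us R)" "leg2 (Us R) \<cdot>\<^bsub>C\<^esub> Ua s = leg1 (Us R)"
    using U_Comp[OF s(1) DR(4)] U_Comp[OF s(1) DR(5)] s by simp_all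
  moreover have "leg1 (Us R) \<cdot>\<^bsub>C\<^esub> Ua t = leg1 (Us R) \<cdot>\<^bsub>C\<^esub> leg1 (Us W)"
    "leg2 (Us R) \<cdot>\<^bsub>C\<^esub> Ua t = leg2 (Us R) \<cdot>\<^bsub>C\<^esub> leg2 (Us W)"
    using U_Comp[OF t(1) DR(4)] U_Comp[OF t(1) DR(5)] U_Comp[OF l(1) DR(4)] U_Comp[OF l(2) DR(5)] t by simp_all
  moreover have "is_pullback C (leg2 (Us R)) (leg1 (Us R)) (Us W)" using U_pullback[OF W] by simp
  moreover have "Ua d \<in> hom C (Uo X) (apex (Us R))" "Ua s \<in> hom C (apex (Us R)) (apex (Us R))"
    "Ua t \<in> hom C (apex (Us W)) (apex (Us R))"
    using U_hom[OF d(1)] U_hom[OF s(1)] U_hom[OF t(1)] by simp_all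
  ultimately show ?thesis using U_relation[OF R] unfolding is_equivalence_def by blast
qed

end

section \<open>Connectors on generalised elements\<close>

definition triple_obj :: "('o, 'a) cat \<Rightarrow> ('o, 'a) span \<Rightarrow> ('o, 'a) span \<Rightarrow> 'o" where
  "triple_obj C R S = apex (pullback C (leg2 R) (leg1 S))"

definition coord1 :: "('o, 'a) cat \<Rightarrow> ('o, 'a) span \<Rightarrow> ('o, 'a) span \<Rightarrow> 'a" where
  "coord1 C R S = leg1 R \<cdot>\<^bsub>C\<^esub> leg1 (pullback C (leg2 R) (leg1 S))"

text \<open>By the pullback square this is also the first leg of \<open>S\<close> after the second
  projection; the middle entry is read off from \<open>R\<close> by convention.\<close>

definition coord2 :: "('o, 'a) cat \<Rightarrow> ('o, 'a) span \<Rightarrow> ('o, 'a) span \<Rightarrow> 'a" where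
  "coord2 C R S = leg2 R \<cdot>\<^bsub>C\<^esub> leg1 (pullback C (leg2 R) (leg1 S))"

definition coord3 :: "('o, 'a) cat \<Rightarrow> ('o, 'a) span \<Rightarrow> ('o, 'a) span \<Rightarrow> 'a" where
  "coord3 C R S = leg2 S \<cdot>\<^bsub>C\<^esub> leg2 (pullback C (leg2 R) (leg1 S))"

definition app ::
    "('o, 'a) cat \<Rightarrow> ('o, 'a) span \<Rightarrow> ('o, 'a) span \<Rightarrow> 'a \<Rightarrow> 'o \<Rightarrow> 'a \<Rightarrow> 'a \<Rightarrow> 'a \<Rightarrow> 'a" where
  "app C R S p T x y z = p \<cdot>\<^bsub>C\<^esub> triple C R S T x y z"

text \<open>When \<open>R'\<close> is a relation, this exhibits it as the regular image of
  \<open>R\<close> along \<open>e\<close>: its legs and \<open>eR\<close> form the epi-mono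
  factorisation of the pair of legs of \<open>R\<close> followed by \<open>e\<close>.\<close>

definition quotient_relation ::
    "('o, 'a) cat \<Rightarrow> 'a \<Rightarrow> ('o, 'a) span \<Rightarrow> ('o, 'a) span \<Rightarrow> 'a \<Rightarrow> bool" where
  "quotient_relation C e R R' eR \<longleftrightarrow> cover C eR (apex R) (apex R') \<and>
     leg1 R' \<cdot>\<^bsub>C\<^esub> eR = e \<cdot>\<^bsub>C\<^esub> leg1 R \<and> leg2 R' \<cdot>\<^bsub>C\<^esub> eR = e \<cdot>\<^bsub>C\<^esub> leg2 R"

context regular_category
begin

context
  fixes R S X
  assumes R: "is_relation C X X R" and S: "is_relation C X X S"
begin

private abbreviation "W \<equiv> pullback C (leg2 R) (leg1 S)"

private lemma W: "is_pullback C (leg2 R) (leg1 S) W"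
  using is_relationD[OF R] is_relationD[OF S] by (intro pullback_is_pullback) (auto simp: hom_iff)

private lemma W_legs: "leg1 W \<in> hom C (triple_obj C R S) (apex R)" "leg2 W \<in> hom C (triple_obj C R S) (apex S)"
  "leg1 S \<cdot> leg2 W = leg2 R \<cdot> leg1 W"
  using is_relationD[OF R] is_relationD[OF S] is_pullbackD[OF W] by (auto simp: hom_iff triple_obj_def)

lemma coord_hom:
  "coord1 C R S \<in> hom C (triple_obj C R S) X" "coord2 C R S \<in> hom C (triple_obj C R S) X"
  "coord3 C R S \<in> hom C (triple_obj C R S) X"
  unfolding coord1_def coord2_def coord3_def
  using is_relationD[OF R] is_relationD[OF S] W_legs Comp_in_hom by blast+

lemma coord_Comp:
  assumes u: "u \<in> hom C T (triple_obj C R S)"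
  shows "leg1 R \<cdot> (leg1 W \<cdot> u) = coord1 C R S \<cdot> u" "leg2 R \<cdot> (leg1 W \<cdot> u) = coord2 C R S \<cdot> u"
    "leg1 S \<cdot> (leg2 W \<cdot> u) = coord2 C R S \<cdot> u" "leg2 S \<cdot> (leg2 W \<cdot> u) = coord3 C R S \<cdot> u"
  unfolding coord1_def coord2_def coord3_def
  using is_relationD[OF R] is_relationD[OF S] W_legs Comp_assoc[OF u] by metis+

lemma coord_in_pullback:
  assumes u: "u \<in> hom C T (triple_obj C R S)"
  shows "in_pullback C R S T (coord1 C R S \<cdot> u) (coord2 C R S \<cdot> u) (coord3 C R S \<cdot> u)"
  unfolding in_pullback_def
  using relatedI[OF Comp_in_hom[OF u W_legs(1)] coord_Comp(1,2)[OF u]]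
    relatedI[OF Comp_in_hom[OF u W_legs(2)] coord_Comp(3,4)[OF u]] by blast

lemma coord_in_pullback_generic:
  "in_pullback C R S (triple_obj C R S) (coord1 C R S) (coord2 C R S) (coord3 C R S)"
  using coord_in_pullback[OF Ide_in_hom[OF hom_Obj(1)[OF coord_hom(1)]]] coord_hom Comp_Ide_right by metis

lemma coord_eqI:
  assumes u: "u \<in> hom C T (triple_obj C R S)" and v: "v \<in> hom C T (triple_obj C R S)"
    and eq: "coord1 C R S \<cdot> u = coord1 C R S \<cdot> v" "coord2 C R S \<cdot> u = coord2 C R S \<cdot> v"
      "coord3 C R S \<cdot> u = coord3 C R S \<cdot> v"
  shows "u = v"
proof (rule pullback_eqI[OF W u[unfolded triple_obj_def] v[unfolded triple_obj_def]])
  show "leg1 W \<cdot> u = leg1 W \<cdot> v"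
    using coord_Comp[OF u] coord_Comp[OF v] eq
    by (intro relation_eqI[OF R Comp_in_hom[OF u W_legs(1)] Comp_in_hom[OF v W_legs(1)]]) simp_all
  show "leg2 W \<cdot> u = leg2 W \<cdot> v"
    using coord_Comp[OF u] coord_Comp[OF v] eq
    by (intro relation_eqI[OF S Comp_in_hom[OF u W_legs(2)] Comp_in_hom[OF v W_legs(2)]]) simp_all
qed

text \<open>Discharges the definite description in \<open>triple\<close> once and for all: every
  arrow into the object of triples is the triple of its own coordinates.\<close>

lemma triple_eqI:
  assumes u: "u \<in> hom C T (triple_obj C R S)"
  shows "triple C R S T (coord1 C R S \<cdot> u) (coord2 C R S \<cdot> u) (coord3 C R S \<cdot> u) = u"
  unfolding triple_def Let_def
proof (rule the_equality)
  show "u \<in> hom C T (apex W) \<and> leg1 R \<cdot> (leg1 W \<cdot> u) = coord1 C R S \<cdot> u \<and>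
      leg2 R \<cdot> (leg1 W \<cdot> u) = coord2 C R S \<cdot> u \<and> leg1 S \<cdot> (leg2 W \<cdot> u) = coord2 C R S \<cdot> u \<and>
      leg2 S \<cdot> (leg2 W \<cdot> u) = coord3 C R S \<cdot> u"
    using coord_Comp[OF u] u by (simp add: triple_obj_def)
  fix v assume v: "v \<in> hom C T (apex W) \<and> leg1 R \<cdot> (leg1 W \<cdot> v) = coord1 C R S \<cdot> u \<and>
      leg2 R \<cdot> (leg1 W \<cdot> v) = coord2 C R S \<cdot> u \<and> leg1 S \<cdot> (leg2 W \<cdot> v) = coord2 C R S \<cdot> u \<and>
      leg2 S \<cdot> (leg2 W \<cdot> v) = coord3 C R S \<cdot> u"
  hence v': "v \<in> hom C T (triple_obj C R S)" by (simp add: triple_obj_def)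
  show "v = u" using coord_Comp[OF v'] v by (intro coord_eqI[OF v' u]) simp_all
qed

lemma triple_ex:
  assumes d: "in_pullback C R S T x y z"
  obtains u where "u \<in> hom C T (triple_obj C R S)" "coord1 C R S \<cdot> u = x" "coord2 C R S \<cdot> u = y"
    "coord3 C R S \<cdot> u = z"
proof -
  have r: "related C R T x y" "related C S T y z" using d by (auto simp: in_pullback_def)
  obtain h where h: "h \<in> hom C T (apex R)" "leg1 R \<cdot> h = x" "leg2 R \<cdot> h = y" using r(1) by (rule relatedE)
  obtain k where k: "k \<in> hom C T (apex S)" "leg1 S \<cdot> k = y" "leg2 S \<cdot> k = z" using r(2) by (rule relatedE)
  have dom: "Dom C (leg1 S) = apex S" "Dom C (leg2 R) = apex R"
    using is_relationD[OF R] is_relationD[OF S] by (auto simp: hom_iff)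
  obtain u where u: "u \<in> hom C T (triple_obj C R S)" "leg1 W \<cdot> u = h" "leg2 W \<cdot> u = k"
    using pullback_lift[OF W, of h T k] h k dom by (auto simp: triple_obj_def)
  show ?thesis using that[OF u(1)] coord_Comp[OF u(1)] h k u by metis
qed

lemma triple:
  assumes d: "in_pullback C R S T x y z"
  shows "triple C R S T x y z \<in> hom C T (triple_obj C R S)" "coord1 C R S \<cdot> triple C R S T x y z = x"
    "coord2 C R S \<cdot> triple C R S T x y z = y" "coord3 C R S \<cdot> triple C R S T x y z = z"
proof -
  obtain u where u: "u \<in> hom C T (triple_obj C R S)" "coord1 C R S \<cdot> u = x" "coord2 C R S \<cdot> u = y"
    "coord3 C R S \<cdot> u = z" using triple_ex[OF d] .
  have "triple C R S T x y z = u" using triple_eqI[OF u(1)] u(2-4) by simp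
  with u show "triple C R S T x y z \<in> hom C T (triple_obj C R S)" "coord1 C R S \<cdot> triple C R S T x y z = x"
    "coord2 C R S \<cdot> triple C R S T x y z = y" "coord3 C R S \<cdot> triple C R S T x y z = z" by simp_all
qed

lemma in_pullback_hom:
  assumes "in_pullback C R S T x y z"
  shows "x \<in> hom C T X" "y \<in> hom C T X" "z \<in> hom C T X"
  using assms related_hom[OF R] related_hom[OF S] by (auto simp: in_pullback_def)

lemma in_pullback_comp:
  "\<lbrakk>in_pullback C R S T x y z; q \<in> hom C T' T\<rbrakk> \<Longrightarrow> in_pullback C R S T' (x \<cdot> q) (y \<cdot> q) (z \<cdot> q)"
  unfolding in_pullback_def using related_comp[OF R] related_comp[OF S] by blast

lemma triple_comp:
  assumes d: "in_pullback C R S T x y z" and q: "q \<in> hom C T' T"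
  shows "triple C R S T' (x \<cdot> q) (y \<cdot> q) (z \<cdot> q) = triple C R S T x y z \<cdot> q"
proof -
  note t = triple[OF d]
  have "triple C R S T x y z \<cdot> q \<in> hom C T' (triple_obj C R S)" using q t(1) by (rule Comp_in_hom)
  from triple_eqI[OF this] show ?thesis
    using reassoc[OF t(2,1) coord_hom(1) q] reassoc[OF t(3,1) coord_hom(2) q]
      reassoc[OF t(4,1) coord_hom(3) q] by simp
qed

lemma app_hom:
  "\<lbrakk>p \<in> hom C (triple_obj C R S) Z; in_pullback C R S T x y z\<rbrakk> \<Longrightarrow> app C R S p T x y z \<in> hom C T Z"
  unfolding app_def by (rule Comp_in_hom[OF triple(1)])

lemma app_comp:
  assumes p: "p \<in> hom C (triple_obj C R S) Z" and d: "in_pullback C R S T x y z" and q: "q \<in> hom C T' T"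
  shows "app C R S p T' (x \<cdot> q) (y \<cdot> q) (z \<cdot> q) = app C R S p T x y z \<cdot> q"
  unfolding app_def triple_comp[OF d q] using Comp_assoc[OF q triple(1)[OF d] p] .

lemma app_coord:
  assumes u: "u \<in> hom C T (triple_obj C R S)"
  shows "app C R S p T (coord1 C R S \<cdot> u) (coord2 C R S \<cdot> u) (coord3 C R S \<cdot> u) = p \<cdot> u"
  unfolding app_def triple_eqI[OF u] ..

lemma app_generic:
  assumes p: "p \<in> hom C (triple_obj C R S) Z"
  shows "app C R S p (triple_obj C R S) (coord1 C R S) (coord2 C R S) (coord3 C R S) = p"
  using app_coord[OF Ide_in_hom[OF hom_Obj(1)[OF coord_hom(1)]], of p] coord_hom Comp_Ide_right p by metis

lemma is_connectorD:
  assumes "is_connector C X R S p"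
  shows "p \<in> hom C (triple_obj C R S) X"
    "in_pullback C R S T x y z \<Longrightarrow> related C S T x (app C R S p T x y z)"
    "in_pullback C R S T x y z \<Longrightarrow> related C R T (app C R S p T x y z) z"
    "in_pullback C R S T x x y \<Longrightarrow> app C R S p T x x y = y"
    "in_pullback C R S T x y y \<Longrightarrow> app C R S p T x y y = x"
    "\<lbrakk>in_pullback C R S T z u v; in_pullback C R S T x y (app C R S p T z u v);
      in_pullback C R S T x y z; in_pullback C R S T (app C R S p T x y z) u v\<rbrakk>
      \<Longrightarrow> app C R S p T x y (app C R S p T z u v) = app C R S p T (app C R S p T x y z) u v"
proof -
  show "p \<in> hom C (triple_obj C R S) X"
    using assms by (simp add: is_connector_def triple_obj_def)
  have obj: "T \<in> Obj C" if "in_pullback C R S T x y z" for T x y z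
    using in_pullback_hom(1)[OF that] hom_Obj by blast
  note law = conjunct2[OF assms[unfolded is_connector_def Let_def, folded app_def], rule_format]
  show "in_pullback C R S T x y z \<Longrightarrow> related C S T x (app C R S p T x y z)"
    "in_pullback C R S T x y z \<Longrightarrow> related C R T (app C R S p T x y z) z"
    "in_pullback C R S T x x y \<Longrightarrow> app C R S p T x x y = y"
    "in_pullback C R S T x y y \<Longrightarrow> app C R S p T x y y = x"
    "\<lbrakk>in_pullback C R S T z u v; in_pullback C R S T x y (app C R S p T z u v);
      in_pullback C R S T x y z; in_pullback C R S T (app C R S p T x y z) u v\<rbrakk>
      \<Longrightarrow> app C R S p T x y (app C R S p T z u v) = app C R S p T (app C R S p T x y z) u v"
    using law obj by blast+
qed

end

lemma is_connectorI:
  assumes "p \<in> hom C (triple_obj C R S) X"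
    and "\<And>T x y z. in_pullback C R S T x y z \<Longrightarrow> related C S T x (app C R S p T x y z)"
    and "\<And>T x y z. in_pullback C R S T x y z \<Longrightarrow> related C R T (app C R S p T x y z) z"
    and "\<And>T x y. in_pullback C R S T x x y \<Longrightarrow> app C R S p T x x y = y"
    and "\<And>T x y. in_pullback C R S T x y y \<Longrightarrow> app C R S p T x y y = x"
    and "\<And>T x y z u v. \<lbrakk>in_pullback C R S T z u v; in_pullback C R S T x y (app C R S p T z u v);
      in_pullback C R S T x y z; in_pullback C R S T (app C R S p T x y z) u v\<rbrakk>
      \<Longrightarrow> app C R S p T x y (app C R S p T z u v) = app C R S p T (app C R S p T x y z) u v"
  shows "is_connector C X R S p"
  unfolding is_connector_def Let_def app_def[symmetric]
  using assms by (auto simp: triple_obj_def)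

section \<open>Arrows acting on relations, triples and connectors\<close>

lemma related_map:
  assumes R: "is_relation C X X R" and R': "is_relation C Y Y R'" and f: "f \<in> hom C X Y"
    and fR: "fR \<in> hom C (apex R) (apex R')" "leg1 R' \<cdot> fR = f \<cdot> leg1 R" "leg2 R' \<cdot> fR = f \<cdot> leg2 R"
    and r: "related C R T x y"
  shows "related C R' T (f \<cdot> x) (f \<cdot> y)"
proof -
  note D = is_relationD[OF R] and D' = is_relationD[OF R']
  obtain h where h: "h \<in> hom C T (apex R)" "leg1 R \<cdot> h = x" "leg2 R \<cdot> h = y" using r by (rule relatedE)
  show ?thesis
  proof (rule relatedI[OF Comp_in_hom[OF h(1) fR(1)]])
    show "leg1 R' \<cdot> (fR \<cdot> h) = f \<cdot> x"
      using reassoc[OF fR(2,1) D'(4) h(1)] Comp_assoc[OF h(1) D(4) f] h(2) by metis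
    show "leg2 R' \<cdot> (fR \<cdot> h) = f \<cdot> y"
      using reassoc[OF fR(3,1) D'(5) h(1)] Comp_assoc[OF h(1) D(5) f] h(3) by metis
  qed
qed

lemma in_pullback_map:
  assumes R: "is_relation C X X R" "is_relation C Y Y R'" and S: "is_relation C X X S" "is_relation C Y Y S'"
    and f: "f \<in> hom C X Y"
    and fR: "fR \<in> hom C (apex R) (apex R')" "leg1 R' \<cdot> fR = f \<cdot> leg1 R" "leg2 R' \<cdot> fR = f \<cdot> leg2 R"
    and fS: "fS \<in> hom C (apex S) (apex S')" "leg1 S' \<cdot> fS = f \<cdot> leg1 S" "leg2 S' \<cdot> fS = f \<cdot> leg2 S"
    and d: "in_pullback C R S T x y z"
  shows "in_pullback C R' S' T (f \<cdot> x) (f \<cdot> y) (f \<cdot> z)"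
  using d related_map[OF R f fR] related_map[OF S f fS] by (auto simp: in_pullback_def)

text \<open>\<open>induced\<close> is specified by the two projections of the pullback,
  \<open>triple\<close> by the coordinates in the base object. Joint monicity of the legs of
  \<open>R'\<close> and of \<open>S'\<close> turns agreement of coordinates into agreement of
  projections.\<close>

lemma induced_eq_triple:
  assumes R: "is_relation C X X R" "is_relation C Y Y R'" and S: "is_relation C X X S" "is_relation C Y Y S'"
    and f: "f \<in> hom C X Y"
    and fR: "fR \<in> hom C (apex R) (apex R')" "leg1 R' \<cdot> fR = f \<cdot> leg1 R" "leg2 R' \<cdot> fR = f \<cdot> leg2 R"
    and fS: "fS \<in> hom C (apex S) (apex S')" "leg1 S' \<cdot> fS = f \<cdot> leg1 S" "leg2 S' \<cdot> fS = f \<cdot> leg2 S"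
  shows "induced C R S R' S' fR fS = triple C R' S' (triple_obj C R S)
    (f \<cdot> coord1 C R S) (f \<cdot> coord2 C R S) (f \<cdot> coord3 C R S)"
    (is "_ = ?t")
proof -
  let ?W = "pullback C (leg2 R) (leg1 S)" and ?W' = "pullback C (leg2 R') (leg1 S')"
  note DR = is_relationD[OF R(1)] is_relationD[OF R(2)] and DS = is_relationD[OF S(1)] is_relationD[OF S(2)]
  have W: "is_pullback C (leg2 R) (leg1 S) ?W" and W': "is_pullback C (leg2 R') (leg1 S') ?W'"
    using DR DS by (auto intro!: pullback_is_pullback simp: hom_iff)
  have l: "leg1 ?W \<in> hom C (triple_obj C R S) (apex R)" "leg2 ?W \<in> hom C (triple_obj C R S) (apex S)"
    and l': "leg1 ?W' \<in> hom C (triple_obj C R' S') (apex R')" "leg2 ?W' \<in> hom C (triple_obj C R' S') (apex S')"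
    using is_pullbackD[OF W] is_pullbackD[OF W'] DR DS by (auto simp: hom_iff triple_obj_def)
  note t = triple[OF R(2) S(2) in_pullback_map[OF R S f fR fS coord_in_pullback_generic[OF R(1) S(1)]]]
  note c = coord_Comp[OF R(2) S(2)]
  have eq: "leg1 R' \<cdot> (fR \<cdot> leg1 ?W) = f \<cdot> coord1 C R S" "leg2 R' \<cdot> (fR \<cdot> leg1 ?W) = f \<cdot> coord2 C R S"
    "leg1 S' \<cdot> (fS \<cdot> leg2 ?W) = f \<cdot> coord2 C R S" "leg2 S' \<cdot> (fS \<cdot> leg2 ?W) = f \<cdot> coord3 C R S"
    using reassoc[OF fR(2,1) DR(9) l(1)] reassoc[OF fR(3,1) DR(10) l(1)]
      reassoc[OF fS(2,1) DS(9) l(2)] reassoc[OF fS(3,1) DS(10) l(2)]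
      Comp_assoc[OF l(1) DR(4) f] Comp_assoc[OF l(1) DR(5) f] Comp_assoc[OF l(2) DS(4) f] Comp_assoc[OF l(2) DS(5) f]
      is_pullbackD(7)[OF W]
    unfolding coord1_def coord2_def coord3_def by metis+
  show ?thesis unfolding induced_def Let_def triple_obj_def[symmetric]
  proof (rule the_equality)
    have "leg1 ?W' \<cdot> ?t = fR \<cdot> leg1 ?W"
    proof (rule relation_eqI[OF R(2) Comp_in_hom[OF t(1) l'(1)] Comp_in_hom[OF l(1) fR(1)]])
      show "leg1 R' \<cdot> (leg1 ?W' \<cdot> ?t) = leg1 R' \<cdot> (fR \<cdot> leg1 ?W)" using c(1)[OF t(1)] t(2) eq(1) by simp
      show "leg2 R' \<cdot> (leg1 ?W' \<cdot> ?t) = leg2 R' \<cdot> (fR \<cdot> leg1 ?W)" using c(2)[OF t(1)] t(3) eq(2) by simp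
    qed
    moreover have "leg2 ?W' \<cdot> ?t = fS \<cdot> leg2 ?W"
    proof (rule relation_eqI[OF S(2) Comp_in_hom[OF t(1) l'(2)] Comp_in_hom[OF l(2) fS(1)]])
      show "leg1 S' \<cdot> (leg2 ?W' \<cdot> ?t) = leg1 S' \<cdot> (fS \<cdot> leg2 ?W)" using c(3)[OF t(1)] t(3) eq(3) by simp
      show "leg2 S' \<cdot> (leg2 ?W' \<cdot> ?t) = leg2 S' \<cdot> (fS \<cdot> leg2 ?W)" using c(4)[OF t(1)] t(4) eq(4) by simp
    qed
    ultimately show t': "?t \<in> hom C (triple_obj C R S) (triple_obj C R' S') \<and>
        leg1 ?W' \<cdot> ?t = fR \<cdot> leg1 ?W \<and> leg2 ?W' \<cdot> ?t = fS \<cdot> leg2 ?W" using t(1) by blast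
    fix u assume "u \<in> hom C (triple_obj C R S) (triple_obj C R' S') \<and>
        leg1 ?W' \<cdot> u = fR \<cdot> leg1 ?W \<and> leg2 ?W' \<cdot> u = fS \<cdot> leg2 ?W"
    with t' show "u = ?t" using pullback_eqI[OF W'] unfolding triple_obj_def by metis
  qed
qed

text \<open>A Yoneda argument: the elementwise condition at the generic triple is the equation of
  arrows, and conversely the equation is composed with the arrow classifying an arbitrary
  triple.\<close>

lemma preserves_connector_iff:
  assumes R: "is_relation C X X R" "is_relation C Y Y R'" and S: "is_relation C X X S" "is_relation C Y Y S'"
    and f: "f \<in> hom C X Y"
    and fR: "fR \<in> hom C (apex R) (apex R')" "leg1 R' \<cdot> fR = f \<cdot> leg1 R" "leg2 R' \<cdot> fR = f \<cdot> leg2 R"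
    and fS: "fS \<in> hom C (apex S) (apex S')" "leg1 S' \<cdot> fS = f \<cdot> leg1 S" "leg2 S' \<cdot> fS = f \<cdot> leg2 S"
    and p: "p \<in> hom C (triple_obj C R S) X" "p' \<in> hom C (triple_obj C R' S') Y"
  shows "f \<cdot> p = p' \<cdot> induced C R S R' S' fR fS \<longleftrightarrow> (\<forall>T x y z. in_pullback C R S T x y z \<longrightarrow>
    f \<cdot> app C R S p T x y z = app C R' S' p' T (f \<cdot> x) (f \<cdot> y) (f \<cdot> z))"
    (is "?l \<longleftrightarrow> ?r")
proof
  note ind = induced_eq_triple[OF R S f fR fS]
  note gen = coord_in_pullback_generic[OF R(1) S(1)] and ch = coord_hom[OF R(1) S(1)]
  note gen' = in_pullback_map[OF R S f fR fS gen]
  show ?l if ?r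
    using that[rule_format, OF gen] unfolding app_generic[OF R(1) S(1) p(1)] ind by (simp add: app_def)
  assume l: ?l
  show ?r
  proof (intro allI impI)
    fix T x y z assume d: "in_pullback C R S T x y z"
    note t = triple[OF R(1) S(1) d]
    let ?t = "triple C R S T x y z"
    have "f \<cdot> app C R S p T x y z = (f \<cdot> p) \<cdot> ?t"
      unfolding app_def using Comp_assoc[OF t(1) p(1) f] .
    also have "\<dots> = app C R' S' p' (triple_obj C R S) (f \<cdot> coord1 C R S) (f \<cdot> coord2 C R S) (f \<cdot> coord3 C R S) \<cdot> ?t"
      using l unfolding ind by (simp add: app_def)
    also have "\<dots> = app C R' S' p' T ((f \<cdot> coord1 C R S) \<cdot> ?t) ((f \<cdot> coord2 C R S) \<cdot> ?t) ((f \<cdot> coord3 C R S) \<cdot> ?t)"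
      using app_comp[OF R(2) S(2) p(2) gen' t(1)] by simp
    also have "\<dots> = app C R' S' p' T (f \<cdot> x) (f \<cdot> y) (f \<cdot> z)"
      using Comp_assoc[OF t(1) ch(1) f] Comp_assoc[OF t(1) ch(2) f] Comp_assoc[OF t(1) ch(3) f] t(2-4) by simp
    finally show "f \<cdot> app C R S p T x y z = app C R' S' p' T (f \<cdot> x) (f \<cdot> y) (f \<cdot> z)" .
  qed
qed

text \<open>The witness of relatedness in \<open>R'\<close> is lifted along the cover
  \<open>eR\<close>, and the legs of the lift give \<open>x\<close> and \<open>y\<close>.\<close>

lemma quotient_lift:
  assumes q: "quotient_relation C e R R' eR" and R: "is_relation C X X R" and R': "is_relation C Y Y R'"
    and e: "e \<in> hom C X Y" and r: "related C R' T a b"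
  obtains T' q x y where "cover C q T' T" "related C R T' x y" "e \<cdot> x = a \<cdot> q" "e \<cdot> y = b \<cdot> q"
proof -
  have cov: "cover C eR (apex R) (apex R')" and eq: "leg1 R' \<cdot> eR = e \<cdot> leg1 R" "leg2 R' \<cdot> eR = e \<cdot> leg2 R"
    using q by (auto simp: quotient_relation_def)
  note D = is_relationD[OF R] and D' = is_relationD[OF R'] and eR = cover_hom[OF cov]
  obtain h where h: "h \<in> hom C T (apex R')" "leg1 R' \<cdot> h = a" "leg2 R' \<cdot> h = b" using r by (rule relatedE)
  obtain T' q k where q: "cover C q T' T" and k: "k \<in> hom C T' (apex R)" "eR \<cdot> k = h \<cdot> q"
    using cover_pullback[OF cov h(1)] .
  note q' = cover_hom[OF q]
  show ?thesis
  proof (rule that[OF q relatedI[OF k(1) refl refl]])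
    show "e \<cdot> (leg1 R \<cdot> k) = a \<cdot> q"
      using Comp_assoc[OF k(1) D(4) e] reassoc[OF eq(1) eR D'(4) k(1)] k(2) Comp_assoc[OF q' h(1) D'(4)] h(2) by metis
    show "e \<cdot> (leg2 R \<cdot> k) = b \<cdot> q"
      using Comp_assoc[OF k(1) D(5) e] reassoc[OF eq(2) eR D'(5) k(1)] k(2) Comp_assoc[OF q' h(1) D'(5)] h(3) by metis
  qed
qed

end

section \<open>Regular images of equivalence relations, and lifting along compatible
  sections\<close>

context goursat_category
begin

text \<open>Reflexivity and symmetry lift directly; transitivity needs the Goursat law. Lifts
  \<open>x R y\<close> of \<open>a R' b\<close> and \<open>y' R z\<close> of \<open>b R' c\<close>
  have middle elements that merely agree under \<open>e\<close>, so with \<open>K\<close> the kernel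
  pair of \<open>e\<close> one has x R y K y' R z. The law replaces this by x K v R w K z, and
  \<open>v R w\<close> lies over the pair \<open>a\<close>, \<open>c\<close>.\<close>

lemma quotient_equivalence:
  assumes q: "quotient_relation C e R R' eR" and R: "is_equivalence C X R" and R': "is_relation C Y Y R'"
    and e: "cover C e X Y"
  shows "is_equivalence C Y R'"
proof (rule is_equivalenceI[OF R'])
  note Rr = is_equivalence_relation[OF R] and e' = cover_hom[OF e]
  have map: "related C R T x y \<Longrightarrow> related C R' T (e \<cdot> x) (e \<cdot> y)" for T x y
    using related_map[OF Rr R' e'] q by (auto simp: quotient_relation_def cover_def)
  note lift = quotient_lift[OF q Rr R' e']
  show "related C R' T y y" if y: "y \<in> hom C T Y" for T y
  proof -
    obtain T' q x where q: "cover C q T' T" and x: "x \<in> hom C T' X" "e \<cdot> x = y \<cdot> q"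
      using cover_pullback[OF e y] .
    have "related C R' T' (y \<cdot> q) (y \<cdot> q)" using map[OF related_refl[OF R x(1)]] x(2) by simp
    thus ?thesis by (rule related_local[OF R' y y q])
  qed
  show "related C R' T b a" if r: "related C R' T a b" for T a b
  proof -
    obtain T' q x y where q: "cover C q T' T" and x: "related C R T' x y" "e \<cdot> x = a \<cdot> q" "e \<cdot> y = b \<cdot> q"
      using lift[OF r] .
    have "related C R' T' (b \<cdot> q) (a \<cdot> q)" using map[OF related_sym[OF R x(1)]] x(2,3) by simp
    thus ?thesis using related_local[OF R' _ _ q] related_hom[OF R' r] by blast
  qed
  show "related C R' T a c" if r: "related C R' T a b" and r': "related C R' T b c" for T a b c
  proof -
    obtain T1 q1 x y where 1: "cover C q1 T1 T" "related C R T1 x y" "e \<cdot> x = a \<cdot> q1" "e \<cdot> y = b \<cdot> q1"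
      using lift[OF r] .
    note q1 = cover_hom[OF 1(1)]
    obtain T2 q2 y' z where 2: "cover C q2 T2 T1" "related C R T2 y' z" "e \<cdot> y' = (b \<cdot> q1) \<cdot> q2" "e \<cdot> z = (c \<cdot> q1) \<cdot> q2"
      using lift[OF related_comp[OF R' r' q1]] .
    note q2 = cover_hom[OF 2(1)]
    obtain K where K: "is_equivalence C X K"
      "\<And>T x y. related C K T x y \<longleftrightarrow> x \<in> hom C T X \<and> y \<in> hom C T X \<and> e \<cdot> x = e \<cdot> y"
      using kernel_equivalence[OF e'] by blast
    note h = related_hom[OF Rr 1(2)] related_hom[OF Rr 2(2)]
    have eq: "e \<cdot> (x \<cdot> q2) = (a \<cdot> q1) \<cdot> q2" "e \<cdot> (y \<cdot> q2) = (b \<cdot> q1) \<cdot> q2"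
      using reassoc[OF 1(3) h(1) e' q2] reassoc[OF 1(4) h(2) e' q2] .
    have xy: "related C R T2 (x \<cdot> q2) (y \<cdot> q2)" using related_comp[OF Rr 1(2) q2] .
    have yy': "related C K T2 (y \<cdot> q2) y'"
      using K(2) eq(2) 2(3) h(3) Comp_in_hom[OF q2 h(2)] by metis
    obtain T3 q3 v w where 3: "cover C q3 T3 T2" "related C K T3 ((x \<cdot> q2) \<cdot> q3) v"
      "related C R T3 v w" "related C K T3 w (z \<cdot> q3)"
      using goursat_related[OF R K(1) xy yy' 2(2)] .
    note q3 = cover_hom[OF 3(1)]
    let ?q = "q1 \<cdot> (q2 \<cdot> q3)"
    have q23: "q2 \<cdot> q3 \<in> hom C T3 T1" using q3 q2 by (rule Comp_in_hom)
    have q: "cover C ?q T3 T" using cover_comp[OF cover_comp[OF 3(1) 2(1)] 1(1)] .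
    have as: "((s \<cdot> q1) \<cdot> q2) \<cdot> q3 = s \<cdot> ?q" if s: "s \<in> hom C T Y" for s
      using Comp_assoc[OF q3 q2 Comp_in_hom[OF q1 s]] Comp_assoc[OF q23 q1 s] by simp
    have a: "a \<in> hom C T Y" and c: "c \<in> hom C T Y" using related_hom[OF R' r] related_hom[OF R' r'] by auto
    have "e \<cdot> v = e \<cdot> ((x \<cdot> q2) \<cdot> q3)" using 3(2) K(2) by metis
    also have "\<dots> = ((a \<cdot> q1) \<cdot> q2) \<cdot> q3" using reassoc[OF eq(1) Comp_in_hom[OF q2 h(1)] e' q3] .
    also have "\<dots> = a \<cdot> ?q" using as[OF a] .
    finally have ev: "e \<cdot> v = a \<cdot> ?q" .
    have "e \<cdot> w = e \<cdot> (z \<cdot> q3)" using 3(4) K(2) by metis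
    also have "\<dots> = ((c \<cdot> q1) \<cdot> q2) \<cdot> q3" using reassoc[OF 2(4) h(4) e' q3] .
    also have "\<dots> = c \<cdot> ?q" using as[OF c] .
    finally have "related C R' T3 (a \<cdot> ?q) (c \<cdot> ?q)" using map[OF 3(3)] ev by simp
    thus ?thesis by (rule related_local[OF R' a c q])
  qed
qed

text \<open>Over a Goursat category, compatible elements of two split epimorphisms that agree after passing
  to a quotient lift to elements that agree on the nose: apply the Goursat law on the pullback of
  \<^term>\<open>a\<close> and \<^term>\<open>b\<close> to the kernel pair of its diagonal and that of the arrow induced by
  \<^term>\<open>hA\<close> and \<^term>\<open>hB\<close>, along the chain
  \<open>(x, tax), (sax, tax), (sby, tby), (sby, y)\<close>.\<close>

lemma split_lift:
  assumes a: "a \<in> hom C A X" and b: "b \<in> hom C B X" and s: "s \<in> hom C X A" "a \<cdot> s = Ide C X"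
    and t: "t \<in> hom C X B" "b \<cdot> t = Ide C X"
    and hA: "hA \<in> hom C A A'" and hB: "hB \<in> hom C B B'"
    and x: "x \<in> hom C T A" and y: "y \<in> hom C T B"
    and eq: "hA \<cdot> (s \<cdot> (a \<cdot> x)) = hA \<cdot> (s \<cdot> (b \<cdot> y))" "hB \<cdot> (t \<cdot> (a \<cdot> x)) = hB \<cdot> (t \<cdot> (b \<cdot> y))"
  obtains T' q x' y' where "cover C q T' T" "x' \<in> hom C T' A" "y' \<in> hom C T' B" "a \<cdot> x' = b \<cdot> y'"
    "hA \<cdot> x' = hA \<cdot> (x \<cdot> q)" "hB \<cdot> y' = hB \<cdot> (y \<cdot> q)"
proof -
  obtain P where P: "is_pullback C a b P" using pullback_ex[of a b] a b by (auto simp: hom_iff)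
  have D: "leg1 P \<in> hom C (apex P) A" "leg2 P \<in> hom C (apex P) B" "a \<cdot> leg1 P = b \<cdot> leg2 P"
    using is_pullbackD[OF P] a b by (auto simp: hom_iff)
  have ax: "a \<cdot> x \<in> hom C T X" and b_y: "b \<cdot> y \<in> hom C T X" using x y a b Comp_in_hom by blast+
  have sec: "a \<cdot> (s \<cdot> w) = w" "b \<cdot> (t \<cdot> w) = w" if w: "w \<in> hom C T X" for w
    using reassoc[OF s(2,1) a w] reassoc[OF t(2,1) b w] Comp_Ide_left[OF w] by auto
  have pair: "\<exists>u \<in> hom C T (apex P). leg1 P \<cdot> u = v \<and> leg2 P \<cdot> u = w"
    if "v \<in> hom C T A" "w \<in> hom C T B" "a \<cdot> v = b \<cdot> w" for v w
    using pullback_lift[OF P, of v T w] that a b by (metis hom_iff)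
  have st: "s \<cdot> (a \<cdot> x) \<in> hom C T A" "t \<cdot> (a \<cdot> x) \<in> hom C T B" "s \<cdot> (b \<cdot> y) \<in> hom C T A" "t \<cdot> (b \<cdot> y) \<in> hom C T B"
    using ax b_y s t Comp_in_hom by blast+
  obtain u0 where u0: "u0 \<in> hom C T (apex P)" "leg1 P \<cdot> u0 = x" "leg2 P \<cdot> u0 = t \<cdot> (a \<cdot> x)"
    using pair[OF x st(2)] sec[OF ax] by auto
  obtain u1 where u1: "u1 \<in> hom C T (apex P)" "leg1 P \<cdot> u1 = s \<cdot> (a \<cdot> x)" "leg2 P \<cdot> u1 = t \<cdot> (a \<cdot> x)"
    using pair[OF st(1,2)] sec[OF ax] by auto
  obtain u2 where u2: "u2 \<in> hom C T (apex P)" "leg1 P \<cdot> u2 = s \<cdot> (b \<cdot> y)" "leg2 P \<cdot> u2 = t \<cdot> (b \<cdot> y)"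
    using pair[OF st(3,4)] sec[OF b_y] by auto
  obtain u3 where u3: "u3 \<in> hom C T (apex P)" "leg1 P \<cdot> u3 = s \<cdot> (b \<cdot> y)" "leg2 P \<cdot> u3 = y"
    using pair[OF st(3) y] sec[OF b_y] by auto
  let ?f = "a \<cdot> leg1 P"
  have f: "?f \<in> hom C (apex P) X" using D(1) a by (rule Comp_in_hom)
  have f_comp: "?f \<cdot> u = a \<cdot> (leg1 P \<cdot> u)" "?f \<cdot> u = b \<cdot> (leg2 P \<cdot> u)" if "u \<in> hom C T' (apex P)" for u T'
    using Comp_assoc[OF that D(1) a] Comp_assoc[OF that D(2) b] D(3) by simp_all
  have hl: "hA \<cdot> leg1 P \<in> hom C (apex P) A'" "hB \<cdot> leg2 P \<in> hom C (apex P) B'"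
    using D hA hB Comp_in_hom by blast+
  have h_comp: "(hA \<cdot> leg1 P) \<cdot> u = hA \<cdot> (leg1 P \<cdot> u)" "(hB \<cdot> leg2 P) \<cdot> u = hB \<cdot> (leg2 P \<cdot> u)"
    if "u \<in> hom C T' (apex P)" for u T'
    using Comp_assoc[OF that D(1) hA] Comp_assoc[OF that D(2) hB] by simp_all
  obtain g Z where g: "g \<in> hom C (apex P) Z" "\<And>T u v. \<lbrakk>u \<in> hom C T (apex P); v \<in> hom C T (apex P)\<rbrakk>
      \<Longrightarrow> g \<cdot> u = g \<cdot> v \<longleftrightarrow> (hA \<cdot> leg1 P) \<cdot> u = (hA \<cdot> leg1 P) \<cdot> v \<and> (hB \<cdot> leg2 P) \<cdot> u = (hB \<cdot> leg2 P) \<cdot> v"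
    using pairing_ex[OF hl] by blast
  have e1: "?f \<cdot> u0 = ?f \<cdot> u1" using f_comp(2)[OF u0(1)] f_comp(2)[OF u1(1)] u0(3) u1(3) by simp
  have e2: "g \<cdot> u1 = g \<cdot> u2"
    using g(2)[OF u1(1) u2(1)] h_comp[OF u1(1)] h_comp[OF u2(1)] u1 u2 eq by simp
  have e3: "?f \<cdot> u2 = ?f \<cdot> u3" using f_comp(1)[OF u2(1)] f_comp(1)[OF u3(1)] u2(2) u3(2) by simp
  obtain T' q v w where q: "cover C q T' T" and v: "v \<in> hom C T' (apex P)"
    and w: "w \<in> hom C T' (apex P)" and vw: "g \<cdot> (u0 \<cdot> q) = g \<cdot> v" "?f \<cdot> v = ?f \<cdot> w" "g \<cdot> w = g \<cdot> (u3 \<cdot> q)"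
    using goursat_kernels[OF f g(1) u0(1) u1(1) u2(1) u3(1) e1 e2 e3] .
  note q' = cover_hom[OF q]
  have uq: "u0 \<cdot> q \<in> hom C T' (apex P)" "u3 \<cdot> q \<in> hom C T' (apex P)" using q' u0(1) u3(1) Comp_in_hom by blast+
  \<comment> \<open>The law does not make \<open>v\<close> and \<open>w\<close> equal; they only
    agree under the diagonal \<open>?f\<close>. That suffices: the first leg of \<open>v\<close> and
    the second leg of \<open>w\<close> then match over \<open>X\<close>, and \<open>g\<close>
    controls exactly these two legs.\<close>
  show ?thesis
  proof (rule that[OF q])
    show "leg1 P \<cdot> v \<in> hom C T' A" using v D(1) by (rule Comp_in_hom)
    show "leg2 P \<cdot> w \<in> hom C T' B" using w D(2) by (rule Comp_in_hom)
    show "a \<cdot> (leg1 P \<cdot> v) = b \<cdot> (leg2 P \<cdot> w)" using f_comp(1)[OF v] f_comp(2)[OF w] vw(2) by simp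
    show "hA \<cdot> (leg1 P \<cdot> v) = hA \<cdot> (x \<cdot> q)"
      using g(2)[OF uq(1) v] vw(1) h_comp(1)[OF uq(1)] h_comp(1)[OF v] reassoc[OF u0(2,1) D(1) q'] by simp
    show "hB \<cdot> (leg2 P \<cdot> w) = hB \<cdot> (y \<cdot> q)"
      using g(2)[OF w uq(2)] vw(3) h_comp(2)[OF uq(2)] h_comp(2)[OF w] reassoc[OF u3(3,1) D(2) q'] by simp
  qed
qed

end

section \<open>Connectors under quotients\<close>

context goursat_category
begin

context
  fixes R S X R' S' Y e eR eS
  assumes R: "is_equivalence C X R" and S: "is_equivalence C X S"
    and R': "is_relation C Y Y R'" and S': "is_relation C Y Y S'"
    and e: "e \<in> hom C X Y"
    and qR: "quotient_relation C e R R' eR" and qS: "quotient_relation C e S S' eS"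
begin

private lemmas Rr = is_equivalence_relation[OF R]
private lemmas Sr = is_equivalence_relation[OF S]

private lemma eR: "cover C eR (apex R) (apex R')" "leg1 R' \<cdot> eR = e \<cdot> leg1 R" "leg2 R' \<cdot> eR = e \<cdot> leg2 R"
  using qR by (auto simp: quotient_relation_def)

private lemma eS: "cover C eS (apex S) (apex S')" "leg1 S' \<cdot> eS = e \<cdot> leg1 S" "leg2 S' \<cdot> eS = e \<cdot> leg2 S"
  using qS by (auto simp: quotient_relation_def)

text \<open>Supplies the agreement hypotheses of \<open>split_lift\<close> when the section is a
  diagonal: both sides have the same element of \<open>Y\<close> as both their legs, hence coincide
  by joint monicity of \<open>Q'\<close>.\<close>

private lemma diagonal_compat:
  assumes Q: "is_relation C X X Q" "is_relation C Y Y Q'"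
    and d: "d \<in> hom C X (apex Q)" "leg1 Q \<cdot> d = Ide C X" "leg2 Q \<cdot> d = Ide C X"
    and f: "f \<in> hom C (apex Q) (apex Q')" "leg1 Q' \<cdot> f = e \<cdot> leg1 Q" "leg2 Q' \<cdot> f = e \<cdot> leg2 Q"
    and w: "w \<in> hom C T X" "w' \<in> hom C T X" "e \<cdot> w = e \<cdot> w'"
  shows "f \<cdot> (d \<cdot> w) = f \<cdot> (d \<cdot> w')"
proof -
  note D = is_relationD[OF Q(1)] and D' = is_relationD[OF Q(2)]
  have *: "f \<cdot> (d \<cdot> v) \<in> hom C T (apex Q') \<and> leg1 Q' \<cdot> (f \<cdot> (d \<cdot> v)) = e \<cdot> v \<and> leg2 Q' \<cdot> (f \<cdot> (d \<cdot> v)) = e \<cdot> v"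
    if v: "v \<in> hom C T X" for v
  proof (intro conjI)
    have dv: "d \<cdot> v \<in> hom C T (apex Q)" using v d(1) by (rule Comp_in_hom)
    show "f \<cdot> (d \<cdot> v) \<in> hom C T (apex Q')" using dv f(1) by (rule Comp_in_hom)
    have "leg1 Q \<cdot> (d \<cdot> v) = v" "leg2 Q \<cdot> (d \<cdot> v) = v"
      using reassoc[OF d(2,1) D(4) v] reassoc[OF d(3,1) D(5) v] Comp_Ide_left[OF v] by metis+
    thus "leg1 Q' \<cdot> (f \<cdot> (d \<cdot> v)) = e \<cdot> v" "leg2 Q' \<cdot> (f \<cdot> (d \<cdot> v)) = e \<cdot> v"
      using reassoc[OF f(2,1) D'(4) dv] reassoc[OF f(3,1) D'(5) dv]
        Comp_assoc[OF dv D(4) e] Comp_assoc[OF dv D(5) e] by metis+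
  qed
  show ?thesis
    using *[OF w(1)] *[OF w(2)] w(3) relation_eqI[OF Q(2), of "f \<cdot> (d \<cdot> w)" T "f \<cdot> (d \<cdot> w')"] by metis
qed

text \<open>The two halves of the triple lift separately through \<open>eR\<close> and
  \<open>eS\<close>, but their middle entries agree only after applying \<open>e\<close>.
  \<open>split_lift\<close>, with the diagonals as sections of the second leg of \<open>R\<close>
  and the first leg of \<open>S\<close>, corrects the middle without disturbing the images in
  \<open>R'\<close> and \<open>S'\<close>.\<close>

lemma triple_lift:
  assumes d: "in_pullback C R' S' T a b c"
  obtains T' q x y z where "cover C q T' T" "in_pullback C R S T' x y z"
    "e \<cdot> x = a \<cdot> q" "e \<cdot> y = b \<cdot> q" "e \<cdot> z = c \<cdot> q"
proof -
  note DR = is_relationD[OF Rr] and DS = is_relationD[OF Sr] and DR' = is_relationD[OF R'] and DS' = is_relationD[OF S']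
  note eR' = cover_hom[OF eR(1)] and eS' = cover_hom[OF eS(1)]
  have r: "related C R' T a b" "related C S' T b c" using d by (auto simp: in_pullback_def)
  obtain h where h: "h \<in> hom C T (apex R')" "leg1 R' \<cdot> h = a" "leg2 R' \<cdot> h = b" using r(1) by (rule relatedE)
  obtain k where k: "k \<in> hom C T (apex S')" "leg1 S' \<cdot> k = b" "leg2 S' \<cdot> k = c" using r(2) by (rule relatedE)
  obtain T1 q1 r1 where 1: "cover C q1 T1 T" "r1 \<in> hom C T1 (apex R)" "eR \<cdot> r1 = h \<cdot> q1"
    using cover_pullback[OF eR(1) h(1)] .
  note q1 = cover_hom[OF 1(1)]
  obtain T2 q2 y where 2: "cover C q2 T2 T1" "y \<in> hom C T2 (apex S)" "eS \<cdot> y = (k \<cdot> q1) \<cdot> q2"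
    using cover_pullback[OF eS(1) Comp_in_hom[OF q1 k(1)]] .
  note q2 = cover_hom[OF 2(1)]
  let ?q = "q1 \<cdot> q2" and ?x = "r1 \<cdot> q2"
  have q: "?q \<in> hom C T2 T" using q2 q1 by (rule Comp_in_hom)
  have x: "?x \<in> hom C T2 (apex R)" using q2 1(2) by (rule Comp_in_hom)
  have ex: "eR \<cdot> ?x = h \<cdot> ?q" using reassoc[OF 1(3,2) eR' q2] Comp_assoc[OF q2 q1 h(1)] by simp
  have ey: "eS \<cdot> y = k \<cdot> ?q" using 2(3) Comp_assoc[OF q2 q1 k(1)] by simp
  have legs: "leg1 R' \<cdot> (h \<cdot> s) = a \<cdot> s" "leg2 R' \<cdot> (h \<cdot> s) = b \<cdot> s" "leg1 S' \<cdot> (k \<cdot> s) = b \<cdot> s" "leg2 S' \<cdot> (k \<cdot> s) = c \<cdot> s"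
    if "s \<in> hom C T' T" for s T'
    using reassoc[OF h(2,1) DR'(4) that] reassoc[OF h(3,1) DR'(5) that]
      reassoc[OF k(2,1) DS'(4) that] reassoc[OF k(3,1) DS'(5) that] .
  have e_legs: "e \<cdot> (leg1 R \<cdot> u) = leg1 R' \<cdot> (eR \<cdot> u)" "e \<cdot> (leg2 R \<cdot> u) = leg2 R' \<cdot> (eR \<cdot> u)"
    if "u \<in> hom C T' (apex R)" for u T'
    using reassoc[OF eR(2) eR' DR'(4) that] reassoc[OF eR(3) eR' DR'(5) that]
      Comp_assoc[OF that DR(4) e] Comp_assoc[OF that DR(5) e] by metis+
  have e_legs': "e \<cdot> (leg1 S \<cdot> u) = leg1 S' \<cdot> (eS \<cdot> u)" "e \<cdot> (leg2 S \<cdot> u) = leg2 S' \<cdot> (eS \<cdot> u)"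
    if "u \<in> hom C T' (apex S)" for u T'
    using reassoc[OF eS(2) eS' DS'(4) that] reassoc[OF eS(3) eS' DS'(5) that]
      Comp_assoc[OF that DS(4) e] Comp_assoc[OF that DS(5) e] by metis+
  obtain dR where dR: "dR \<in> hom C X (apex R)" "leg1 R \<cdot> dR = Ide C X" "leg2 R \<cdot> dR = Ide C X"
    using R by (auto simp: is_equivalence_def)
  obtain dS where dS: "dS \<in> hom C X (apex S)" "leg1 S \<cdot> dS = Ide C X" "leg2 S \<cdot> dS = Ide C X"
    using S by (auto simp: is_equivalence_def)
  have mid: "leg2 R \<cdot> ?x \<in> hom C T2 X" "leg1 S \<cdot> y \<in> hom C T2 X"
    using Comp_in_hom[OF x DR(5)] Comp_in_hom[OF 2(2) DS(4)] .
  \<comment> \<open>Both middle entries lie over \<open>b\<close>; this is the only relation between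
    the two lifts.\<close>
  have "e \<cdot> (leg2 R \<cdot> ?x) = e \<cdot> (leg1 S \<cdot> y)"
    using e_legs(2)[OF x] e_legs'(1)[OF 2(2)] ex ey legs[OF q] by metis
  note compat = diagonal_compat[OF Rr R' dR eR' eR(2,3) mid this] diagonal_compat[OF Sr S' dS eS' eS(2,3) mid this]
  obtain T3 q3 x' y' where 3: "cover C q3 T3 T2" "x' \<in> hom C T3 (apex R)" "y' \<in> hom C T3 (apex S)"
    "leg2 R \<cdot> x' = leg1 S \<cdot> y'" "eR \<cdot> x' = eR \<cdot> (?x \<cdot> q3)" "eS \<cdot> y' = eS \<cdot> (y \<cdot> q3)"
    using split_lift[OF DR(5) DS(4) dR(1,3) dS(1,2) eR' eS' x 2(2) compat] .
  note q3 = cover_hom[OF 3(1)]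
  let ?p = "?q \<cdot> q3"
  have p: "?p \<in> hom C T3 T" using q3 q by (rule Comp_in_hom)
  have ex': "eR \<cdot> x' = h \<cdot> ?p" using 3(5) reassoc[OF ex x eR' q3] Comp_assoc[OF q3 q h(1)] by simp
  have ey': "eS \<cdot> y' = k \<cdot> ?p" using 3(6) reassoc[OF ey 2(2) eS' q3] Comp_assoc[OF q3 q k(1)] by simp
  show ?thesis
  proof (rule that)
    show "cover C ?p T3 T" using cover_comp[OF 3(1) cover_comp[OF 2(1) 1(1)]] .
    show "in_pullback C R S T3 (leg1 R \<cdot> x') (leg2 R \<cdot> x') (leg2 S \<cdot> y')"
      unfolding in_pullback_def using relatedI[OF 3(2) refl refl] relatedI[OF 3(3) 3(4)[symmetric] refl] by blast
    show "e \<cdot> (leg1 R \<cdot> x') = a \<cdot> ?p" using e_legs(1)[OF 3(2)] ex' legs(1)[OF p] by simp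
    show "e \<cdot> (leg2 R \<cdot> x') = b \<cdot> ?p" using e_legs(2)[OF 3(2)] ex' legs(2)[OF p] by simp
    show "e \<cdot> (leg2 S \<cdot> y') = c \<cdot> ?p" using e_legs'(2)[OF 3(3)] ey' legs(4)[OF p] by simp
  qed
qed

private abbreviation "P \<equiv> triple_obj C R S"
private abbreviation "k1 \<equiv> coord1 C R S"
private abbreviation "k2 \<equiv> coord2 C R S"
private abbreviation "k3 \<equiv> coord3 C R S"

private lemmas k_hom = coord_hom[OF Rr Sr]

text \<open>Two nested pairings give an arrow whose kernel pair is coordinatewise agreement under
  \<open>e\<close>, the congruence on triples that the connector must respect.\<close>

lemma coord_kernel_ex:
  obtains m Z where "m \<in> hom C P Z"
    "\<And>T u v. \<lbrakk>u \<in> hom C T P; v \<in> hom C T P\<rbrakk> \<Longrightarrow> m \<cdot> u = m \<cdot> v \<longleftrightarrow>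
      e \<cdot> (k1 \<cdot> u) = e \<cdot> (k1 \<cdot> v) \<and> e \<cdot> (k2 \<cdot> u) = e \<cdot> (k2 \<cdot> v) \<and> e \<cdot> (k3 \<cdot> u) = e \<cdot> (k3 \<cdot> v)"
proof -
  have ek: "e \<cdot> k1 \<in> hom C P Y" "e \<cdot> k2 \<in> hom C P Y" "e \<cdot> k3 \<in> hom C P Y"
    using Comp_in_hom[OF k_hom(1) e] Comp_in_hom[OF k_hom(2) e] Comp_in_hom[OF k_hom(3) e] .
  obtain m Z where m: "m \<in> hom C P Z" "\<And>T u v. \<lbrakk>u \<in> hom C T P; v \<in> hom C T P\<rbrakk>
      \<Longrightarrow> m \<cdot> u = m \<cdot> v \<longleftrightarrow> (e \<cdot> k1) \<cdot> u = (e \<cdot> k1) \<cdot> v \<and> (e \<cdot> k2) \<cdot> u = (e \<cdot> k2) \<cdot> v"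
    using pairing_ex[OF ek(1,2)] by blast
  obtain n N where n: "n \<in> hom C P N" "\<And>T u v. \<lbrakk>u \<in> hom C T P; v \<in> hom C T P\<rbrakk>
      \<Longrightarrow> n \<cdot> u = n \<cdot> v \<longleftrightarrow> m \<cdot> u = m \<cdot> v \<and> (e \<cdot> k3) \<cdot> u = (e \<cdot> k3) \<cdot> v"
    using pairing_ex[OF m(1) ek(3)] by blast
  have as: "(e \<cdot> k1) \<cdot> u = e \<cdot> (k1 \<cdot> u)" "(e \<cdot> k2) \<cdot> u = e \<cdot> (k2 \<cdot> u)" "(e \<cdot> k3) \<cdot> u = e \<cdot> (k3 \<cdot> u)"
    if "u \<in> hom C T P" for u T
    using Comp_assoc[OF that k_hom(1) e] Comp_assoc[OF that k_hom(2) e] Comp_assoc[OF that k_hom(3) e] by simp_all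
  show ?thesis using that[OF n(1)] n(2) m(2) as by simp
qed

text \<open>Associativity involves two triples sharing the entry \<open>a3\<close>, and separate
  lifts would share it only under \<open>e\<close>. So \<open>split_lift\<close> is used once more,
  now for the third and the first coordinate on the object of triples, with the constant triple as
  their common section and coordinatewise agreement under \<open>e\<close> as the quotient on both
  sides.\<close>

lemma chain_lift:
  assumes d: "in_pullback C R' S' T a1 a2 a3" and d': "in_pullback C R' S' T a3 a4 a5"
  obtains T' q x1 x2 x3 x4 x5 where "cover C q T' T" "in_pullback C R S T' x1 x2 x3"
    "in_pullback C R S T' x3 x4 x5" "e \<cdot> x1 = a1 \<cdot> q" "e \<cdot> x2 = a2 \<cdot> q" "e \<cdot> x3 = a3 \<cdot> q"
    "e \<cdot> x4 = a4 \<cdot> q" "e \<cdot> x5 = a5 \<cdot> q"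
proof -
  have a: "a1 \<in> hom C T Y" "a2 \<in> hom C T Y" "a3 \<in> hom C T Y" "a4 \<in> hom C T Y" "a5 \<in> hom C T Y"
    using in_pullback_hom[OF R' S' d] in_pullback_hom[OF R' S' d'] by auto
  obtain T1 q1 x1 x2 x3 where 1: "cover C q1 T1 T" "in_pullback C R S T1 x1 x2 x3"
    "e \<cdot> x1 = a1 \<cdot> q1" "e \<cdot> x2 = a2 \<cdot> q1" "e \<cdot> x3 = a3 \<cdot> q1" using triple_lift[OF d] .
  note q1 = cover_hom[OF 1(1)]
  obtain T2 q2 y3 y4 y5 where 2: "cover C q2 T2 T1" "in_pullback C R S T2 y3 y4 y5"
    "e \<cdot> y3 = (a3 \<cdot> q1) \<cdot> q2" "e \<cdot> y4 = (a4 \<cdot> q1) \<cdot> q2" "e \<cdot> y5 = (a5 \<cdot> q1) \<cdot> q2"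
    using triple_lift[OF in_pullback_comp[OF R' S' d' q1]] .
  note q2 = cover_hom[OF 2(1)]
  let ?q = "q1 \<cdot> q2"
  have q: "?q \<in> hom C T2 T" using q2 q1 by (rule Comp_in_hom)
  note xh = in_pullback_hom[OF Rr Sr 1(2)]
  have aq: "(ai \<cdot> q1) \<cdot> q2 = ai \<cdot> ?q" if "ai \<in> hom C T Y" for ai using Comp_assoc[OF q2 q1 that] by simp
  have ex: "e \<cdot> (x1 \<cdot> q2) = a1 \<cdot> ?q" "e \<cdot> (x2 \<cdot> q2) = a2 \<cdot> ?q" "e \<cdot> (x3 \<cdot> q2) = a3 \<cdot> ?q"
    using reassoc[OF 1(3) xh(1) e q2] reassoc[OF 1(4) xh(2) e q2] reassoc[OF 1(5) xh(3) e q2] aq a by simp_all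
  have ey: "e \<cdot> y3 = a3 \<cdot> ?q" "e \<cdot> y4 = a4 \<cdot> ?q" "e \<cdot> y5 = a5 \<cdot> ?q" using 2 aq a by simp_all
  have xq: "in_pullback C R S T2 (x1 \<cdot> q2) (x2 \<cdot> q2) (x3 \<cdot> q2)" using in_pullback_comp[OF Rr Sr 1(2) q2] .
  obtain u where u: "u \<in> hom C T2 P" "k1 \<cdot> u = x1 \<cdot> q2" "k2 \<cdot> u = x2 \<cdot> q2" "k3 \<cdot> u = x3 \<cdot> q2"
    using triple_ex[OF Rr Sr xq] .
  obtain v where v: "v \<in> hom C T2 P" "k1 \<cdot> v = y3" "k2 \<cdot> v = y4" "k3 \<cdot> v = y5"
    using triple_ex[OF Rr Sr 2(2)] .
  have X: "Ide C X \<in> hom C X X" using Ide_in_hom is_relationD(1)[OF Rr] by blast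
  \<comment> \<open>The constant triple defines \<open>s\<close>, a section of all three coordinates
    at once.\<close>
  have "in_pullback C R S X (Ide C X) (Ide C X) (Ide C X)"
    using related_refl[OF R X] related_refl[OF S X] by (simp add: in_pullback_def)
  then obtain s where s: "s \<in> hom C X P" "k1 \<cdot> s = Ide C X" "k2 \<cdot> s = Ide C X" "k3 \<cdot> s = Ide C X"
    using triple_ex[OF Rr Sr] by blast
  have ks: "k1 \<cdot> (s \<cdot> w) = w" "k2 \<cdot> (s \<cdot> w) = w" "k3 \<cdot> (s \<cdot> w) = w" if "w \<in> hom C T' X" for w T'
    using reassoc[OF s(2,1) k_hom(1) that] reassoc[OF s(3,1) k_hom(2) that] reassoc[OF s(4,1) k_hom(3) that]
      Comp_Ide_left[OF that] by simp_all
  obtain m Z where m: "m \<in> hom C P Z"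
    "\<And>T u v. \<lbrakk>u \<in> hom C T P; v \<in> hom C T P\<rbrakk> \<Longrightarrow> m \<cdot> u = m \<cdot> v \<longleftrightarrow>
      e \<cdot> (k1 \<cdot> u) = e \<cdot> (k1 \<cdot> v) \<and> e \<cdot> (k2 \<cdot> u) = e \<cdot> (k2 \<cdot> v) \<and> e \<cdot> (k3 \<cdot> u) = e \<cdot> (k3 \<cdot> v)"
    using coord_kernel_ex by blast
  have mid: "k3 \<cdot> u \<in> hom C T2 X" "k1 \<cdot> v \<in> hom C T2 X"
    using Comp_in_hom[OF u(1) k_hom(3)] Comp_in_hom[OF v(1) k_hom(1)] .
  have "e \<cdot> (k3 \<cdot> u) = e \<cdot> (k1 \<cdot> v)" using u(4) v(2) ex(3) ey(1) by simp
  hence compat: "m \<cdot> (s \<cdot> (k3 \<cdot> u)) = m \<cdot> (s \<cdot> (k1 \<cdot> v))"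
    using m(2)[OF Comp_in_hom[OF mid(1) s(1)] Comp_in_hom[OF mid(2) s(1)]] ks[OF mid(1)] ks[OF mid(2)] by simp
  obtain T3 q3 u' v' where 3: "cover C q3 T3 T2" "u' \<in> hom C T3 P" "v' \<in> hom C T3 P" "k3 \<cdot> u' = k1 \<cdot> v'"
    "m \<cdot> u' = m \<cdot> (u \<cdot> q3)" "m \<cdot> v' = m \<cdot> (v \<cdot> q3)"
    using split_lift[OF k_hom(3) k_hom(1) s(1,4) s(1,2) m(1) m(1) u(1) v(1) compat compat] .
  note q3 = cover_hom[OF 3(1)]
  let ?p = "?q \<cdot> q3"
  have E: "e \<cdot> (k \<cdot> (w \<cdot> q3)) = b \<cdot> ?p"
    if k: "k \<in> hom C P X" and w: "w \<in> hom C T2 P" and b: "b \<in> hom C T Y" and eq: "e \<cdot> (k \<cdot> w) = b \<cdot> ?q" for k w b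
    using Comp_assoc[OF q3 w k] reassoc[OF eq Comp_in_hom[OF w k] e q3] Comp_assoc[OF q3 q b] by metis
  note mu = m(2)[OF 3(2) Comp_in_hom[OF q3 u(1)]] and mv = m(2)[OF 3(3) Comp_in_hom[OF q3 v(1)]]
  show ?thesis
  proof (rule that)
    show "cover C ?p T3 T" using cover_comp[OF 3(1) cover_comp[OF 2(1) 1(1)]] .
    show "in_pullback C R S T3 (k1 \<cdot> u') (k2 \<cdot> u') (k3 \<cdot> u')" using coord_in_pullback[OF Rr Sr 3(2)] .
    show "in_pullback C R S T3 (k3 \<cdot> u') (k2 \<cdot> v') (k3 \<cdot> v')" using coord_in_pullback[OF Rr Sr 3(3)] 3(4) by simp
    show "e \<cdot> (k1 \<cdot> u') = a1 \<cdot> ?p" using mu 3(5) E[OF k_hom(1) u(1) a(1)] u(2) ex(1) by simp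
    show "e \<cdot> (k2 \<cdot> u') = a2 \<cdot> ?p" using mu 3(5) E[OF k_hom(2) u(1) a(2)] u(3) ex(2) by simp
    show "e \<cdot> (k3 \<cdot> u') = a3 \<cdot> ?p" using mu 3(5) E[OF k_hom(3) u(1) a(3)] u(4) ex(3) by simp
    show "e \<cdot> (k2 \<cdot> v') = a4 \<cdot> ?p" using mv 3(6) E[OF k_hom(2) v(1) a(4)] v(3) ey(2) by simp
    show "e \<cdot> (k3 \<cdot> v') = a5 \<cdot> ?p" using mv 3(6) E[OF k_hom(3) v(1) a(5)] v(4) ey(3) by simp
  qed
qed

text \<open>Two applications of the shifting lemma, to the rectangles
  \<open>(x, y, z), (x, y, z'), (y, y, z), (y, y, z')\<close> and
  \<open>(x, y, z), (x', y', z'), (x, y, y), (x', y', y')\<close>: on the second side of each of them the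
  connector is a projection.\<close>

lemma connector_compatible:
  assumes p: "is_connector C X R S p"
    and u: "u \<in> hom C T P" "u' \<in> hom C T P"
    and eq: "e \<cdot> (k1 \<cdot> u) = e \<cdot> (k1 \<cdot> u')" "e \<cdot> (k2 \<cdot> u) = e \<cdot> (k2 \<cdot> u')" "e \<cdot> (k3 \<cdot> u) = e \<cdot> (k3 \<cdot> u')"
  shows "e \<cdot> (p \<cdot> u) = e \<cdot> (p \<cdot> u')"
proof -
  note law = is_connectorD[OF Rr Sr p]
  have ep: "e \<cdot> p \<in> hom C P Y" using law(1) e by (rule Comp_in_hom)
  have ep_comp: "(e \<cdot> p) \<cdot> w = e \<cdot> (p \<cdot> w)" if "w \<in> hom C T P" for w T
    using Comp_assoc[OF that law(1) e] by simp
  have p_left: "p \<cdot> w = k3 \<cdot> w" if w: "w \<in> hom C T P" "k1 \<cdot> w = k2 \<cdot> w" for w T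
    using app_coord[OF Rr Sr w(1), of p] law(4)[of T "k2 \<cdot> w" "k3 \<cdot> w"] coord_in_pullback[OF Rr Sr w(1)] w(2) by simp
  have p_right: "p \<cdot> w = k1 \<cdot> w" if w: "w \<in> hom C T P" "k2 \<cdot> w = k3 \<cdot> w" for w T
    using app_coord[OF Rr Sr w(1), of p] law(5)[of T "k1 \<cdot> w" "k3 \<cdot> w"] coord_in_pullback[OF Rr Sr w(1)] w(2) by simp
  have kh: "k1 \<cdot> w \<in> hom C T X" "k2 \<cdot> w \<in> hom C T X" "k3 \<cdot> w \<in> hom C T X" if "w \<in> hom C T P" for w T
    using Comp_in_hom[OF that k_hom(1)] Comp_in_hom[OF that k_hom(2)] Comp_in_hom[OF that k_hom(3)] .
  obtain f12 Z12 where f12: "f12 \<in> hom C P Z12" "\<And>T u v. \<lbrakk>u \<in> hom C T P; v \<in> hom C T P\<rbrakk>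
      \<Longrightarrow> f12 \<cdot> u = f12 \<cdot> v \<longleftrightarrow> k1 \<cdot> u = k1 \<cdot> v \<and> k2 \<cdot> u = k2 \<cdot> v"
    using pairing_ex[OF k_hom(1,2)] by blast
  obtain f23 Z23 where f23: "f23 \<in> hom C P Z23" "\<And>T u v. \<lbrakk>u \<in> hom C T P; v \<in> hom C T P\<rbrakk>
      \<Longrightarrow> f23 \<cdot> u = f23 \<cdot> v \<longleftrightarrow> k2 \<cdot> u = k2 \<cdot> v \<and> k3 \<cdot> u = k3 \<cdot> v"
    using pairing_ex[OF k_hom(2,3)] by blast
  have ek3: "e \<cdot> k3 \<in> hom C P Y" using k_hom(3) e by (rule Comp_in_hom)
  obtain d D where d: "d \<in> hom C P D" "\<And>T u v. \<lbrakk>u \<in> hom C T P; v \<in> hom C T P\<rbrakk>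
      \<Longrightarrow> d \<cdot> u = d \<cdot> v \<longleftrightarrow> f12 \<cdot> u = f12 \<cdot> v \<and> (e \<cdot> k3) \<cdot> u = (e \<cdot> k3) \<cdot> v"
    using pairing_ex[OF f12(1) ek3] by blast
  obtain m Z where m: "m \<in> hom C P Z"
    "\<And>T u v. \<lbrakk>u \<in> hom C T P; v \<in> hom C T P\<rbrakk> \<Longrightarrow> m \<cdot> u = m \<cdot> v \<longleftrightarrow>
      e \<cdot> (k1 \<cdot> u) = e \<cdot> (k1 \<cdot> v) \<and> e \<cdot> (k2 \<cdot> u) = e \<cdot> (k2 \<cdot> v) \<and> e \<cdot> (k3 \<cdot> u) = e \<cdot> (k3 \<cdot> v)"
    using coord_kernel_ex by blast
  \<comment> \<open>Here only the third coordinate varies, within a fibre of \<open>e\<close>. The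
    condition on the intersection is trivial: \<open>f23\<close> and \<open>d\<close> together
    determine all coordinates, so elements identified by both are equal.\<close>
  have step: "(e \<cdot> p) \<cdot> u = (e \<cdot> p) \<cdot> u'"
    if u: "u \<in> hom C T P" "u' \<in> hom C T P" and k: "k1 \<cdot> u = k1 \<cdot> u'" "k2 \<cdot> u = k2 \<cdot> u'"
      "e \<cdot> (k3 \<cdot> u) = e \<cdot> (k3 \<cdot> u')" for T u u'
  proof -
    have tt: "\<exists>t. t \<in> hom C T P \<and> k1 \<cdot> t = k2 \<cdot> w \<and> k2 \<cdot> t = k2 \<cdot> w \<and> k3 \<cdot> t = k3 \<cdot> w"
      if w: "w \<in> hom C T P" for w
    proof -
      have "in_pullback C R S T (k2 \<cdot> w) (k2 \<cdot> w) (k3 \<cdot> w)"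
        using coord_in_pullback[OF Rr Sr w] related_refl[OF R kh(2)[OF w]] by (simp add: in_pullback_def)
      thus ?thesis using triple_ex[OF Rr Sr] by metis
    qed
    obtain t where t: "t \<in> hom C T P" "k1 \<cdot> t = k2 \<cdot> u" "k2 \<cdot> t = k2 \<cdot> u" "k3 \<cdot> t = k3 \<cdot> u"
      using tt[OF u(1)] by blast
    obtain t' where t': "t' \<in> hom C T P" "k1 \<cdot> t' = k2 \<cdot> u'" "k2 \<cdot> t' = k2 \<cdot> u'" "k3 \<cdot> t' = k3 \<cdot> u'"
      using tt[OF u(2)] by blast
    have e3: "(e \<cdot> k3) \<cdot> w = e \<cdot> (k3 \<cdot> w)" if "w \<in> hom C T P" for w
      using Comp_assoc[OF that k_hom(3) e] by simp
    show ?thesis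
    proof (rule shifting[OF f23(1) d(1) ep _ u t(1) t'(1)])
      show "(e \<cdot> p) \<cdot> v = (e \<cdot> p) \<cdot> w"
        if "v \<in> hom C T' P" "w \<in> hom C T' P" "f23 \<cdot> v = f23 \<cdot> w" "d \<cdot> v = d \<cdot> w" for T' v w
        using coord_eqI[OF Rr Sr that(1,2)] f23(2)[OF that(1,2)] d(2)[OF that(1,2)] f12(2)[OF that(1,2)] that(3,4)
        by simp
      show "d \<cdot> u = d \<cdot> u'" using d(2)[OF u] f12(2)[OF u] k e3[OF u(1)] e3[OF u(2)] by simp
      show "d \<cdot> t = d \<cdot> t'"
        using d(2)[OF t(1) t'(1)] f12(2)[OF t(1) t'(1)] k t t' e3[OF t(1)] e3[OF t'(1)] by simp
      show "f23 \<cdot> u = f23 \<cdot> t" using f23(2)[OF u(1) t(1)] t by simp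
      show "f23 \<cdot> u' = f23 \<cdot> t'" using f23(2)[OF u(2) t'(1)] t' by simp
      have "p \<cdot> t = k3 \<cdot> t" "p \<cdot> t' = k3 \<cdot> t'" using p_left[OF t(1)] t p_left[OF t'(1)] t' by simp_all
      thus "(e \<cdot> p) \<cdot> t = (e \<cdot> p) \<cdot> t'" using ep_comp[OF t(1)] ep_comp[OF t'(1)] t(4) t'(4) k(3) by simp
    qed
  qed
  have tt: "\<exists>t. t \<in> hom C T P \<and> k1 \<cdot> t = k1 \<cdot> w \<and> k2 \<cdot> t = k2 \<cdot> w \<and> k3 \<cdot> t = k2 \<cdot> w"
    if w: "w \<in> hom C T P" for w
  proof -
    have "in_pullback C R S T (k1 \<cdot> w) (k2 \<cdot> w) (k2 \<cdot> w)"
      using coord_in_pullback[OF Rr Sr w] related_refl[OF S kh(2)[OF w]] by (simp add: in_pullback_def)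
    thus ?thesis using triple_ex[OF Rr Sr] by metis
  qed
  obtain t where t: "t \<in> hom C T P" "k1 \<cdot> t = k1 \<cdot> u" "k2 \<cdot> t = k2 \<cdot> u" "k3 \<cdot> t = k2 \<cdot> u"
    using tt[OF u(1)] by blast
  obtain t' where t': "t' \<in> hom C T P" "k1 \<cdot> t' = k1 \<cdot> u'" "k2 \<cdot> t' = k2 \<cdot> u'" "k3 \<cdot> t' = k2 \<cdot> u'"
    using tt[OF u(2)] by blast
  \<comment> \<open>Elements identified by both \<open>f12\<close> and \<open>m\<close> agree in the
    first two coordinates, and under \<open>e\<close> in the third; this is the case settled by
    \<open>step\<close>, which thus provides the condition on the intersection.\<close>
  have "(e \<cdot> p) \<cdot> u = (e \<cdot> p) \<cdot> u'"
  proof (rule shifting[OF f12(1) m(1) ep _ u t(1) t'(1)])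
    show "(e \<cdot> p) \<cdot> v = (e \<cdot> p) \<cdot> w"
      if "v \<in> hom C T' P" "w \<in> hom C T' P" "f12 \<cdot> v = f12 \<cdot> w" "m \<cdot> v = m \<cdot> w" for T' v w
      using step[OF that(1,2)] f12(2)[OF that(1,2)] m(2)[OF that(1,2)] that(3,4) by simp
    show "m \<cdot> u = m \<cdot> u'" using m(2)[OF u] eq by simp
    show "m \<cdot> t = m \<cdot> t'" using m(2)[OF t(1) t'(1)] eq t t' by simp
    show "f12 \<cdot> u = f12 \<cdot> t" using f12(2)[OF u(1) t(1)] t by simp
    show "f12 \<cdot> u' = f12 \<cdot> t'" using f12(2)[OF u(2) t'(1)] t' by simp
    have "p \<cdot> t = k1 \<cdot> t" "p \<cdot> t' = k1 \<cdot> t'" using p_right[OF t(1)] t p_right[OF t'(1)] t' by simp_all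
    thus "(e \<cdot> p) \<cdot> t = (e \<cdot> p) \<cdot> t'" using ep_comp[OF t(1)] ep_comp[OF t'(1)] t(2) t'(2) eq(1) by simp
  qed
  thus ?thesis using ep_comp[OF u(1)] ep_comp[OF u(2)] by simp
qed

private lemma map:
  assumes "in_pullback C R S T x y z"
  shows "in_pullback C R' S' T (e \<cdot> x) (e \<cdot> y) (e \<cdot> z)"
  using in_pullback_map[OF Rr R' Sr S' e cover_hom[OF eR(1)] eR(2,3) cover_hom[OF eS(1)] eS(2,3) assms] .

text \<open>The generic triple of the quotient lifts locally by \<open>triple_lift\<close>. A local
  lift of the generic element is a local section of \<open>h\<close>, so
  \<open>locally_split_cover\<close> applies.\<close>

lemma triple_cover:
  obtains h where "cover C h P (triple_obj C R' S')" "coord1 C R' S' \<cdot> h = e \<cdot> k1"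
    "coord2 C R' S' \<cdot> h = e \<cdot> k2" "coord3 C R' S' \<cdot> h = e \<cdot> k3"
    "\<And>T x y z. in_pullback C R S T x y z \<Longrightarrow>
      h \<cdot> triple C R S T x y z = triple C R' S' T (e \<cdot> x) (e \<cdot> y) (e \<cdot> z)"
proof -
  let ?P' = "triple_obj C R' S'"
  note l = coord_hom[OF R' S']
  let ?h = "triple C R' S' P (e \<cdot> k1) (e \<cdot> k2) (e \<cdot> k3)"
  note h = triple[OF R' S' map[OF coord_in_pullback_generic[OF Rr Sr]]]
  have h_coord: "coord1 C R' S' \<cdot> (?h \<cdot> w) = e \<cdot> (k1 \<cdot> w)" "coord2 C R' S' \<cdot> (?h \<cdot> w) = e \<cdot> (k2 \<cdot> w)"
    "coord3 C R' S' \<cdot> (?h \<cdot> w) = e \<cdot> (k3 \<cdot> w)" if w: "w \<in> hom C T P" for w T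
    using reassoc[OF h(2,1) l(1) w] reassoc[OF h(3,1) l(2) w] reassoc[OF h(4,1) l(3) w]
      Comp_assoc[OF w k_hom(1) e] Comp_assoc[OF w k_hom(2) e] Comp_assoc[OF w k_hom(3) e] by simp_all
  obtain T' q x y z where q: "cover C q T' ?P'" "in_pullback C R S T' x y z"
    "e \<cdot> x = coord1 C R' S' \<cdot> q" "e \<cdot> y = coord2 C R' S' \<cdot> q" "e \<cdot> z = coord3 C R' S' \<cdot> q"
    using triple_lift[OF coord_in_pullback_generic[OF R' S']] .
  obtain w where w: "w \<in> hom C T' P" "k1 \<cdot> w = x" "k2 \<cdot> w = y" "k3 \<cdot> w = z" using triple_ex[OF Rr Sr q(2)] .
  have "?h \<cdot> w = q"
    using h_coord[OF w(1)] w q by (intro coord_eqI[OF R' S' Comp_in_hom[OF w(1) h(1)] cover_hom[OF q(1)]]) simp_all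
  hence "cover C ?h P ?P'" using locally_split_cover[OF h(1) q(1) w(1)] by blast
  moreover have "?h \<cdot> triple C R S T x y z = triple C R' S' T (e \<cdot> x) (e \<cdot> y) (e \<cdot> z)"
    if d: "in_pullback C R S T x y z" for T x y z
  proof -
    note t = triple[OF Rr Sr d] and t' = triple[OF R' S' map[OF d]]
    show ?thesis
      using h_coord[OF t(1)] t(2-4) t'(2-4) by (intro coord_eqI[OF R' S' Comp_in_hom[OF t(1) h(1)] t'(1)]) simp_all
  qed
  ultimately show ?thesis using that h(2-4) by blast
qed

text \<open>By \<open>connector_compatible\<close>, \<open>e \<cdot> p\<close> is constant on the
  fibres of the cover of triples, so it descends to \<open>p'\<close>. Each law for
  \<open>p'\<close> is then verified after a cover on which the elements involved lift, relations
  and equations being local.\<close>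

lemma quotient_connector:
  assumes p: "is_connector C X R S p" and cov: "cover C e X Y"
  obtains p' where "is_connector C Y R' S' p'"
    "\<And>T x y z. in_pullback C R S T x y z \<Longrightarrow> e \<cdot> app C R S p T x y z = app C R' S' p' T (e \<cdot> x) (e \<cdot> y) (e \<cdot> z)"
proof -
  let ?P' = "triple_obj C R' S'"
  obtain h where h: "cover C h P ?P'" "coord1 C R' S' \<cdot> h = e \<cdot> k1"
    "coord2 C R' S' \<cdot> h = e \<cdot> k2" "coord3 C R' S' \<cdot> h = e \<cdot> k3"
    "\<And>T x y z. in_pullback C R S T x y z \<Longrightarrow> h \<cdot> triple C R S T x y z = triple C R' S' T (e \<cdot> x) (e \<cdot> y) (e \<cdot> z)"
    using triple_cover by blast
  note h' = cover_hom[OF h(1)] and l = coord_hom[OF R' S'] and law = is_connectorD[OF Rr Sr p]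
  have hr: "regular_epi C h" "Dom C h = P" "Cod C h = ?P'" using h(1) by (auto simp: cover_def hom_iff)
  have ep: "e \<cdot> p \<in> hom C P Y" using law(1) e by (rule Comp_in_hom)
  obtain p' where p': "p' \<in> hom C ?P' Y" "p' \<cdot> h = e \<cdot> p"
  proof (rule regular_epi_descent[OF hr(1), of "e \<cdot> p" Y, unfolded hr(2,3)])
    fix T u v assume uv: "u \<in> hom C T P" "v \<in> hom C T P" "h \<cdot> u = h \<cdot> v"
    have *: "coord1 C R' S' \<cdot> (h \<cdot> w) = e \<cdot> (k1 \<cdot> w)" "coord2 C R' S' \<cdot> (h \<cdot> w) = e \<cdot> (k2 \<cdot> w)"
      "coord3 C R' S' \<cdot> (h \<cdot> w) = e \<cdot> (k3 \<cdot> w)" if w: "w \<in> hom C T P" for w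
      using reassoc[OF h(2) h' l(1) w] reassoc[OF h(3) h' l(2) w] reassoc[OF h(4) h' l(3) w]
        Comp_assoc[OF w k_hom(1) e] Comp_assoc[OF w k_hom(2) e] Comp_assoc[OF w k_hom(3) e] by simp_all
    have "e \<cdot> (p \<cdot> u) = e \<cdot> (p \<cdot> v)"
      using *[OF uv(1)] *[OF uv(2)] uv(3) by (intro connector_compatible[OF p uv(1,2)]) simp_all
    thus "(e \<cdot> p) \<cdot> u = (e \<cdot> p) \<cdot> v"
      using Comp_assoc[OF uv(1) law(1) e] Comp_assoc[OF uv(2) law(1) e] by simp
  qed (use ep in auto)
  have e_app: "e \<cdot> app C R S p T x y z = app C R' S' p' T (e \<cdot> x) (e \<cdot> y) (e \<cdot> z)"
    if d: "in_pullback C R S T x y z" for T x y z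
  proof -
    note t = triple(1)[OF Rr Sr d]
    show ?thesis unfolding app_def
      using Comp_assoc[OF t law(1) e] reassoc[OF p'(2) h' p'(1) t] h(5)[OF d] by simp
  qed
  note app_q = app_comp[OF R' S' p'(1)] and app_h = app_hom[OF R' S' p'(1)] and ph = in_pullback_hom[OF R' S']
  have e_map: "related C R T x y \<Longrightarrow> related C R' T (e \<cdot> x) (e \<cdot> y)"
    "related C S T x y \<Longrightarrow> related C S' T (e \<cdot> x) (e \<cdot> y)" for T x y
    using related_map[OF Rr R' e cover_hom[OF eR(1)] eR(2,3)] related_map[OF Sr S' e cover_hom[OF eS(1)] eS(2,3)]
    by blast+
  have 1: "related C S' T a (app C R' S' p' T a b c) \<and> related C R' T (app C R' S' p' T a b c) c"
    if d: "in_pullback C R' S' T a b c" for T a b c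
  proof -
    obtain T' q x y z where q: "cover C q T' T" "in_pullback C R S T' x y z"
      "e \<cdot> x = a \<cdot> q" "e \<cdot> y = b \<cdot> q" "e \<cdot> z = c \<cdot> q" using triple_lift[OF d] .
    have "e \<cdot> app C R S p T' x y z = app C R' S' p' T a b c \<cdot> q"
      using e_app[OF q(2)] app_q[OF d cover_hom[OF q(1)]] q(3-5) by simp
    hence "related C S' T' (a \<cdot> q) (app C R' S' p' T a b c \<cdot> q)" "related C R' T' (app C R' S' p' T a b c \<cdot> q) (c \<cdot> q)"
      using e_map(2)[OF law(2)[OF q(2)]] e_map(1)[OF law(3)[OF q(2)]] q(3,5) by simp_all
    thus ?thesis
      using related_local[OF S' ph(1)[OF d] app_h[OF d] q(1)] related_local[OF R' app_h[OF d] ph(3)[OF d] q(1)] by blast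
  qed
  have 2: "app C R' S' p' T a a b = b" if d: "in_pullback C R' S' T a a b" for T a b
  proof -
    \<comment> \<open>A lift of the triple with entries \<open>a\<close>, \<open>a\<close>,
      \<open>b\<close> need not repeat its first entry. So only the pair is lifted, and the
      repetition is restored upstairs by reflexivity of \<open>R\<close>; the other unit law is
      treated in the same way.\<close>
    have r: "related C S' T a b" using d by (simp add: in_pullback_def)
    obtain T' q x y where q: "cover C q T' T" "related C S T' x y" "e \<cdot> x = a \<cdot> q" "e \<cdot> y = b \<cdot> q"
      using quotient_lift[OF qS Sr S' e r] .
    have d': "in_pullback C R S T' x x y"
      using q(2) related_refl[OF R] related_hom[OF Sr q(2)] by (simp add: in_pullback_def)
    have "app C R' S' p' T a a b \<cdot> q = b \<cdot> q"
      using e_app[OF d'] law(4)[OF d'] app_q[OF d cover_hom[OF q(1)]] q(3,4) by simp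
    thus ?thesis using cover_epi[OF q(1) app_h[OF d] ph(3)[OF d]] by blast
  qed
  have 3: "app C R' S' p' T a b b = a" if d: "in_pullback C R' S' T a b b" for T a b
  proof -
    have r: "related C R' T a b" using d by (simp add: in_pullback_def)
    obtain T' q x y where q: "cover C q T' T" "related C R T' x y" "e \<cdot> x = a \<cdot> q" "e \<cdot> y = b \<cdot> q"
      using quotient_lift[OF qR Rr R' e r] .
    have d': "in_pullback C R S T' x y y"
      using q(2) related_refl[OF S] related_hom[OF Rr q(2)] by (simp add: in_pullback_def)
    have "app C R' S' p' T a b b \<cdot> q = a \<cdot> q"
      using e_app[OF d'] law(5)[OF d'] app_q[OF d cover_hom[OF q(1)]] q(3,4) by simp
    thus ?thesis using cover_epi[OF q(1) app_h[OF d] ph(1)[OF d]] by blast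
  qed
  have 4: "app C R' S' p' T x y (app C R' S' p' T z u v) = app C R' S' p' T (app C R' S' p' T x y z) u v"
    if d: "in_pullback C R' S' T z u v" "in_pullback C R' S' T x y (app C R' S' p' T z u v)"
      "in_pullback C R' S' T x y z" "in_pullback C R' S' T (app C R' S' p' T x y z) u v" for T x y z u v
  proof -
    \<comment> \<open>The two triples have to be lifted with a common entry \<open>x3\<close>, since
      associativity upstairs is about one chain of five elements.\<close>
    obtain T' q x1 x2 x3 x4 x5 where q: "cover C q T' T" "in_pullback C R S T' x1 x2 x3"
      "in_pullback C R S T' x3 x4 x5" "e \<cdot> x1 = x \<cdot> q" "e \<cdot> x2 = y \<cdot> q" "e \<cdot> x3 = z \<cdot> q"
      "e \<cdot> x4 = u \<cdot> q" "e \<cdot> x5 = v \<cdot> q" using chain_lift[OF d(3,1)] .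
    note q' = cover_hom[OF q(1)]
    have r: "related C R T' x1 x2" "related C S T' x2 x3" "related C R T' x3 x4" "related C S T' x4 x5"
      using q(2,3) by (auto simp: in_pullback_def)
    \<comment> \<open>The nested terms are defined upstairs by the relatedness laws of the connector
      together with transitivity of \<open>S\<close> and of \<open>R\<close>.\<close>
    have d1: "in_pullback C R S T' x1 x2 (app C R S p T' x3 x4 x5)"
      unfolding in_pullback_def using r(1) related_trans[OF S r(2) law(2)[OF q(3)]] by blast
    have d2: "in_pullback C R S T' (app C R S p T' x1 x2 x3) x4 x5"
      unfolding in_pullback_def using r(4) related_trans[OF R law(3)[OF q(2)] r(3)] by blast
    have "app C R' S' p' T x y (app C R' S' p' T z u v) \<cdot> q
        = e \<cdot> app C R S p T' x1 x2 (app C R S p T' x3 x4 x5)"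
      using app_q[OF d(2) q'] app_q[OF d(1) q'] e_app[OF d1] e_app[OF q(3)] q(4-8) by simp
    also have "\<dots> = e \<cdot> app C R S p T' (app C R S p T' x1 x2 x3) x4 x5"
      using law(6)[OF q(3) d1 q(2) d2] by simp
    also have "\<dots> = app C R' S' p' T (app C R' S' p' T x y z) u v \<cdot> q"
      using app_q[OF d(4) q'] app_q[OF d(3) q'] e_app[OF d2] e_app[OF q(2)] q(4-8) by simp
    finally show ?thesis using cover_epi[OF q(1) app_h[OF d(2)] app_h[OF d(4)]] by blast
  qed
  have "is_connector C Y R' S' p'"
    using p'(1) 1 2 3 4 by (intro is_connectorI) blast+
  thus ?thesis using that e_app by blast
qed

end

end

section \<open>The category of connectors\<close>

datatype side = First | Second

text \<open>Indexing the two relations and the base object by one type lets the three forgetful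
  functors to \<open>C\<close> be treated by single statements quantified over the
  component.\<close>

datatype component = Rel side | Base

fun rel_part :: "side \<Rightarrow> ('o, 'a) conn \<Rightarrow> ('o, 'a) span" where
  "rel_part First (R, S, X, p) = R"
| "rel_part Second (R, S, X, p) = S"

fun conn_part :: "('o, 'a) conn \<Rightarrow> 'a" where
  "conn_part (R, S, X, p) = p"

fun obj_part :: "component \<Rightarrow> ('o, 'a) conn \<Rightarrow> 'o" where
  "obj_part (Rel s) A = apex (rel_part s A)"
| "obj_part Base (R, S, X, p) = X"

fun arr_part :: "component \<Rightarrow> ('b, 'a) arr3 \<Rightarrow> 'a" where
  "arr_part (Rel First) (A, B, r, s, f) = r"
| "arr_part (Rel Second) (A, B, r, s, f) = s"
| "arr_part Base (A, B, r, s, f) = f"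

definition conn_dom :: "('o, 'a) cat \<Rightarrow> ('o, 'a) conn \<Rightarrow> 'o \<Rightarrow> 'a \<Rightarrow> 'a \<Rightarrow> 'a \<Rightarrow> bool" where
  "conn_dom C A = in_pullback C (rel_part First A) (rel_part Second A)"

definition conn_app :: "('o, 'a) cat \<Rightarrow> ('o, 'a) conn \<Rightarrow> 'o \<Rightarrow> 'a \<Rightarrow> 'a \<Rightarrow> 'a \<Rightarrow> 'a" where
  "conn_app C A = app C (rel_part First A) (rel_part Second A) (conn_part A)"

lemma all_side: "(\<forall>s. Q s) \<longleftrightarrow> Q First \<and> Q Second"
  by (metis side.exhaust)

lemma component_cases [case_names First Second Base]:
  obtains "k = Rel First" | "k = Rel Second" | "k = Base"
  by (metis component.exhaust side.exhaust)

lemma Obj_Conn_iff: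
  "A \<in> Obj (Conn C) \<longleftrightarrow> obj_part Base A \<in> Obj C \<and> (\<forall>s. is_equivalence C (obj_part Base A) (rel_part s A)) \<and>
    is_connector C (obj_part Base A) (rel_part First A) (rel_part Second A) (conn_part A)"
  by (cases A) (auto simp: Conn_def Two_Eq_def all_side)

lemma arr_part_Comp: "arr_part k (G \<cdot>\<^bsub>Conn C\<^esub> F) = arr_part k G \<cdot>\<^bsub>C\<^esub> arr_part k F"
  by (cases F; cases G; cases k rule: component_cases) (simp_all add: Conn_def)

lemma arr_part_Ide: "arr_part k (Ide (Conn C) A) = Ide C (obj_part k A)"
  by (cases A; cases k rule: component_cases) (simp_all add: Conn_def)

lemma Dom_Conn: "Dom (Conn C) F = fst F" and Cod_Conn: "Cod (Conn C) F = fst (snd F)"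
  by (auto simp: Conn_def split: prod.splits)

context regular_category
begin

lemma Conn_relation: "A \<in> Obj (Conn C) \<Longrightarrow> is_relation C (obj_part Base A) (obj_part Base A) (rel_part s A)"
  by (simp add: Obj_Conn_iff is_equivalence_relation)

lemma Conn_equivalence: "A \<in> Obj (Conn C) \<Longrightarrow> is_equivalence C (obj_part Base A) (rel_part s A)"
  by (simp add: Obj_Conn_iff)

lemma Conn_legs:
  assumes "A \<in> Obj (Conn C)"
  shows "leg1 (rel_part s A) \<in> hom C (obj_part (Rel s) A) (obj_part Base A)"
    "leg2 (rel_part s A) \<in> hom C (obj_part (Rel s) A) (obj_part Base A)"
  using is_relationD(4,5)[OF Conn_relation[OF assms]] by simp_all

lemma obj_part_Obj: "A \<in> Obj (Conn C) \<Longrightarrow> obj_part k A \<in> Obj C"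
  using is_relationD(1,3)[OF Conn_relation] by (cases k) auto

lemma conn_part_hom:
  "A \<in> Obj (Conn C) \<Longrightarrow>
    conn_part A \<in> hom C (triple_obj C (rel_part First A) (rel_part Second A)) (obj_part Base A)"
  by (rule is_connectorD(1)[OF Conn_relation Conn_relation]) (simp_all add: Obj_Conn_iff)

lemma conn_dom_iff:
  "conn_dom C A T x y z \<longleftrightarrow> related C (rel_part First A) T x y \<and> related C (rel_part Second A) T y z"
  by (simp add: conn_dom_def in_pullback_def)

lemma conn_dom_hom:
  assumes "A \<in> Obj (Conn C)" "conn_dom C A T x y z"
  shows "x \<in> hom C T (obj_part Base A)" "y \<in> hom C T (obj_part Base A)" "z \<in> hom C T (obj_part Base A)"
  using in_pullback_hom[OF Conn_relation Conn_relation] assms by (auto simp: conn_dom_def)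

lemma conn_app_hom:
  assumes "A \<in> Obj (Conn C)" "conn_dom C A T x y z"
  shows "conn_app C A T x y z \<in> hom C T (obj_part Base A)"
  unfolding conn_app_def
  using assms by (intro app_hom[OF Conn_relation Conn_relation conn_part_hom]) (simp_all add: conn_dom_def)

lemma conn_app_comp:
  assumes "A \<in> Obj (Conn C)" "conn_dom C A T x y z" "q \<in> hom C T' T"
  shows "conn_app C A T' (x \<cdot> q) (y \<cdot> q) (z \<cdot> q) = conn_app C A T x y z \<cdot> q"
  unfolding conn_app_def
  using assms by (intro app_comp[OF Conn_relation Conn_relation conn_part_hom]) (simp_all add: conn_dom_def)

text \<open>The working description of arrows: \<open>preserves_connector_iff\<close> trades the
  equation with \<open>induced\<close> for compatibility on generalised triples, and the tuple
  equation records that an arrow is determined by its ends and its three parts.\<close>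

lemma Conn_hom_iff:
  "F \<in> hom (Conn C) A B \<longleftrightarrow> A \<in> Obj (Conn C) \<and> B \<in> Obj (Conn C) \<and>
    F = (A, B, arr_part (Rel First) F, arr_part (Rel Second) F, arr_part Base F) \<and>
    (\<forall>k. arr_part k F \<in> hom C (obj_part k A) (obj_part k B)) \<and>
    (\<forall>s. leg1 (rel_part s B) \<cdot> arr_part (Rel s) F = arr_part Base F \<cdot> leg1 (rel_part s A)) \<and>
    (\<forall>s. leg2 (rel_part s B) \<cdot> arr_part (Rel s) F = arr_part Base F \<cdot> leg2 (rel_part s A)) \<and>
    (\<forall>T x y z. conn_dom C A T x y z \<longrightarrow> arr_part Base F \<cdot> conn_app C A T x y z =
       conn_app C B T (arr_part Base F \<cdot> x) (arr_part Base F \<cdot> y) (arr_part Base F \<cdot> z))"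
    (is "_ \<longleftrightarrow> A \<in> _ \<and> B \<in> _ \<and> ?eq \<and> ?hom \<and> ?l1 \<and> ?l2 \<and> ?app")
proof -
  obtain R S X p where A: "A = (R, S, X, p)" by (cases A)
  obtain R' S' X' p' where B: "B = (R', S', X', p')" by (cases B)
  obtain A' B' r s f where F: "F = (A', B', r, s, f)" by (cases F)
  have all_component: "(\<forall>k. Q k) \<longleftrightarrow> Q (Rel First) \<and> Q (Rel Second) \<and> Q Base" for Q
    by (metis component.exhaust side.exhaust)
  have hom: "F \<in> hom (Conn C) A B \<longleftrightarrow> F \<in> Arr (Conn C) \<and> A' = A \<and> B' = B"
    by (simp add: hom_iff Dom_Conn Cod_Conn F)
  \<comment> \<open>Pure unfolding. The connector equation is kept aside because its elementwise
    form is equivalent to it only in the presence of the other conjuncts.\<close>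
  have pre: "F \<in> hom (Conn C) A B \<longleftrightarrow> A \<in> Obj (Conn C) \<and> B \<in> Obj (Conn C) \<and> ?eq \<and> ?hom \<and> ?l1 \<and> ?l2 \<and>
      f \<cdot> p = p' \<cdot> induced C R S R' S' r s"
    unfolding hom
    by (auto simp: Conn_def Two_Eq_def A B F all_side all_component)
  have "f \<cdot> p = p' \<cdot> induced C R S R' S' r s \<longleftrightarrow> ?app"
    if o: "A \<in> Obj (Conn C)" "B \<in> Obj (Conn C)" and h: ?hom and l: ?l1 ?l2
  proof -
    have "f \<in> hom C X X'" "r \<in> hom C (apex R) (apex R')" "s \<in> hom C (apex S) (apex S')"
      using h by (simp_all add: all_component A B F)
    moreover have "leg1 R' \<cdot> r = f \<cdot> leg1 R" "leg2 R' \<cdot> r = f \<cdot> leg2 R" "leg1 S' \<cdot> s = f \<cdot> leg1 S" "leg2 S' \<cdot> s = f \<cdot> leg2 S"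
      using l by (simp_all add: all_side A B F)
    moreover have "is_relation C X X R" "is_relation C X X S" "is_relation C X' X' R'" "is_relation C X' X' S'"
      using Conn_relation[OF o(1), of First] Conn_relation[OF o(1), of Second]
        Conn_relation[OF o(2), of First] Conn_relation[OF o(2), of Second] by (simp_all add: A B)
    moreover have "p \<in> hom C (triple_obj C R S) X" "p' \<in> hom C (triple_obj C R' S') X'"
      using conn_part_hom[OF o(1)] conn_part_hom[OF o(2)] by (simp_all add: A B)
    ultimately show ?thesis
      unfolding conn_dom_def conn_app_def A B F rel_part.simps conn_part.simps arr_part.simps
      by (intro preserves_connector_iff)
  qed
  with pre show ?thesis by blast
qed

lemma Conn_homD:
  assumes "F \<in> hom (Conn C) A B"
  shows "A \<in> Obj (Conn C)" "B \<in> Obj (Conn C)" "arr_part k F \<in> hom C (obj_part k A) (obj_part k B)"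
    "leg1 (rel_part s B) \<cdot> arr_part (Rel s) F = arr_part Base F \<cdot> leg1 (rel_part s A)"
    "leg2 (rel_part s B) \<cdot> arr_part (Rel s) F = arr_part Base F \<cdot> leg2 (rel_part s A)"
    "conn_dom C A T x y z \<Longrightarrow> arr_part Base F \<cdot> conn_app C A T x y z =
       conn_app C B T (arr_part Base F \<cdot> x) (arr_part Base F \<cdot> y) (arr_part Base F \<cdot> z)"
  using assms unfolding Conn_hom_iff by blast+

lemma Conn_homI:
  assumes "A \<in> Obj (Conn C)" "B \<in> Obj (Conn C)" "\<And>k. u k \<in> hom C (obj_part k A) (obj_part k B)"
    and "\<And>s. leg1 (rel_part s B) \<cdot> u (Rel s) = u Base \<cdot> leg1 (rel_part s A)"
    and "\<And>s. leg2 (rel_part s B) \<cdot> u (Rel s) = u Base \<cdot> leg2 (rel_part s A)"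
    and "\<And>T x y z. conn_dom C A T x y z \<Longrightarrow> u Base \<cdot> conn_app C A T x y z =
       conn_app C B T (u Base \<cdot> x) (u Base \<cdot> y) (u Base \<cdot> z)"
  obtains F where "F \<in> hom (Conn C) A B" "\<And>k. arr_part k F = u k"
proof
  let ?F = "(A, B, u (Rel First), u (Rel Second), u Base)"
  have u: "arr_part k ?F = u k" for k
    by (cases k rule: component_cases) simp_all
  show "arr_part k ?F = u k" for k by (fact u)
  show "?F \<in> hom (Conn C) A B" unfolding Conn_hom_iff u using assms by blast
qed

lemma Conn_hom_eqI:
  assumes "F \<in> hom (Conn C) A B" "G \<in> hom (Conn C) A B" "\<And>k. arr_part k F = arr_part k G"
  shows "F = G"
  using assms unfolding Conn_hom_iff by metis

lemma conn_dom_map: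
  assumes F: "F \<in> hom (Conn C) A B" and d: "conn_dom C A T x y z"
  shows "conn_dom C B T (arr_part Base F \<cdot> x) (arr_part Base F \<cdot> y) (arr_part Base F \<cdot> z)"
proof -
  note D = Conn_homD[OF F]
  have "related C (rel_part s A) T a b \<Longrightarrow> related C (rel_part s B) T (arr_part Base F \<cdot> a) (arr_part Base F \<cdot> b)" for s a b
    using related_map[OF Conn_relation[OF D(1)] Conn_relation[OF D(2)] D(3) D(3)[of "Rel s", simplified] D(4,5)] .
  thus ?thesis using d by (simp add: conn_dom_iff)
qed

lemma Conn_Comp_hom:
  assumes F: "F \<in> hom (Conn C) A B" and G: "G \<in> hom (Conn C) B D"
  shows "G \<cdot>\<^bsub>Conn C\<^esub> F \<in> hom (Conn C) A D"
proof -
  let ?u = "\<lambda>k. arr_part k G \<cdot> arr_part k F"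
  note DF = Conn_homD[OF F] and DG = Conn_homD[OF G]
  obtain H where H: "H \<in> hom (Conn C) A D" "\<And>k. arr_part k H = ?u k"
  proof (rule Conn_homI[of A D ?u, OF DF(1) DG(2)])
    show "?u k \<in> hom C (obj_part k A) (obj_part k D)" for k using DF(3) DG(3) by (rule Comp_in_hom)
    show "leg1 (rel_part s D) \<cdot> ?u (Rel s) = ?u Base \<cdot> leg1 (rel_part s A)" for s
      using reassoc[OF DG(4,3) Conn_legs(1)[OF DG(2)] DF(3)] DF(4) Comp_assoc[OF DF(3) Conn_legs(1)[OF DG(1)] DG(3)]
        Comp_assoc[OF Conn_legs(1)[OF DF(1)] DF(3) DG(3)] by metis
    show "leg2 (rel_part s D) \<cdot> ?u (Rel s) = ?u Base \<cdot> leg2 (rel_part s A)" for s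
      using reassoc[OF DG(5,3) Conn_legs(2)[OF DG(2)] DF(3)] DF(5) Comp_assoc[OF DF(3) Conn_legs(2)[OF DG(1)] DG(3)]
        Comp_assoc[OF Conn_legs(2)[OF DF(1)] DF(3) DG(3)] by metis
    fix T x y z assume d: "conn_dom C A T x y z"
    have as: "?u Base \<cdot> w = arr_part Base G \<cdot> (arr_part Base F \<cdot> w)" if "w \<in> hom C T (obj_part Base A)" for w
      using Comp_assoc[OF that DF(3) DG(3)] by simp
    show "?u Base \<cdot> conn_app C A T x y z = conn_app C D T (?u Base \<cdot> x) (?u Base \<cdot> y) (?u Base \<cdot> z)"
      using as[OF conn_app_hom[OF DF(1) d]] DF(6)[OF d] DG(6)[OF conn_dom_map[OF F d]]
        as[OF conn_dom_hom(1)[OF DF(1) d]] as[OF conn_dom_hom(2)[OF DF(1) d]] as[OF conn_dom_hom(3)[OF DF(1) d]]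
      by simp
  qed blast
  have "H = G \<cdot>\<^bsub>Conn C\<^esub> F"
    using H F G unfolding Conn_hom_iff[of F] Conn_hom_iff[of G] Conn_hom_iff[of H]
    by (cases F; cases G; cases H) (auto simp: Conn_def arr_part_Comp)
  thus ?thesis using H(1) by simp
qed

lemma Conn_Ide_hom:
  assumes A: "A \<in> Obj (Conn C)"
  shows "Ide (Conn C) A \<in> hom (Conn C) A A"
proof -
  have F: "Ide (Conn C) A = (A, A, arr_part (Rel First) (Ide (Conn C) A), arr_part (Rel Second) (Ide (Conn C) A),
      arr_part Base (Ide (Conn C) A))"
    by (cases A) (simp add: Conn_def)
  have id: "Ide C (obj_part Base A) \<cdot> w = w" if "w \<in> hom C T (obj_part Base A)" for w T
    using that by (rule Comp_Ide_left)
  show ?thesis unfolding Conn_hom_iff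
  proof (intro conjI allI impI A F)
    show "arr_part k (Ide (Conn C) A) \<in> hom C (obj_part k A) (obj_part k A)" for k
      unfolding arr_part_Ide using Ide_in_hom[OF obj_part_Obj[OF A]] .
    fix s
    show "leg1 (rel_part s A) \<cdot> arr_part (Rel s) (Ide (Conn C) A) = arr_part Base (Ide (Conn C) A) \<cdot> leg1 (rel_part s A)"
      "leg2 (rel_part s A) \<cdot> arr_part (Rel s) (Ide (Conn C) A) = arr_part Base (Ide (Conn C) A) \<cdot> leg2 (rel_part s A)"
      unfolding arr_part_Ide using Comp_Ide_left Comp_Ide_right Conn_legs[OF A] by metis+
  next
    fix T x y z assume d: "conn_dom C A T x y z"
    show "arr_part Base (Ide (Conn C) A) \<cdot> conn_app C A T x y z = conn_app C A T (arr_part Base (Ide (Conn C) A) \<cdot> x)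
        (arr_part Base (Ide (Conn C) A) \<cdot> y) (arr_part Base (Ide (Conn C) A) \<cdot> z)"
      unfolding arr_part_Ide using id[OF conn_app_hom[OF A d]] id[OF conn_dom_hom(1)[OF A d]]
        id[OF conn_dom_hom(2)[OF A d]] id[OF conn_dom_hom(3)[OF A d]] by simp
  qed
qed

lemma category_Conn: "category (Conn C)"
proof
  fix F assume "F \<in> Arr (Conn C)"
  hence "F \<in> hom (Conn C) (Dom (Conn C) F) (Cod (Conn C) F)" by (simp add: hom_iff)
  from Conn_homD(1,2)[OF this] show "Dom (Conn C) F \<in> Obj (Conn C)" "Cod (Conn C) F \<in> Obj (Conn C)" .
next
  show "Ide (Conn C) A \<in> hom (Conn C) A A" if "A \<in> Obj (Conn C)" for A using that by (rule Conn_Ide_hom)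
next
  show "G \<cdot>\<^bsub>Conn C\<^esub> F \<in> hom (Conn C) A D" if "F \<in> hom (Conn C) A B" "G \<in> hom (Conn C) B D" for F G A B D
    using that by (rule Conn_Comp_hom)
next
  fix F A B assume F: "F \<in> hom (Conn C) A B"
  note D = Conn_homD[OF F]
  show "F \<cdot>\<^bsub>Conn C\<^esub> Ide (Conn C) A = F"
    using Conn_Comp_hom[OF Conn_Ide_hom[OF D(1)] F] F
    by (rule Conn_hom_eqI) (simp add: arr_part_Comp arr_part_Ide Comp_Ide_right[OF D(3)])
  show "Ide (Conn C) B \<cdot>\<^bsub>Conn C\<^esub> F = F"
    using Conn_Comp_hom[OF F Conn_Ide_hom[OF D(2)]] F
    by (rule Conn_hom_eqI) (simp add: arr_part_Comp arr_part_Ide Comp_Ide_left[OF D(3)])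
next
  fix F G H A B D E assume h: "F \<in> hom (Conn C) A B" "G \<in> hom (Conn C) B D" "H \<in> hom (Conn C) D E"
  show "H \<cdot>\<^bsub>Conn C\<^esub> (G \<cdot>\<^bsub>Conn C\<^esub> F) = (H \<cdot>\<^bsub>Conn C\<^esub> G) \<cdot>\<^bsub>Conn C\<^esub> F"
    using Conn_Comp_hom[OF Conn_Comp_hom[OF h(1,2)] h(3)] Conn_Comp_hom[OF h(1) Conn_Comp_hom[OF h(2,3)]]
  proof (rule Conn_hom_eqI)
    show "arr_part k (H \<cdot>\<^bsub>Conn C\<^esub> (G \<cdot>\<^bsub>Conn C\<^esub> F)) = arr_part k ((H \<cdot>\<^bsub>Conn C\<^esub> G) \<cdot>\<^bsub>Conn C\<^esub> F)" for k
      unfolding arr_part_Comp using Comp_assoc Conn_homD(3) h by metis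
  qed
qed

lemma part_functor: "is_functor (Conn C) C (obj_part k) (arr_part k)"
  unfolding is_functor_def
proof (intro conjI ballI impI)
  show "obj_part k A \<in> Obj C" if "A \<in> Obj (Conn C)" for A using that by (rule obj_part_Obj)
  show "arr_part k F \<in> hom C (obj_part k (Dom (Conn C) F)) (obj_part k (Cod (Conn C) F))"
    if "F \<in> Arr (Conn C)" for F
    using that by (intro Conn_homD(3)) (simp add: hom_iff)
qed (simp_all add: arr_part_Ide arr_part_Comp)

text \<open>The apex is the prescribed limit \<open>M\<close> of the apexes, which is what makes the
  limit of connectors componentwise. Relatedness in the limit is pointwise, and reflexivity,
  symmetry and transitivity follow from this description.\<close>

lemma limit_relation:
  assumes J: "category J" and X: "is_functor J C Xo Xa" and L: "is_limit J C Xo Xa L \<pi>"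
    and Y: "is_functor J C Ro Ra" and M: "is_limit J C Ro Ra M \<rho>"
    and Q: "\<And>i. i \<in> Obj J \<Longrightarrow> is_equivalence C (Xo i) (Q i)" "\<And>i. i \<in> Obj J \<Longrightarrow> apex (Q i) = Ro i"
    and l: "\<And>f. f \<in> Arr J \<Longrightarrow> leg1 (Q (Cod J f)) \<cdot> Ra f = Xa f \<cdot> leg1 (Q (Dom J f))"
      "\<And>f. f \<in> Arr J \<Longrightarrow> leg2 (Q (Cod J f)) \<cdot> Ra f = Xa f \<cdot> leg2 (Q (Dom J f))"
  obtains E where "apex E = M" "is_equivalence C L E"
    "\<And>i. i \<in> Obj J \<Longrightarrow> leg1 (Q i) \<cdot> \<rho> i = \<pi> i \<cdot> leg1 E" "\<And>i. i \<in> Obj J \<Longrightarrow> leg2 (Q i) \<cdot> \<rho> i = \<pi> i \<cdot> leg2 E"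
    "\<And>T x y. related C E T x y \<longleftrightarrow> x \<in> hom C T L \<and> y \<in> hom C T L \<and>
      (\<forall>i \<in> Obj J. related C (Q i) T (\<pi> i \<cdot> x) (\<pi> i \<cdot> y))"
proof -
  have JO: "Dom J f \<in> Obj J" "Cod J f \<in> Obj J" if "f \<in> Arr J" for f
    using that J by (auto simp: category.Dom_in_Obj category.Cod_in_Obj)
  have Xa: "Xa f \<in> hom C (Xo (Dom J f)) (Xo (Cod J f))" and Ra: "Ra f \<in> hom C (Ro (Dom J f)) (Ro (Cod J f))"
    if "f \<in> Arr J" for f using that X Y by (auto simp: is_functor_def)
  note Qr = is_equivalence_relation[OF Q(1)]
  have leg: "leg1 (Q i) \<in> hom C (Ro i) (Xo i)" "leg2 (Q i) \<in> hom C (Ro i) (Xo i)" if "i \<in> Obj J" for i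
    using is_relationD(4,5)[OF Qr[OF that]] Q(2)[OF that] by simp_all
  note LD = is_limitD[OF L] and MD = is_limitD[OF M]
  have cone: "\<exists>m \<in> hom C M L. \<forall>i \<in> Obj J. \<pi> i \<cdot> m = lg i \<cdot> \<rho> i"
    if lg: "\<And>i. i \<in> Obj J \<Longrightarrow> lg i \<in> hom C (Ro i) (Xo i)"
      "\<And>f. f \<in> Arr J \<Longrightarrow> lg (Cod J f) \<cdot> Ra f = Xa f \<cdot> lg (Dom J f)" for lg
  proof -
    have "is_cone J C Xo Xa M (\<lambda>i. lg i \<cdot> \<rho> i)"
      unfolding is_cone_def
    proof (intro conjI ballI)
      show "M \<in> Obj C" using MD(2) .
      show "lg i \<cdot> \<rho> i \<in> hom C M (Xo i)" if "i \<in> Obj J" for i using MD(3)[OF that] lg(1)[OF that] by (rule Comp_in_hom)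
      show "Xa f \<cdot> (lg (Dom J f) \<cdot> \<rho> (Dom J f)) = lg (Cod J f) \<cdot> \<rho> (Cod J f)" if f: "f \<in> Arr J" for f
        using Comp_assoc[OF MD(3)[OF JO(1)[OF f]] lg(1)[OF JO(1)[OF f]] Xa[OF f]] lg(2)[OF f]
          Comp_assoc[OF MD(3)[OF JO(1)[OF f]] Ra[OF f] lg(1)[OF JO(2)[OF f]]] MD(4)[OF f] by metis
    qed
    from limit_lift[OF L this] show ?thesis by metis
  qed
  obtain m1 where m1: "m1 \<in> hom C M L" "\<And>i. i \<in> Obj J \<Longrightarrow> \<pi> i \<cdot> m1 = leg1 (Q i) \<cdot> \<rho> i"
    using cone[of "\<lambda>i. leg1 (Q i)"] leg(1) l(1) by blast
  obtain m2 where m2: "m2 \<in> hom C M L" "\<And>i. i \<in> Obj J \<Longrightarrow> \<pi> i \<cdot> m2 = leg2 (Q i) \<cdot> \<rho> i"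
    using cone[of "\<lambda>i. leg2 (Q i)"] leg(2) l(2) by blast
  let ?E = "\<lparr>apex = M, leg1 = m1, leg2 = m2\<rparr>"
  have pm: "\<pi> i \<cdot> (m1 \<cdot> u) = leg1 (Q i) \<cdot> (\<rho> i \<cdot> u)" "\<pi> i \<cdot> (m2 \<cdot> u) = leg2 (Q i) \<cdot> (\<rho> i \<cdot> u)"
    if i: "i \<in> Obj J" and u: "u \<in> hom C T M" for i u T
    using reassoc[OF m1(2)[OF i] m1(1) LD(3)[OF i] u] reassoc[OF m2(2)[OF i] m2(1) LD(3)[OF i] u]
      Comp_assoc[OF u MD(3)[OF i] leg(1)[OF i]] Comp_assoc[OF u MD(3)[OF i] leg(2)[OF i]] by simp_all
  have rel: "is_relation C L L ?E"
  proof (rule is_relationI, unfold span.simps)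
    fix T u v assume uv: "u \<in> hom C T M" "v \<in> hom C T M" "m1 \<cdot> u = m1 \<cdot> v" "m2 \<cdot> u = m2 \<cdot> v"
    show "u = v"
    proof (rule limit_eqI[OF M J Y uv(1,2)])
      fix i assume i: "i \<in> Obj J"
      show "\<rho> i \<cdot> u = \<rho> i \<cdot> v"
      proof (rule relation_eqI[OF Qr[OF i]])
        show "\<rho> i \<cdot> u \<in> hom C T (apex (Q i))" "\<rho> i \<cdot> v \<in> hom C T (apex (Q i))"
          using Comp_in_hom[OF uv(1) MD(3)[OF i]] Comp_in_hom[OF uv(2) MD(3)[OF i]] Q(2)[OF i] by simp_all
        show "leg1 (Q i) \<cdot> (\<rho> i \<cdot> u) = leg1 (Q i) \<cdot> (\<rho> i \<cdot> v)" "leg2 (Q i) \<cdot> (\<rho> i \<cdot> u) = leg2 (Q i) \<cdot> (\<rho> i \<cdot> v)"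
          using pm[OF i uv(1)] pm[OF i uv(2)] uv(3,4) by simp_all
      qed
    qed
  qed (use m1 m2 in auto)
  have iff: "related C ?E T x y \<longleftrightarrow> x \<in> hom C T L \<and> y \<in> hom C T L \<and>
      (\<forall>i \<in> Obj J. related C (Q i) T (\<pi> i \<cdot> x) (\<pi> i \<cdot> y))" for T x y
  proof (intro iffI conjI ballI; (elim conjE)?)
    assume r: "related C ?E T x y"
    show "x \<in> hom C T L" "y \<in> hom C T L" using related_hom[OF rel r] .
    fix i assume i: "i \<in> Obj J"
    show "related C (Q i) T (\<pi> i \<cdot> x) (\<pi> i \<cdot> y)"
      using MD(3)[OF i] Q(2)[OF i] m1(2)[OF i] m2(2)[OF i]
      by (intro related_map[OF rel Qr[OF i] LD(3)[OF i] _ _ _ r, of "\<rho> i"]) simp_all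
  next
    assume x: "x \<in> hom C T L" and y: "y \<in> hom C T L" and r: "\<forall>i \<in> Obj J. related C (Q i) T (\<pi> i \<cdot> x) (\<pi> i \<cdot> y)"
    \<comment> \<open>The witnesses are chosen independently for each \<open>i\<close>. They
      nevertheless form a cone, because each is determined by its legs and the legs are compatible
      with the diagram.\<close>
    have "\<forall>i. \<exists>h. i \<in> Obj J \<longrightarrow> h \<in> hom C T (Ro i) \<and> leg1 (Q i) \<cdot> h = \<pi> i \<cdot> x \<and> leg2 (Q i) \<cdot> h = \<pi> i \<cdot> y"
    proof (intro allI)
      fix i show "\<exists>h. i \<in> Obj J \<longrightarrow> h \<in> hom C T (Ro i) \<and> leg1 (Q i) \<cdot> h = \<pi> i \<cdot> x \<and> leg2 (Q i) \<cdot> h = \<pi> i \<cdot> y"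
        using r Q(2)[of i] by (metis relatedE)
    qed
    then obtain h where h: "\<And>i. i \<in> Obj J \<Longrightarrow> h i \<in> hom C T (Ro i)"
      "\<And>i. i \<in> Obj J \<Longrightarrow> leg1 (Q i) \<cdot> h i = \<pi> i \<cdot> x" "\<And>i. i \<in> Obj J \<Longrightarrow> leg2 (Q i) \<cdot> h i = \<pi> i \<cdot> y"
      by metis
    have "is_cone J C Ro Ra T h" unfolding is_cone_def
    proof (intro conjI ballI)
      show "T \<in> Obj C" using hom_Obj(1)[OF x] .
      show "h i \<in> hom C T (Ro i)" if "i \<in> Obj J" for i using h(1)[OF that] .
      fix f assume f: "f \<in> Arr J"
      note d = JO(1)[OF f] and c = JO(2)[OF f]
      show "Ra f \<cdot> h (Dom J f) = h (Cod J f)"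
      proof (rule relation_eqI[OF Qr[OF c]])
        show "Ra f \<cdot> h (Dom J f) \<in> hom C T (apex (Q (Cod J f)))" "h (Cod J f) \<in> hom C T (apex (Q (Cod J f)))"
          using Comp_in_hom[OF h(1)[OF d] Ra[OF f]] h(1)[OF c] Q(2)[OF c] by simp_all
        have "leg1 (Q (Cod J f)) \<cdot> (Ra f \<cdot> h (Dom J f)) = Xa f \<cdot> (\<pi> (Dom J f) \<cdot> x)"
          using reassoc[OF l(1)[OF f] Ra[OF f] leg(1)[OF c] h(1)[OF d]]
            Comp_assoc[OF h(1)[OF d] leg(1)[OF d] Xa[OF f]] h(2)[OF d] by simp
        also have "\<dots> = \<pi> (Cod J f) \<cdot> x" using reassoc[OF LD(4)[OF f] LD(3)[OF d] Xa[OF f] x] .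
        finally show "leg1 (Q (Cod J f)) \<cdot> (Ra f \<cdot> h (Dom J f)) = leg1 (Q (Cod J f)) \<cdot> h (Cod J f)"
          using h(2)[OF c] by simp
        have "leg2 (Q (Cod J f)) \<cdot> (Ra f \<cdot> h (Dom J f)) = Xa f \<cdot> (\<pi> (Dom J f) \<cdot> y)"
          using reassoc[OF l(2)[OF f] Ra[OF f] leg(2)[OF c] h(1)[OF d]]
            Comp_assoc[OF h(1)[OF d] leg(2)[OF d] Xa[OF f]] h(3)[OF d] by simp
        also have "\<dots> = \<pi> (Cod J f) \<cdot> y" using reassoc[OF LD(4)[OF f] LD(3)[OF d] Xa[OF f] y] .
        finally show "leg2 (Q (Cod J f)) \<cdot> (Ra f \<cdot> h (Dom J f)) = leg2 (Q (Cod J f)) \<cdot> h (Cod J f)"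
          using h(3)[OF c] by simp
      qed
    qed
    then obtain u where u: "u \<in> hom C T M" "\<And>i. i \<in> Obj J \<Longrightarrow> \<rho> i \<cdot> u = h i"
      using limit_lift[OF M] by blast
    show "related C ?E T x y"
    proof (rule relatedI, unfold span.simps)
      show "u \<in> hom C T M" by fact
      show "m1 \<cdot> u = x"
        using pm(1)[OF _ u(1)] u(2) h(2) by (intro limit_eqI[OF L J X Comp_in_hom[OF u(1) m1(1)] x]) simp
      show "m2 \<cdot> u = y"
        using pm(2)[OF _ u(1)] u(2) h(3) by (intro limit_eqI[OF L J X Comp_in_hom[OF u(1) m2(1)] y]) simp
    qed
  qed
  have "is_equivalence C L ?E"
  proof (rule is_equivalenceI[OF rel])
    show "related C ?E T x x" if "x \<in> hom C T L" for T x
      using that related_refl[OF Q(1) Comp_in_hom[OF that LD(3)]] unfolding iff by blast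
    show "related C ?E T x y \<Longrightarrow> related C ?E T y x" for T x y
      unfolding iff using related_sym[OF Q(1)] by blast
    show "\<lbrakk>related C ?E T x y; related C ?E T y z\<rbrakk> \<Longrightarrow> related C ?E T x z" for T x y z
      unfolding iff using related_trans[OF Q(1)] by blast
  qed
  from that[of ?E, OF _ this _ _ iff] show ?thesis using m1(2) m2(2) by simp
qed

text \<open>The projections of the limit are jointly monic and relatedness is pointwise by
  \<open>E(2)\<close>, so every law for the induced arrow can be tested after each projection, where
  it is a law of the given connector.\<close>

lemma limit_connector:
  assumes J: "category J" and F: "is_functor J (Conn C) Fo Fa"
    and L: "is_limit J C (\<lambda>i. obj_part Base (Fo i)) (\<lambda>f. arr_part Base (Fa f)) L \<pi>"
    and X: "is_functor J C (\<lambda>i. obj_part Base (Fo i)) (\<lambda>f. arr_part Base (Fa f))"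
    and E: "\<And>s. is_equivalence C L (E s)"
      "\<And>s T x y. related C (E s) T x y \<longleftrightarrow> x \<in> hom C T L \<and> y \<in> hom C T L \<and>
        (\<forall>i \<in> Obj J. related C (rel_part s (Fo i)) T (\<pi> i \<cdot> x) (\<pi> i \<cdot> y))"
  obtains p where "is_connector C L (E First) (E Second) p"
    "\<And>T x y z i. \<lbrakk>in_pullback C (E First) (E Second) T x y z; i \<in> Obj J\<rbrakk>
      \<Longrightarrow> \<pi> i \<cdot> app C (E First) (E Second) p T x y z = conn_app C (Fo i) T (\<pi> i \<cdot> x) (\<pi> i \<cdot> y) (\<pi> i \<cdot> z)"
proof -
  let ?P = "triple_obj C (E First) (E Second)"
  let ?k1 = "coord1 C (E First) (E Second)" and ?k2 = "coord2 C (E First) (E Second)"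
    and ?k3 = "coord3 C (E First) (E Second)"
  note Er = is_equivalence_relation[OF E(1)]
  note k = coord_hom[OF Er Er]
  have JO: "Dom J f \<in> Obj J" "Cod J f \<in> Obj J" if "f \<in> Arr J" for f
    using that J by (auto simp: category.Dom_in_Obj category.Cod_in_Obj)
  have Fo: "Fo i \<in> Obj (Conn C)" if "i \<in> Obj J" for i using that F by (auto simp: is_functor_def)
  have Fa: "Fa f \<in> hom (Conn C) (Fo (Dom J f)) (Fo (Cod J f))" if "f \<in> Arr J" for f
    using that F by (auto simp: is_functor_def)
  note LD = is_limitD[OF L]
  have dom: "conn_dom C (Fo i) T (\<pi> i \<cdot> x) (\<pi> i \<cdot> y) (\<pi> i \<cdot> z)"
    if "in_pullback C (E First) (E Second) T x y z" "i \<in> Obj J" for T x y z i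
    using that unfolding in_pullback_def conn_dom_iff E(2) by blast
  \<comment> \<open>The connector of each vertex, evaluated at the projected generic triple; arrows
    of connectors preserve such values, so these form a cone.\<close>
  define \<tau> where "\<tau> i = conn_app C (Fo i) ?P (\<pi> i \<cdot> ?k1) (\<pi> i \<cdot> ?k2) (\<pi> i \<cdot> ?k3)" for i
  note gen = coord_in_pullback_generic[OF Er Er, of First Second]
  have \<tau>: "\<tau> i \<in> hom C ?P (obj_part Base (Fo i))" if "i \<in> Obj J" for i
    unfolding \<tau>_def using conn_app_hom[OF Fo[OF that] dom[OF gen that]] .
  have "is_cone J C (\<lambda>i. obj_part Base (Fo i)) (\<lambda>f. arr_part Base (Fa f)) ?P \<tau>"
    unfolding is_cone_def
  proof (intro conjI ballI \<tau>)
    show "?P \<in> Obj C" using hom_Obj(1)[OF k(1)] .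
    fix f assume f: "f \<in> Arr J"
    note d = JO(1)[OF f]
    have "arr_part Base (Fa f) \<cdot> (\<pi> (Dom J f) \<cdot> w) = \<pi> (Cod J f) \<cdot> w" if "w \<in> hom C ?P L" for w
      using reassoc[OF LD(4)[OF f] LD(3)[OF d] Conn_homD(3)[OF Fa[OF f]] that] .
    thus "arr_part Base (Fa f) \<cdot> \<tau> (Dom J f) = \<tau> (Cod J f)"
      unfolding \<tau>_def using Conn_homD(6)[OF Fa[OF f] dom[OF gen d]] k by simp
  qed
  then obtain p where p: "p \<in> hom C ?P L" "\<And>i. i \<in> Obj J \<Longrightarrow> \<pi> i \<cdot> p = \<tau> i"
    using limit_lift[OF L] by blast
  have pa: "\<pi> i \<cdot> app C (E First) (E Second) p T x y z = conn_app C (Fo i) T (\<pi> i \<cdot> x) (\<pi> i \<cdot> y) (\<pi> i \<cdot> z)"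
    if d: "in_pullback C (E First) (E Second) T x y z" and i: "i \<in> Obj J" for T x y z i
  proof -
    note t = triple[OF Er Er d]
    let ?t = "triple C (E First) (E Second) T x y z"
    have "\<pi> i \<cdot> (p \<cdot> ?t) = \<tau> i \<cdot> ?t" using reassoc[OF p(2)[OF i] p(1) LD(3)[OF i] t(1)] .
    also have "\<dots> = conn_app C (Fo i) T ((\<pi> i \<cdot> ?k1) \<cdot> ?t) ((\<pi> i \<cdot> ?k2) \<cdot> ?t) ((\<pi> i \<cdot> ?k3) \<cdot> ?t)"
      unfolding \<tau>_def using conn_app_comp[OF Fo[OF i] dom[OF gen i] t(1)] by simp
    also have "\<dots> = conn_app C (Fo i) T (\<pi> i \<cdot> x) (\<pi> i \<cdot> y) (\<pi> i \<cdot> z)"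
      using Comp_assoc[OF t(1) k(1) LD(3)[OF i]] Comp_assoc[OF t(1) k(2) LD(3)[OF i]]
        Comp_assoc[OF t(1) k(3) LD(3)[OF i]] t(2-4) by simp
    finally show ?thesis by (simp add: app_def)
  qed
  let ?app = "app C (E First) (E Second) p"
  note ph = in_pullback_hom[OF Er Er, of First Second] and ah = app_hom[OF Er Er p(1)]
  have law: "is_connector C (obj_part Base (Fo i)) (rel_part First (Fo i)) (rel_part Second (Fo i)) (conn_part (Fo i))"
    if "i \<in> Obj J" for i using Fo[OF that] by (simp add: Obj_Conn_iff)
  note laws = is_connectorD[OF Conn_relation[OF Fo] Conn_relation[OF Fo] law, folded conn_app_def conn_dom_def]
  have "is_connector C L (E First) (E Second) p"
  proof (rule is_connectorI[OF p(1)])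
    fix T x y z assume d: "in_pullback C (E First) (E Second) T x y z"
    show "related C (E Second) T x (?app T x y z)" "related C (E First) T (?app T x y z) z"
      unfolding E(2) using ph(1,3)[OF d] ah[OF d] pa[OF d] laws(2,3)[OF _ _ _ dom[OF d]] by simp_all
  next
    fix T x y assume d: "in_pullback C (E First) (E Second) T x x y"
    show "?app T x x y = y"
      using pa[OF d] laws(4)[OF _ _ _ dom[OF d]] by (intro limit_eqI[OF L J X ah[OF d] ph(3)[OF d]]) simp
  next
    fix T x y assume d: "in_pullback C (E First) (E Second) T x y y"
    show "?app T x y y = x"
      using pa[OF d] laws(5)[OF _ _ _ dom[OF d]] by (intro limit_eqI[OF L J X ah[OF d] ph(1)[OF d]]) simp
  next
    fix T x y z u v
    assume d: "in_pullback C (E First) (E Second) T z u v" "in_pullback C (E First) (E Second) T x y (?app T z u v)"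
      "in_pullback C (E First) (E Second) T x y z" "in_pullback C (E First) (E Second) T (?app T x y z) u v"
    show "?app T x y (?app T z u v) = ?app T (?app T x y z) u v"
    proof (rule limit_eqI[OF L J X ah[OF d(2)] ah[OF d(4)]])
      fix i assume i: "i \<in> Obj J"
      show "\<pi> i \<cdot> ?app T x y (?app T z u v) = \<pi> i \<cdot> ?app T (?app T x y z) u v"
        using laws(6)[OF i i i dom[OF d(1) i] _ dom[OF d(3) i]] dom[OF d(2) i] dom[OF d(4) i]
          pa[OF d(1) i] pa[OF d(2) i] pa[OF d(3) i] pa[OF d(4) i] by simp
    qed
  qed
  thus ?thesis using that pa by blast
qed

end

section \<open>Limits, coequalisers and the Goursat law for connectors\<close>

lemma functor_comp:
  assumes F: "is_functor J D Fo Fa" and U: "is_functor D C Uo Ua" and J: "category J"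
  shows "is_functor J C (\<lambda>i. Uo (Fo i)) (\<lambda>f. Ua (Fa f))"
proof -
  have "Dom J f \<in> Obj J" "Cod J f \<in> Obj J" if "f \<in> Arr J" for f
    using that J by (auto simp: category.Dom_in_Obj category.Cod_in_Obj)
  thus ?thesis using F U unfolding is_functor_def hom_iff by simp
qed

section \<open>Componentwise limits in \<open>Conn C\<close>\<close>

context regular_category
begin

text \<open>The limits of the three component diagrams are assembled by
  \<open>limit_relation\<close> and \<open>limit_connector\<close>. The componentwise claim concerns
  the limit built here; \<open>part_limit\<close> extends it to every limit.\<close>

lemma Conn_limit:
  fixes J :: "(nat, nat) cat"
  assumes J: "category J" "finite (Obj J)" "finite (Arr J)" and F: "is_functor J (Conn C) Fo Fa"
  obtains A \<sigma> where "is_limit J (Conn C) Fo Fa A \<sigma>"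
    "\<And>k. is_limit J C (\<lambda>i. obj_part k (Fo i)) (\<lambda>f. arr_part k (Fa f)) (obj_part k A) (\<lambda>i. arr_part k (\<sigma> i))"
proof -
  have JO: "Dom J f \<in> Obj J" "Cod J f \<in> Obj J" if "f \<in> Arr J" for f
    using that J(1) by (auto simp: category.Dom_in_Obj category.Cod_in_Obj)
  have Fo: "Fo i \<in> Obj (Conn C)" if "i \<in> Obj J" for i using that F by (auto simp: is_functor_def)
  have Fa: "Fa f \<in> hom (Conn C) (Fo (Dom J f)) (Fo (Cod J f))" if "f \<in> Arr J" for f
    using that F by (auto simp: is_functor_def)
  have X: "is_functor J C (\<lambda>i. obj_part k (Fo i)) (\<lambda>f. arr_part k (Fa f))" for k
    using F part_functor J(1) by (rule functor_comp)
  have "\<forall>k. \<exists>L \<pi>. is_limit J C (\<lambda>i. obj_part k (Fo i)) (\<lambda>f. arr_part k (Fa f)) L \<pi>"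
    using finitely_complete J X unfolding finitely_complete_def by blast
  then obtain L \<pi> where L: "\<And>k. is_limit J C (\<lambda>i. obj_part k (Fo i)) (\<lambda>f. arr_part k (Fa f)) (L k) (\<pi> k)"
    by metis
  note LD = is_limitD[OF L]
  have "\<exists>E. apex E = L (Rel s) \<and> is_equivalence C (L Base) E \<and>
      (\<forall>i \<in> Obj J. leg1 (rel_part s (Fo i)) \<cdot> \<pi> (Rel s) i = \<pi> Base i \<cdot> leg1 E) \<and>
      (\<forall>i \<in> Obj J. leg2 (rel_part s (Fo i)) \<cdot> \<pi> (Rel s) i = \<pi> Base i \<cdot> leg2 E) \<and>
      (\<forall>T x y. related C E T x y \<longleftrightarrow> x \<in> hom C T (L Base) \<and> y \<in> hom C T (L Base) \<and>
        (\<forall>i \<in> Obj J. related C (rel_part s (Fo i)) T (\<pi> Base i \<cdot> x) (\<pi> Base i \<cdot> y)))" for s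
  proof (rule limit_relation[OF J(1) X[of Base] L[of Base] X[of "Rel s"] L[of "Rel s"]])
    show "is_equivalence C (obj_part Base (Fo i)) (rel_part s (Fo i))" if "i \<in> Obj J" for i
      using Conn_equivalence[OF Fo[OF that]] .
    show "leg1 (rel_part s (Fo (Cod J f))) \<cdot> arr_part (Rel s) (Fa f) = arr_part Base (Fa f) \<cdot> leg1 (rel_part s (Fo (Dom J f)))"
      "leg2 (rel_part s (Fo (Cod J f))) \<cdot> arr_part (Rel s) (Fa f) = arr_part Base (Fa f) \<cdot> leg2 (rel_part s (Fo (Dom J f)))"
      if "f \<in> Arr J" for f using Conn_homD(4,5)[OF Fa[OF that]] .
  qed (simp, blast)
  then obtain E where E: "\<And>s. apex (E s) = L (Rel s)" "\<And>s. is_equivalence C (L Base) (E s)"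
    "\<And>s i. i \<in> Obj J \<Longrightarrow> leg1 (rel_part s (Fo i)) \<cdot> \<pi> (Rel s) i = \<pi> Base i \<cdot> leg1 (E s)"
    "\<And>s i. i \<in> Obj J \<Longrightarrow> leg2 (rel_part s (Fo i)) \<cdot> \<pi> (Rel s) i = \<pi> Base i \<cdot> leg2 (E s)"
    "\<And>s T x y. related C (E s) T x y \<longleftrightarrow> x \<in> hom C T (L Base) \<and> y \<in> hom C T (L Base) \<and>
        (\<forall>i \<in> Obj J. related C (rel_part s (Fo i)) T (\<pi> Base i \<cdot> x) (\<pi> Base i \<cdot> y))"
    by metis
  obtain p where p: "is_connector C (L Base) (E First) (E Second) p"
    "\<And>T x y z i. \<lbrakk>in_pullback C (E First) (E Second) T x y z; i \<in> Obj J\<rbrakk>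
      \<Longrightarrow> \<pi> Base i \<cdot> app C (E First) (E Second) p T x y z = conn_app C (Fo i) T (\<pi> Base i \<cdot> x) (\<pi> Base i \<cdot> y) (\<pi> Base i \<cdot> z)"
    using limit_connector[OF J(1) F L X E(2,5)] by blast
  define A where "A = (E First, E Second, L Base, p)"
  have A_rel: "rel_part s A = E s" for s by (cases s) (simp_all add: A_def)
  have A_part: "conn_part A = p" and A_Base: "obj_part Base A = L Base" by (simp_all add: A_def)
  have A_obj: "obj_part k A = L k" for k
    by (cases k) (simp_all only: A_Base obj_part.simps(1) A_rel E(1))
  have A: "A \<in> Obj (Conn C)"
    unfolding Obj_Conn_iff A_rel A_part A_Base using LD(2) E(2) p(1) by blast
  have A_app: "\<pi> Base i \<cdot> conn_app C A T x y z = conn_app C (Fo i) T (\<pi> Base i \<cdot> x) (\<pi> Base i \<cdot> y) (\<pi> Base i \<cdot> z)"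
    if "conn_dom C A T x y z" "i \<in> Obj J" for T x y z i
    using p(2) that unfolding conn_app_def conn_dom_def A_rel A_part by blast
  have "\<exists>S. S \<in> hom (Conn C) A (Fo i) \<and> (\<forall>k. arr_part k S = \<pi> k i)" if i: "i \<in> Obj J" for i
  proof (rule Conn_homI[OF A Fo[OF i], of "\<lambda>k. \<pi> k i"])
    show "\<pi> k i \<in> hom C (obj_part k A) (obj_part k (Fo i))" for k unfolding A_obj using LD(3)[OF i] .
    show "leg1 (rel_part s (Fo i)) \<cdot> \<pi> (Rel s) i = \<pi> Base i \<cdot> leg1 (rel_part s A)"
      "leg2 (rel_part s (Fo i)) \<cdot> \<pi> (Rel s) i = \<pi> Base i \<cdot> leg2 (rel_part s A)" for s
      unfolding A_rel using E(3,4)[OF i] .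
    show "\<pi> Base i \<cdot> conn_app C A T x y z = conn_app C (Fo i) T (\<pi> Base i \<cdot> x) (\<pi> Base i \<cdot> y) (\<pi> Base i \<cdot> z)"
      if "conn_dom C A T x y z" for T x y z using A_app[OF that i] .
  qed blast
  then obtain \<sigma> where \<sigma>: "\<And>i. i \<in> Obj J \<Longrightarrow> \<sigma> i \<in> hom (Conn C) A (Fo i)" "\<And>i k. i \<in> Obj J \<Longrightarrow> arr_part k (\<sigma> i) = \<pi> k i"
    by metis
  have lim: "is_limit J (Conn C) Fo Fa A \<sigma>" unfolding is_limit_def
  proof (intro conjI allI impI)
    show "is_cone J (Conn C) Fo Fa A \<sigma>" unfolding is_cone_def
    proof (intro conjI ballI A \<sigma>(1))
      fix f assume f: "f \<in> Arr J"
      show "Fa f \<cdot>\<^bsub>Conn C\<^esub> \<sigma> (Dom J f) = \<sigma> (Cod J f)"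
        using Conn_Comp_hom[OF \<sigma>(1)[OF JO(1)[OF f]] Fa[OF f]] \<sigma>(1)[OF JO(2)[OF f]]
        by (rule Conn_hom_eqI) (simp add: arr_part_Comp \<sigma>(2) JO f LD(4)[OF f])
    qed
    fix B \<tau> assume c: "is_cone J (Conn C) Fo Fa B \<tau>"
    hence B: "B \<in> Obj (Conn C)" and \<tau>: "\<And>i. i \<in> Obj J \<Longrightarrow> \<tau> i \<in> hom (Conn C) B (Fo i)"
      by (auto simp: is_cone_def)
    have "is_cone J C (\<lambda>i. obj_part k (Fo i)) (\<lambda>f. arr_part k (Fa f)) (obj_part k B) (\<lambda>i. arr_part k (\<tau> i))" for k
      unfolding is_cone_def
    proof (intro conjI ballI)
      show "obj_part k B \<in> Obj C" using obj_part_Obj[OF B] .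
      show "arr_part k (\<tau> i) \<in> hom C (obj_part k B) (obj_part k (Fo i))" if "i \<in> Obj J" for i
        using Conn_homD(3)[OF \<tau>[OF that]] .
      show "arr_part k (Fa f) \<cdot> arr_part k (\<tau> (Dom J f)) = arr_part k (\<tau> (Cod J f))" if "f \<in> Arr J" for f
        using c that unfolding arr_part_Comp[symmetric] is_cone_def by simp
    qed
    hence "\<forall>k. \<exists>u. u \<in> hom C (obj_part k B) (L k) \<and> (\<forall>i \<in> Obj J. \<pi> k i \<cdot> u = arr_part k (\<tau> i))"
      using limit_lift[OF L] by metis
    then obtain u where u: "\<And>k. u k \<in> hom C (obj_part k B) (L k)" "\<And>k i. i \<in> Obj J \<Longrightarrow> \<pi> k i \<cdot> u k = arr_part k (\<tau> i)"
      by metis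
    have leg_E: "leg1 (E s) \<in> hom C (L (Rel s)) (L Base)" "leg2 (E s) \<in> hom C (L (Rel s)) (L Base)" for s
      using is_relationD(4,5)[OF is_equivalence_relation[OF E(2)]] E(1) by simp_all
    obtain U where U: "U \<in> hom (Conn C) B A" "\<And>k. arr_part k U = u k"
    \<comment> \<open>The parts \<open>u\<close> come from three unrelated universal properties. All
      the compatibilities are equations into the base limit, so they are tested after its
      projections, where they hold because each \<open>\<tau> i\<close> is an arrow of
      connectors.\<close>
    proof (rule Conn_homI[OF B A, of u])
      show "u k \<in> hom C (obj_part k B) (obj_part k A)" for k unfolding A_obj using u(1) .
      fix s
      show "leg1 (rel_part s A) \<cdot> u (Rel s) = u Base \<cdot> leg1 (rel_part s B)" unfolding A_rel
      proof (rule limit_eqI[OF L J(1) X Comp_in_hom[OF u(1) leg_E(1)] Comp_in_hom[OF Conn_legs(1)[OF B] u(1)]])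
        fix i assume i: "i \<in> Obj J"
        have "\<pi> Base i \<cdot> (leg1 (E s) \<cdot> u (Rel s)) = (leg1 (rel_part s (Fo i)) \<cdot> \<pi> (Rel s) i) \<cdot> u (Rel s)"
          using reassoc[OF E(3)[OF i, symmetric] leg_E(1) LD(3)[OF i] u(1)] .
        also have "\<dots> = leg1 (rel_part s (Fo i)) \<cdot> arr_part (Rel s) (\<tau> i)"
          using Comp_assoc[OF u(1) LD(3)[OF i] Conn_legs(1)[OF Fo[OF i]]] u(2)[OF i] by simp
        also have "\<dots> = arr_part Base (\<tau> i) \<cdot> leg1 (rel_part s B)" using Conn_homD(4)[OF \<tau>[OF i]] .
        also have "\<dots> = \<pi> Base i \<cdot> (u Base \<cdot> leg1 (rel_part s B))"
          using reassoc[OF u(2)[OF i] u(1) LD(3)[OF i] Conn_legs(1)[OF B]] by simp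
        finally show "\<pi> Base i \<cdot> (leg1 (E s) \<cdot> u (Rel s)) = \<pi> Base i \<cdot> (u Base \<cdot> leg1 (rel_part s B))" .
      qed
      show "leg2 (rel_part s A) \<cdot> u (Rel s) = u Base \<cdot> leg2 (rel_part s B)" unfolding A_rel
      proof (rule limit_eqI[OF L J(1) X Comp_in_hom[OF u(1) leg_E(2)] Comp_in_hom[OF Conn_legs(2)[OF B] u(1)]])
        fix i assume i: "i \<in> Obj J"
        have "\<pi> Base i \<cdot> (leg2 (E s) \<cdot> u (Rel s)) = (leg2 (rel_part s (Fo i)) \<cdot> \<pi> (Rel s) i) \<cdot> u (Rel s)"
          using reassoc[OF E(4)[OF i, symmetric] leg_E(2) LD(3)[OF i] u(1)] .
        also have "\<dots> = leg2 (rel_part s (Fo i)) \<cdot> arr_part (Rel s) (\<tau> i)"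
          using Comp_assoc[OF u(1) LD(3)[OF i] Conn_legs(2)[OF Fo[OF i]]] u(2)[OF i] by simp
        also have "\<dots> = arr_part Base (\<tau> i) \<cdot> leg2 (rel_part s B)" using Conn_homD(5)[OF \<tau>[OF i]] .
        also have "\<dots> = \<pi> Base i \<cdot> (u Base \<cdot> leg2 (rel_part s B))"
          using reassoc[OF u(2)[OF i] u(1) LD(3)[OF i] Conn_legs(2)[OF B]] by simp
        finally show "\<pi> Base i \<cdot> (leg2 (E s) \<cdot> u (Rel s)) = \<pi> Base i \<cdot> (u Base \<cdot> leg2 (rel_part s B))" .
      qed
    next
      fix T x y z assume d: "conn_dom C B T x y z"
      note dh = conn_dom_hom[OF B d]
      have uh: "u Base \<cdot> w \<in> hom C T (L Base)" if "w \<in> hom C T (obj_part Base B)" for w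
        using that u(1) by (rule Comp_in_hom)
      have pu: "\<pi> Base i \<cdot> (u Base \<cdot> w) = arr_part Base (\<tau> i) \<cdot> w"
        if "i \<in> Obj J" "w \<in> hom C T (obj_part Base B)" for i w
        using reassoc[OF u(2)[OF that(1)] u(1) LD(3)[OF that(1)] that(2)] .
      have dA: "conn_dom C A T (u Base \<cdot> x) (u Base \<cdot> y) (u Base \<cdot> z)"
        unfolding conn_dom_iff A_rel E(5)
        using uh[OF dh(1)] uh[OF dh(2)] uh[OF dh(3)] conn_dom_map[OF \<tau> d] pu dh by (simp add: conn_dom_iff)
      show "u Base \<cdot> conn_app C B T x y z = conn_app C A T (u Base \<cdot> x) (u Base \<cdot> y) (u Base \<cdot> z)"
      proof (rule limit_eqI[OF L J(1) X uh[OF conn_app_hom[OF B d]] conn_app_hom[OF A dA, unfolded A_Base]])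
        fix i assume i: "i \<in> Obj J"
        show "\<pi> Base i \<cdot> (u Base \<cdot> conn_app C B T x y z) = \<pi> Base i \<cdot> conn_app C A T (u Base \<cdot> x) (u Base \<cdot> y) (u Base \<cdot> z)"
          using A_app[OF dA i] pu[OF i] dh conn_app_hom[OF B d] Conn_homD(6)[OF \<tau>[OF i] d] by simp
      qed
    qed blast
    show "\<exists>!u. u \<in> hom (Conn C) B A \<and> (\<forall>i\<in>Obj J. \<sigma> i \<cdot>\<^bsub>Conn C\<^esub> u = \<tau> i)"
    proof (intro ex1I[of _ U] conjI ballI U(1))
      show "\<sigma> i \<cdot>\<^bsub>Conn C\<^esub> U = \<tau> i" if i: "i \<in> Obj J" for i
        using Conn_Comp_hom[OF U(1) \<sigma>(1)[OF i]] \<tau>[OF i]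
        by (rule Conn_hom_eqI) (simp add: arr_part_Comp \<sigma>(2)[OF i] U(2) u(2)[OF i])
      fix V assume V: "V \<in> hom (Conn C) B A \<and> (\<forall>i\<in>Obj J. \<sigma> i \<cdot>\<^bsub>Conn C\<^esub> V = \<tau> i)"
      show "V = U"
      proof (rule Conn_hom_eqI[OF conjunct1[OF V] U(1)])
        fix k
        have Vk: "arr_part k V \<in> hom C (obj_part k B) (L k)" using Conn_homD(3)[OF conjunct1[OF V], of k] A_obj by simp
        show "arr_part k V = arr_part k U"
          unfolding U(2)
        proof (rule limit_eqI[OF L J(1) X Vk u(1)])
          fix i assume i: "i \<in> Obj J"
          show "\<pi> k i \<cdot> arr_part k V = \<pi> k i \<cdot> u k"
            using V i arr_part_Comp[of k C "\<sigma> i" V] \<sigma>(2)[OF i] u(2)[OF i] by simp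
        qed
      qed
    qed
  qed
  \<comment> \<open>The parts of \<open>\<sigma>\<close> match the chosen cones only on
    \<open>Obj J\<close>, hence the transport along an identity.\<close>
  have "is_limit J C (\<lambda>i. obj_part k (Fo i)) (\<lambda>f. arr_part k (Fa f)) (obj_part k A) (\<lambda>i. arr_part k (\<sigma> i))" for k
    unfolding A_obj
  proof (rule limit_transport[OF L[of k] J(1) X[of k], of "Ide C (L k)" _ "Ide C (L k)"])
    note id = Ide_in_hom[OF LD(2)[of k]]
    show "Ide C (L k) \<in> hom C (L k) (L k)" "Ide C (L k) \<in> hom C (L k) (L k)" by (fact id)+
    show "Ide C (L k) \<cdot> Ide C (L k) = Ide C (L k)" "Ide C (L k) \<cdot> Ide C (L k) = Ide C (L k)"
      using Comp_Ide_left[OF id] by auto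
    show "\<pi> k i \<cdot> Ide C (L k) = arr_part k (\<sigma> i)" if "i \<in> Obj J" for i
      unfolding \<sigma>(2)[OF that] using Comp_Ide_right[OF LD(3)[OF that]] .
  qed
  with lim that show ?thesis by blast
qed

lemma Conn_finitely_complete: "finitely_complete (Conn C)"
  unfolding finitely_complete_def using Conn_limit by metis

text \<open>Any limit is isomorphic to the one constructed in \<open>Conn_limit\<close>, and the
  parts of that isomorphism transport the component limits.\<close>

lemma part_limit:
  fixes J :: "(nat, nat) cat"
  assumes J: "category J" "finite (Obj J)" "finite (Arr J)" and F: "is_functor J (Conn C) Fo Fa"
    and l: "is_limit J (Conn C) Fo Fa A \<sigma>"
  shows "is_limit J C (\<lambda>i. obj_part k (Fo i)) (\<lambda>f. arr_part k (Fa f)) (obj_part k A) (\<lambda>i. arr_part k (\<sigma> i))"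
proof -
  interpret K: category "Conn C" by (rule category_Conn)
  obtain B \<tau> where B: "is_limit J (Conn C) Fo Fa B \<tau>"
    "is_limit J C (\<lambda>i. obj_part k (Fo i)) (\<lambda>f. arr_part k (Fa f)) (obj_part k B) (\<lambda>i. arr_part k (\<tau> i))"
    using Conn_limit[OF J F] by blast
  obtain i j where ij: "i \<in> hom (Conn C) A B" "j \<in> hom (Conn C) B A" "j \<cdot>\<^bsub>Conn C\<^esub> i = Ide (Conn C) A"
    "i \<cdot>\<^bsub>Conn C\<^esub> j = Ide (Conn C) B" "\<And>n. n \<in> Obj J \<Longrightarrow> \<tau> n \<cdot>\<^bsub>Conn C\<^esub> i = \<sigma> n"
    using K.limit_comparison[OF B(1) l J(1) F] by blast
  show ?thesis
    using Conn_homD(3)[OF ij(1)] Conn_homD(3)[OF ij(2)] ij(3-5)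
    by (intro limit_transport[OF B(2) J(1) functor_comp[OF F part_functor J(1)], of "arr_part k i" _ "arr_part k j"])
      (simp_all add: arr_part_Comp[symmetric] arr_part_Ide[symmetric])
qed

text \<open>The part functors carry the cospan diagram of \<open>F\<close> and \<open>G\<close>,
  with its cone, to the cospan diagram of their parts, so \<open>part_limit\<close> can be read as a
  statement about pullbacks.\<close>

lemma part_pullback:
  assumes P: "is_pullback (Conn C) F G P"
  shows "is_pullback C (arr_part k F) (arr_part k G)
    \<lparr>apex = obj_part k (apex P), leg1 = arr_part k (leg1 P), leg2 = arr_part k (leg2 P)\<rparr>"
    (is "is_pullback C _ _ ?P")
proof -
  interpret K: category "Conn C" by (rule category_Conn)
  note D = K.is_pullbackD[OF P]
  have h: "arr_part k F \<in> hom C (obj_part k (Dom (Conn C) F)) (obj_part k (Cod (Conn C) F))"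
    "arr_part k G \<in> hom C (obj_part k (Dom (Conn C) G)) (obj_part k (Cod (Conn C) F))"
    using D(1-3) by (intro Conn_homD(3); simp add: hom_iff)+
  hence fg: "arr_part k F \<in> Arr C" "arr_part k G \<in> Arr C" "Cod C (arr_part k F) = Cod C (arr_part k G)"
    by (auto simp: hom_iff)
  have o: "K.cospan_Fo F G i \<in> Obj (Conn C)" for i
    using D(1-3) K.Dom_in_Obj K.Cod_in_Obj by (auto simp: K.cospan_Fo_def)
  have Fo: "(\<lambda>i. obj_part k (K.cospan_Fo F G i)) = cospan_Fo (arr_part k F) (arr_part k G)"
    using h by (auto simp: K.cospan_Fo_def cospan_Fo_def hom_iff fun_eq_iff)
  have Fa: "(\<lambda>i. arr_part k (K.cospan_Fa F G i)) = cospan_Fa (arr_part k F) (arr_part k G)"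
    using fun_cong[OF Fo] by (auto simp: K.cospan_Fa_def cospan_Fa_def fun_eq_iff arr_part_Ide)
  have \<pi>: "(\<lambda>i. arr_part k (K.cospan_cone F P i)) = cospan_cone (arr_part k F) ?P"
    by (auto simp: K.cospan_cone_def cospan_cone_def fun_eq_iff arr_part_Comp)
  have "is_limit cospan_cat (Conn C) (K.cospan_Fo F G) (K.cospan_Fa F G) (apex P) (K.cospan_cone F P)"
    using K.pullback_iff_limit[OF D(1-3)] P by blast
  from part_limit[OF category_cospan_cat _ _ K.cospan_functor[OF D(1-3)] this, of k]
  show ?thesis unfolding Fo Fa \<pi> pullback_iff_limit[OF fg] by (simp add: cospan_cat_def)
qed

lemma part_product:
  assumes P: "is_product (Conn C) A B P"
  shows "is_product C (obj_part k A) (obj_part k B)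
    \<lparr>apex = obj_part k (apex P), leg1 = arr_part k (leg1 P), leg2 = arr_part k (leg2 P)\<rparr>"
    (is "is_product C _ _ ?P")
proof -
  interpret K: category "Conn C" by (rule category_Conn)
  note D = K.is_productD[OF P]
  have Fo: "(\<lambda>i. obj_part k (K.pair_Fo A B i)) = pair_Fo (obj_part k A) (obj_part k B)"
    by (auto simp: K.pair_Fo_def pair_Fo_def fun_eq_iff)
  have Fa: "(\<lambda>i. arr_part k (K.pair_Fa A B i)) = pair_Fa (obj_part k A) (obj_part k B)"
    using fun_cong[OF Fo] by (auto simp: K.pair_Fa_def pair_Fa_def fun_eq_iff arr_part_Ide)
  have \<pi>: "(\<lambda>i. arr_part k (K.pair_cone P i)) = pair_cone ?P"
    by (auto simp: K.pair_cone_def pair_cone_def fun_eq_iff)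
  have "is_limit pair_cat (Conn C) (K.pair_Fo A B) (K.pair_Fa A B) (apex P) (K.pair_cone P)"
    using K.product_iff_limit[OF D(1,2)] P by blast
  from part_limit[OF category_pair_cat _ _ K.pair_functor[OF D(1,2)] this, of k]
  show ?thesis unfolding Fo Fa \<pi> product_iff_limit[OF obj_part_Obj[OF D(1)] obj_part_Obj[OF D(2)]]
    by (simp add: pair_cat_def)
qed

text \<open>Every pair identified by \<open>e\<close> factors through the kernel pair, so an arrow
  equalising the kernel pair satisfies the hypothesis of \<open>regular_epi_descent\<close>.\<close>

lemma regular_epi_kernel_coequaliser:
  assumes e: "regular_epi C e" and P: "is_pullback C e e P"
  shows "is_coequaliser C (leg1 P) (leg2 P) e"
  unfolding is_coequaliser_def
proof (intro conjI ballI impI)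
  note D = is_pullbackD[OF P]
  fix h assume h: "h \<in> Arr C" "Dom C h = Dom C e \<and> h \<cdot> leg1 P = h \<cdot> leg2 P"
  have h': "h \<in> hom C (Dom C e) (Cod C h)" using h by (simp add: hom_iff)
  obtain b where b: "b \<in> hom C (Cod C e) (Cod C h)" "b \<cdot> e = h"
  proof (rule regular_epi_descent[OF e h'])
    fix T u v assume uv: "u \<in> hom C T (Dom C e)" "v \<in> hom C T (Dom C e)" "e \<cdot> u = e \<cdot> v"
    obtain w where w: "w \<in> hom C T (apex P)" "leg1 P \<cdot> w = u" "leg2 P \<cdot> w = v"
      using pullback_lift[OF P uv] .
    show "h \<cdot> u = h \<cdot> v" using Comp_assoc[OF w(1) D(5) h'] Comp_assoc[OF w(1) D(6) h'] h(2) w(2,3) by simp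
  qed blast
  show "\<exists>!u. u \<in> hom C (Cod C e) (Cod C h) \<and> u \<cdot> e = h"
    using b regular_epi_cancel[OF e] by metis
qed (use is_pullbackD[OF P] in \<open>auto simp: hom_iff\<close>)

text \<open>Orthogonality of regular epimorphisms and monomorphisms: \<open>k\<close> is the
  diagonal of the square with the cover \<open>d\<close> opposite to the monic \<open>m\<close> and
  with other sides \<open>e \<cdot> l\<close> and \<open>l' \<cdot> n\<close>.\<close>

lemma image_leg:
  assumes l: "l \<in> hom C A X" and l': "l' \<in> hom C B Y" and eq: "l' \<cdot> (n \<cdot> d) = (m \<cdot> e) \<cdot> l"
    and e: "e \<in> hom C X I" and m: "monic C m" "m \<in> hom C I Y"
    and d: "cover C d A J" and n: "n \<in> hom C J B"
  obtains k where "k \<in> hom C J I" "k \<cdot> d = e \<cdot> l" "m \<cdot> k = l' \<cdot> n"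
proof -
  note d' = cover_hom[OF d]
  have dr: "regular_epi C d" "Dom C d = A" "Cod C d = J" "Dom C m = I" using d m(2) by (auto simp: cover_def hom_iff)
  have el: "e \<cdot> l \<in> hom C A I" using l e by (rule Comp_in_hom)
  have mel: "m \<cdot> (e \<cdot> l) = (l' \<cdot> n) \<cdot> d" using eq Comp_assoc[OF l e m(2)] Comp_assoc[OF d' n l'] by simp
  have ln: "l' \<cdot> n \<in> hom C J Y" using n l' by (rule Comp_in_hom)
  obtain k where k: "k \<in> hom C J I" "k \<cdot> d = e \<cdot> l"
  proof (rule regular_epi_descent[OF dr(1), of "e \<cdot> l" I, unfolded dr(2,3)])
    fix T u v assume uv: "u \<in> hom C T A" "v \<in> hom C T A" "d \<cdot> u = d \<cdot> v"
    have "m \<cdot> ((e \<cdot> l) \<cdot> u) = m \<cdot> ((e \<cdot> l) \<cdot> v)"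
      using reassoc[OF mel el m(2) uv(1)] reassoc[OF mel el m(2) uv(2)]
        Comp_assoc[OF uv(1) d' ln] Comp_assoc[OF uv(2) d' ln] uv(3) by simp
    thus "(e \<cdot> l) \<cdot> u = (e \<cdot> l) \<cdot> v"
      using monicD[OF m(1), unfolded dr(4), OF Comp_in_hom[OF uv(1) el] Comp_in_hom[OF uv(2) el]] by blast
  qed (use el in auto)
  have "(m \<cdot> k) \<cdot> d = (l' \<cdot> n) \<cdot> d" using Comp_assoc[OF d' k(1) m(2)] k(2) mel by simp
  hence "m \<cdot> k = l' \<cdot> n" using cover_epi[OF d Comp_in_hom[OF k(1) m(2)] ln] by blast
  with k that show ?thesis by blast
qed

text \<open>The legs of the image are the two diagonals from \<open>image_leg\<close>. They are
  jointly monic because, followed by \<open>m\<close>, they are the legs of \<open>R'\<close>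
  restricted along the monic \<open>n\<close>.\<close>

lemma image_relation:
  assumes R: "is_relation C X X R" and R': "is_relation C Y Y R'"
    and f: "leg1 R' \<cdot> (n \<cdot> d) = (m \<cdot> e) \<cdot> leg1 R" "leg2 R' \<cdot> (n \<cdot> d) = (m \<cdot> e) \<cdot> leg2 R"
    and e: "cover C e X I" and m: "monic C m" "m \<in> hom C I Y"
    and d: "cover C d (apex R) J" and n: "monic C n" "n \<in> hom C J (apex R')"
  obtains Q where "apex Q = J" "is_relation C I I Q" "quotient_relation C e R Q d"
    "leg1 R' \<cdot> n = m \<cdot> leg1 Q" "leg2 R' \<cdot> n = m \<cdot> leg2 Q"
proof -
  note DR = is_relationD[OF R] and DR' = is_relationD[OF R']
  obtain k1 where k1: "k1 \<in> hom C J I" "k1 \<cdot> d = e \<cdot> leg1 R" "m \<cdot> k1 = leg1 R' \<cdot> n"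
    using image_leg[OF DR(4) DR'(4) f(1) cover_hom[OF e] m d n(2)] .
  obtain k2 where k2: "k2 \<in> hom C J I" "k2 \<cdot> d = e \<cdot> leg2 R" "m \<cdot> k2 = leg2 R' \<cdot> n"
    using image_leg[OF DR(5) DR'(5) f(2) cover_hom[OF e] m d n(2)] .
  let ?Q = "\<lparr>apex = J, leg1 = k1, leg2 = k2\<rparr>"
  have "is_relation C I I ?Q"
  proof (rule is_relationI, unfold span.simps)
    fix T u v assume uv: "u \<in> hom C T J" "v \<in> hom C T J" "k1 \<cdot> u = k1 \<cdot> v" "k2 \<cdot> u = k2 \<cdot> v"
    have "n \<cdot> u = n \<cdot> v"
    proof (rule relation_eqI[OF R' Comp_in_hom[OF uv(1) n(2)] Comp_in_hom[OF uv(2) n(2)]])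
      show "leg1 R' \<cdot> (n \<cdot> u) = leg1 R' \<cdot> (n \<cdot> v)"
        using reassoc[OF k1(3) k1(1) m(2) uv(1)] reassoc[OF k1(3) k1(1) m(2) uv(2)]
          Comp_assoc[OF uv(1) n(2) DR'(4)] Comp_assoc[OF uv(2) n(2) DR'(4)] uv(3) by simp
      show "leg2 R' \<cdot> (n \<cdot> u) = leg2 R' \<cdot> (n \<cdot> v)"
        using reassoc[OF k2(3) k2(1) m(2) uv(1)] reassoc[OF k2(3) k2(1) m(2) uv(2)]
          Comp_assoc[OF uv(1) n(2) DR'(5)] Comp_assoc[OF uv(2) n(2) DR'(5)] uv(4) by simp
    qed
    moreover have "Dom C n = J" using n(2) by (simp add: hom_iff)
    ultimately show "u = v" using monicD[OF n(1), of u T v] uv(1,2) by simp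
  qed (use k1 k2 in auto)
  moreover have "quotient_relation C e R ?Q d" using d k1 k2 by (simp add: quotient_relation_def)
  ultimately show ?thesis using that[of ?Q] k1(3) k2(3) by simp
qed

text \<open>Each equation to be verified has the base part of \<open>B\<close> as target, so joint
  monicity is required only for the base parts of \<open>N1\<close> and \<open>N2\<close>; after
  composing with these, both sides become expressions in \<open>M1\<close> or \<open>M2\<close>,
  which are arrows of connectors.\<close>

lemma Conn_relation_lift:
  assumes N: "N1 \<in> hom (Conn C) B D" "N2 \<in> hom (Conn C) B D" and M: "M1 \<in> hom (Conn C) A D" "M2 \<in> hom (Conn C) A D"
    and i: "\<And>k. i k \<in> hom C (obj_part k A) (obj_part k B)"
    and eq: "\<And>k. arr_part k N1 \<cdot> i k = arr_part k M1" "\<And>k. arr_part k N2 \<cdot> i k = arr_part k M2"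
    and rel: "is_relation C X X \<lparr>apex = obj_part Base B, leg1 = arr_part Base N1, leg2 = arr_part Base N2\<rparr>"
  obtains H where "H \<in> hom (Conn C) A B" "\<And>k. arr_part k H = i k"
proof -
  note N1 = Conn_homD[OF N(1)] and N2 = Conn_homD[OF N(2)] and M1 = Conn_homD[OF M(1)] and M2 = Conn_homD[OF M(2)]
  note A = M1(1) and B = N1(1) and D = N1(2)
  have leg: "l \<cdot> i (Rel s) = i Base \<cdot> l'"
    if l: "l \<in> hom C (obj_part (Rel s) B) (obj_part Base B)" and l': "l' \<in> hom C (obj_part (Rel s) A) (obj_part Base A)"
      and d: "d \<in> hom C (obj_part (Rel s) D) (obj_part Base D)"
      and n: "arr_part Base N1 \<cdot> l = d \<cdot> arr_part (Rel s) N1" "arr_part Base N2 \<cdot> l = d \<cdot> arr_part (Rel s) N2"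
      and m: "arr_part Base M1 \<cdot> l' = d \<cdot> arr_part (Rel s) M1" "arr_part Base M2 \<cdot> l' = d \<cdot> arr_part (Rel s) M2"
    for l l' d s
  proof (rule relation_eqI[OF rel], unfold span.simps)
    show "l \<cdot> i (Rel s) \<in> hom C (obj_part (Rel s) A) (obj_part Base B)" using i l by (rule Comp_in_hom)
    show "i Base \<cdot> l' \<in> hom C (obj_part (Rel s) A) (obj_part Base B)" using l' i by (rule Comp_in_hom)
    show "arr_part Base N1 \<cdot> (l \<cdot> i (Rel s)) = arr_part Base N1 \<cdot> (i Base \<cdot> l')"
      using reassoc[OF n(1) l N1(3) i] Comp_assoc[OF i N1(3) d] reassoc[OF eq(1) i N1(3) l'] m(1) eq(1) by metis
    show "arr_part Base N2 \<cdot> (l \<cdot> i (Rel s)) = arr_part Base N2 \<cdot> (i Base \<cdot> l')"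
      using reassoc[OF n(2) l N2(3) i] Comp_assoc[OF i N2(3) d] reassoc[OF eq(2) i N2(3) l'] m(2) eq(2) by metis
  qed
  have l1: "leg1 (rel_part s B) \<cdot> i (Rel s) = i Base \<cdot> leg1 (rel_part s A)" for s
    using leg[OF Conn_legs(1)[OF B] Conn_legs(1)[OF A] Conn_legs(1)[OF D]] N1(4) N2(4) M1(4) M2(4) by metis
  have l2: "leg2 (rel_part s B) \<cdot> i (Rel s) = i Base \<cdot> leg2 (rel_part s A)" for s
    using leg[OF Conn_legs(2)[OF B] Conn_legs(2)[OF A] Conn_legs(2)[OF D]] N1(5) N2(5) M1(5) M2(5) by metis
  show ?thesis
  proof (rule Conn_homI[OF A B i l1 l2])
    fix T x y z assume d: "conn_dom C A T x y z"
    note dh = conn_dom_hom[OF A d]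
    have "related C (rel_part s A) T a b \<Longrightarrow> related C (rel_part s B) T (i Base \<cdot> a) (i Base \<cdot> b)" for s a b
      using related_map[OF Conn_relation[OF A] Conn_relation[OF B] i i[of "Rel s", simplified] l1 l2] .
    hence d': "conn_dom C B T (i Base \<cdot> x) (i Base \<cdot> y) (i Base \<cdot> z)" using d by (simp add: conn_dom_iff)
    have N: "arr_part Base N1 \<cdot> (i Base \<cdot> w) = arr_part Base M1 \<cdot> w" "arr_part Base N2 \<cdot> (i Base \<cdot> w) = arr_part Base M2 \<cdot> w"
      if "w \<in> hom C T (obj_part Base A)" for w
      using reassoc[OF eq(1) i N1(3) that] reassoc[OF eq(2) i N2(3) that] .
    show "i Base \<cdot> conn_app C A T x y z = conn_app C B T (i Base \<cdot> x) (i Base \<cdot> y) (i Base \<cdot> z)"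
    proof (rule relation_eqI[OF rel], unfold span.simps)
      show "i Base \<cdot> conn_app C A T x y z \<in> hom C T (obj_part Base B)" using conn_app_hom[OF A d] i by (rule Comp_in_hom)
      show "conn_app C B T (i Base \<cdot> x) (i Base \<cdot> y) (i Base \<cdot> z) \<in> hom C T (obj_part Base B)" using conn_app_hom[OF B d'] .
      show "arr_part Base N1 \<cdot> (i Base \<cdot> conn_app C A T x y z) = arr_part Base N1 \<cdot> conn_app C B T (i Base \<cdot> x) (i Base \<cdot> y) (i Base \<cdot> z)"
        using N1(6)[OF d'] N(1)[OF conn_app_hom[OF A d]] N(1)[OF dh(1)] N(1)[OF dh(2)] N(1)[OF dh(3)] M1(6)[OF d] by simp
      show "arr_part Base N2 \<cdot> (i Base \<cdot> conn_app C A T x y z) = arr_part Base N2 \<cdot> conn_app C B T (i Base \<cdot> x) (i Base \<cdot> y) (i Base \<cdot> z)"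
        using N2(6)[OF d'] N(2)[OF conn_app_hom[OF A d]] N(2)[OF dh(1)] N(2)[OF dh(2)] N(2)[OF dh(3)] M2(6)[OF d] by simp
    qed
  qed (use that in blast)
qed

end

section \<open>Coequalisers, images and regular epimorphisms of connectors\<close>

context goursat_category
begin

text \<open>The three factorisations through the parts of \<open>F\<close> fit together:
  compatibility with the legs can be tested after the cover on the relation part, and compatibility
  with connectors after lifting triples.\<close>

lemma Conn_coequaliser:
  assumes F: "F \<in> hom (Conn C) A B" and G: "G1 \<in> hom (Conn C) Z A" "G2 \<in> hom (Conn C) Z A"
    and co: "\<And>k. is_coequaliser C (arr_part k G1) (arr_part k G2) (arr_part k F)"
  shows "is_coequaliser (Conn C) G1 G2 F"
  unfolding is_coequaliser_def
proof (intro conjI ballI impI)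
  note DF = Conn_homD[OF F] and DG1 = Conn_homD[OF G(1)] and DG2 = Conn_homD[OF G(2)]
  note A = DF(1) and B = DF(2)
  have cov: "cover C (arr_part k F) (obj_part k A) (obj_part k B)" for k
    using co DF(3) by (auto simp: cover_def regular_epi_def)
  have qt: "quotient_relation C (arr_part Base F) (rel_part s A) (rel_part s B) (arr_part (Rel s) F)" for s
    using cov[of "Rel s"] DF(4,5) by (simp add: quotient_relation_def)
  show "G1 \<in> Arr (Conn C)" "G2 \<in> Arr (Conn C)" "F \<in> Arr (Conn C)" "Dom (Conn C) G1 = Dom (Conn C) G2"
    "Cod (Conn C) G1 = Dom (Conn C) F" "Cod (Conn C) G2 = Dom (Conn C) F"
    using F G by (auto simp: hom_iff)
  show "F \<cdot>\<^bsub>Conn C\<^esub> G1 = F \<cdot>\<^bsub>Conn C\<^esub> G2"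
    using Conn_Comp_hom[OF G(1) F] Conn_Comp_hom[OF G(2) F]
    by (rule Conn_hom_eqI) (simp add: arr_part_Comp is_coequaliserD(4)[OF co])
  fix H assume H0: "H \<in> Arr (Conn C)" "Dom (Conn C) H = Dom (Conn C) F \<and> H \<cdot>\<^bsub>Conn C\<^esub> G1 = H \<cdot>\<^bsub>Conn C\<^esub> G2"
  define D where "D = Cod (Conn C) H"
  have H: "H \<in> hom (Conn C) A D" using H0 F by (simp add: hom_iff D_def)
  note DH = Conn_homD[OF H] and D = Conn_homD(2)[OF H]
  have dom: "Dom C (arr_part k F) = obj_part k A" "Cod C (arr_part k F) = obj_part k B" for k
    using DF(3) by (auto simp: hom_iff)
  have "\<exists>u. u \<in> hom C (obj_part k B) (obj_part k D) \<and> u \<cdot> arr_part k F = arr_part k H" for k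
  proof -
    have "arr_part k H \<cdot> arr_part k G1 = arr_part k H \<cdot> arr_part k G2"
      using H0(2) arr_part_Comp by metis
    from coequaliser_lift[OF co, of _ k, unfolded dom, OF DH(3) this] show ?thesis by blast
  qed
  then obtain u where u: "\<And>k. u k \<in> hom C (obj_part k B) (obj_part k D)" "\<And>k. u k \<cdot> arr_part k F = arr_part k H"
    by metis
  have leg: "d \<cdot> u (Rel s) = u Base \<cdot> b"
    if a: "a \<in> hom C (obj_part (Rel s) A) (obj_part Base A)" and b: "b \<in> hom C (obj_part (Rel s) B) (obj_part Base B)"
      and d: "d \<in> hom C (obj_part (Rel s) D) (obj_part Base D)"
      and f: "b \<cdot> arr_part (Rel s) F = arr_part Base F \<cdot> a" and h: "d \<cdot> arr_part (Rel s) H = arr_part Base H \<cdot> a"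
    for a b d s
  proof -
    have "(d \<cdot> u (Rel s)) \<cdot> arr_part (Rel s) F = (u Base \<cdot> b) \<cdot> arr_part (Rel s) F"
      using Comp_assoc[OF DF(3) u(1) d] u(2) Comp_assoc[OF DF(3) b u(1)] f h
        reassoc[OF u(2) DF(3) u(1) a] by metis
    thus ?thesis using cover_epi[OF cov Comp_in_hom[OF u(1) d] Comp_in_hom[OF b u(1)]] by blast
  qed
  have l1: "leg1 (rel_part s D) \<cdot> u (Rel s) = u Base \<cdot> leg1 (rel_part s B)" for s
    using leg[OF Conn_legs(1)[OF A] Conn_legs(1)[OF B] Conn_legs(1)[OF D] DF(4) DH(4)] .
  have l2: "leg2 (rel_part s D) \<cdot> u (Rel s) = u Base \<cdot> leg2 (rel_part s B)" for s
    using leg[OF Conn_legs(2)[OF A] Conn_legs(2)[OF B] Conn_legs(2)[OF D] DF(5) DH(5)] .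
  obtain U where U: "U \<in> hom (Conn C) B D" "\<And>k. arr_part k U = u k"
  proof (rule Conn_homI[OF B D, of u])
    show "u k \<in> hom C (obj_part k B) (obj_part k D)" for k by (fact u(1))
    show "leg1 (rel_part s D) \<cdot> u (Rel s) = u Base \<cdot> leg1 (rel_part s B)"
      "leg2 (rel_part s D) \<cdot> u (Rel s) = u Base \<cdot> leg2 (rel_part s B)" for s by (fact l1 l2)+
    fix T a b c assume d: "conn_dom C B T a b c"
    \<comment> \<open>Being a cover on the base part does not suffice to lift a composable triple of
      \<open>B\<close>; \<open>triple_lift\<close> uses that the relations of \<open>B\<close> are
      quotients of those of \<open>A\<close>.\<close>
    obtain T' q x y z where q: "cover C q T' T" "conn_dom C A T' x y z" "arr_part Base F \<cdot> x = a \<cdot> q"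
      "arr_part Base F \<cdot> y = b \<cdot> q" "arr_part Base F \<cdot> z = c \<cdot> q"
      using triple_lift[OF Conn_equivalence[OF A] Conn_equivalence[OF A] Conn_relation[OF B] Conn_relation[OF B]
          DF(3) qt qt d[unfolded conn_dom_def], folded conn_dom_def] .
    note q' = cover_hom[OF q(1)] and dh = conn_dom_hom[OF B d] and dh' = conn_dom_hom[OF A q(2)]
    have "related C (rel_part s B) T v w \<Longrightarrow> related C (rel_part s D) T (u Base \<cdot> v) (u Base \<cdot> w)" for s v w
      using related_map[OF Conn_relation[OF B] Conn_relation[OF D] u(1) u(1)[of "Rel s", simplified] l1 l2] .
    hence d': "conn_dom C D T (u Base \<cdot> a) (u Base \<cdot> b) (u Base \<cdot> c)" using d by (simp add: conn_dom_iff)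
    have uF: "u Base \<cdot> (arr_part Base F \<cdot> w) = arr_part Base H \<cdot> w" if "w \<in> hom C T' (obj_part Base A)" for w
      using reassoc[OF u(2) DF(3) u(1) that] .
    have uq: "(u Base \<cdot> w) \<cdot> q = u Base \<cdot> (w \<cdot> q)" if "w \<in> hom C T (obj_part Base B)" for w
      using Comp_assoc[OF q' that u(1)] by simp
    have "(u Base \<cdot> conn_app C B T a b c) \<cdot> q = u Base \<cdot> (arr_part Base F \<cdot> conn_app C A T' x y z)"
      using uq[OF conn_app_hom[OF B d]] conn_app_comp[OF B d q'] DF(6)[OF q(2)] q(3-5) by simp
    also have "\<dots> = conn_app C D T' (arr_part Base H \<cdot> x) (arr_part Base H \<cdot> y) (arr_part Base H \<cdot> z)"
      using uF[OF conn_app_hom[OF A q(2)]] DH(6)[OF q(2)] by simp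
    also have "\<dots> = conn_app C D T' ((u Base \<cdot> a) \<cdot> q) ((u Base \<cdot> b) \<cdot> q) ((u Base \<cdot> c) \<cdot> q)"
      using uF[OF dh'(1)] uF[OF dh'(2)] uF[OF dh'(3)] uq[OF dh(1)] uq[OF dh(2)] uq[OF dh(3)] q(3-5) by simp
    also have "\<dots> = conn_app C D T (u Base \<cdot> a) (u Base \<cdot> b) (u Base \<cdot> c) \<cdot> q"
      using conn_app_comp[OF D d' q'] .
    finally show "u Base \<cdot> conn_app C B T a b c = conn_app C D T (u Base \<cdot> a) (u Base \<cdot> b) (u Base \<cdot> c)"
      using cover_epi[OF q(1) Comp_in_hom[OF conn_app_hom[OF B d] u(1)] conn_app_hom[OF D d']] by blast
  qed blast
  have cod: "Cod (Conn C) F = B" using F by (simp add: hom_iff)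
  show "\<exists>!U. U \<in> hom (Conn C) (Cod (Conn C) F) (Cod (Conn C) H) \<and> U \<cdot>\<^bsub>Conn C\<^esub> F = H"
    unfolding cod D_def[symmetric]
  proof (intro ex1I[of _ U] conjI U(1))
    show "U \<cdot>\<^bsub>Conn C\<^esub> F = H"
      using Conn_Comp_hom[OF F U(1)] H by (rule Conn_hom_eqI) (simp add: arr_part_Comp U(2) u(2))
    fix V assume V: "V \<in> hom (Conn C) B D \<and> V \<cdot>\<^bsub>Conn C\<^esub> F = H"
    show "V = U"
    proof (rule Conn_hom_eqI[OF conjunct1[OF V] U(1)])
      fix k
      have "arr_part k V \<cdot> arr_part k F = u k \<cdot> arr_part k F" using V u(2) arr_part_Comp by metis
      thus "arr_part k V = arr_part k U"
        unfolding U(2) using cover_epi[OF cov Conn_homD(3)[OF conjunct1[OF V]] u(1)] by blast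
    qed
  qed
qed

text \<open>The middle object carries the image relations, equivalences by
  \<open>quotient_equivalence\<close>, and the connector of \<open>quotient_connector\<close>. The
  component factorisations are prescribed rather than chosen, so that the epic parts may be taken to
  be given coequalisers.\<close>

lemma Conn_image:
  assumes F: "F \<in> hom (Conn C) A B"
    and e: "\<And>k. cover C (e k) (obj_part k A) (I k)"
    and m: "\<And>k. monic C (m k)" "\<And>k. m k \<in> hom C (I k) (obj_part k B)"
    and me: "\<And>k. m k \<cdot> e k = arr_part k F"
  obtains E Q M where "E \<in> hom (Conn C) A Q" "M \<in> hom (Conn C) Q B" "\<And>k. arr_part k E = e k" "\<And>k. arr_part k M = m k"
    "\<And>k. obj_part k Q = I k"
proof -
  note DF = Conn_homD[OF F]
  note A = DF(1) and B = DF(2)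
  have "\<exists>Q. apex Q = I (Rel s) \<and> is_relation C (I Base) (I Base) Q \<and> quotient_relation C (e Base) (rel_part s A) Q (e (Rel s)) \<and>
      leg1 (rel_part s B) \<cdot> m (Rel s) = m Base \<cdot> leg1 Q \<and> leg2 (rel_part s B) \<cdot> m (Rel s) = m Base \<cdot> leg2 Q" for s
  proof (rule image_relation[where n = "m (Rel s)" and d = "e (Rel s)",
        OF Conn_relation[OF A] Conn_relation[OF B] _ _ e m(1) m(2)])
    show "leg1 (rel_part s B) \<cdot> (m (Rel s) \<cdot> e (Rel s)) = (m Base \<cdot> e Base) \<cdot> leg1 (rel_part s A)"
      "leg2 (rel_part s B) \<cdot> (m (Rel s) \<cdot> e (Rel s)) = (m Base \<cdot> e Base) \<cdot> leg2 (rel_part s A)"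
      unfolding me using DF(4,5) .
    show "cover C (e (Rel s)) (apex (rel_part s A)) (I (Rel s))" using e[of "Rel s"] by simp
    show "monic C (m (Rel s))" using m(1) .
    show "m (Rel s) \<in> hom C (I (Rel s)) (apex (rel_part s B))" using m(2)[of "Rel s"] by simp
  qed blast
  then obtain W where W: "\<And>s. apex (W s) = I (Rel s)" "\<And>s. is_relation C (I Base) (I Base) (W s)"
    "\<And>s. quotient_relation C (e Base) (rel_part s A) (W s) (e (Rel s))"
    "\<And>s. leg1 (rel_part s B) \<cdot> m (Rel s) = m Base \<cdot> leg1 (W s)"
    "\<And>s. leg2 (rel_part s B) \<cdot> m (Rel s) = m Base \<cdot> leg2 (W s)"
    by metis
  have Weq: "is_equivalence C (I Base) (W s)" for s
    using quotient_equivalence[OF W(3) Conn_equivalence[OF A] W(2) e] .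
  note eB = cover_hom[OF e[of Base]]
  have pA: "is_connector C (obj_part Base A) (rel_part First A) (rel_part Second A) (conn_part A)"
    using A by (simp add: Obj_Conn_iff)
  obtain p where p: "is_connector C (I Base) (W First) (W Second) p"
    "\<And>T x y z. conn_dom C A T x y z \<Longrightarrow> e Base \<cdot> conn_app C A T x y z =
      app C (W First) (W Second) p T (e Base \<cdot> x) (e Base \<cdot> y) (e Base \<cdot> z)"
    using quotient_connector[OF Conn_equivalence[OF A] Conn_equivalence[OF A] W(2) W(2) eB W(3) W(3) pA e]
    unfolding conn_dom_def conn_app_def by blast
  define Q where "Q = (W First, W Second, I Base, p)"
  have Q_rel: "rel_part s Q = W s" for s by (cases s) (simp_all add: Q_def)
  have Q_part: "conn_part Q = p" and Q_Base: "obj_part Base Q = I Base" by (simp_all add: Q_def)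
  have Q_obj: "obj_part k Q = I k" for k
    by (cases k) (simp_all only: Q_Base obj_part.simps(1) Q_rel W(1))
  have Q: "Q \<in> Obj (Conn C)"
    unfolding Obj_Conn_iff Q_rel Q_part Q_Base using hom_Obj(2)[OF eB] Weq p(1) by blast
  have q_legs: "leg1 (W s) \<cdot> e (Rel s) = e Base \<cdot> leg1 (rel_part s A)" "leg2 (W s) \<cdot> e (Rel s) = e Base \<cdot> leg2 (rel_part s A)" for s
    using W(3) by (auto simp: quotient_relation_def)
  have e_app: "e Base \<cdot> conn_app C A T x y z = conn_app C Q T (e Base \<cdot> x) (e Base \<cdot> y) (e Base \<cdot> z)"
    if "conn_dom C A T x y z" for T x y z
    unfolding conn_app_def[of C Q] Q_rel Q_part using p(2)[OF that] .
  obtain E where E: "E \<in> hom (Conn C) A Q" "\<And>k. arr_part k E = e k"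
  proof (rule Conn_homI[OF A Q, of e])
    show "e k \<in> hom C (obj_part k A) (obj_part k Q)" for k unfolding Q_obj using cover_hom[OF e] .
    show "leg1 (rel_part s Q) \<cdot> e (Rel s) = e Base \<cdot> leg1 (rel_part s A)"
      "leg2 (rel_part s Q) \<cdot> e (Rel s) = e Base \<cdot> leg2 (rel_part s A)" for s
      unfolding Q_rel using q_legs .
    show "e Base \<cdot> conn_app C A T x y z = conn_app C Q T (e Base \<cdot> x) (e Base \<cdot> y) (e Base \<cdot> z)"
      if "conn_dom C A T x y z" for T x y z using e_app[OF that] .
  qed blast
  obtain M where M: "M \<in> hom (Conn C) Q B" "\<And>k. arr_part k M = m k"
  proof (rule Conn_homI[OF Q B, of m])
    show "m k \<in> hom C (obj_part k Q) (obj_part k B)" for k unfolding Q_obj using m(2) .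
    show "leg1 (rel_part s B) \<cdot> m (Rel s) = m Base \<cdot> leg1 (rel_part s Q)"
      "leg2 (rel_part s B) \<cdot> m (Rel s) = m Base \<cdot> leg2 (rel_part s Q)" for s
      unfolding Q_rel using W(4,5) .
    fix T a b c assume d: "conn_dom C Q T a b c"
    \<comment> \<open>Triples of the image come locally from \<open>A\<close>, where
      \<open>m Base \<cdot> e Base\<close> is the base part of \<open>F\<close>, known to respect
      connectors.\<close>
    obtain T' q x y z where q: "cover C q T' T" "conn_dom C A T' x y z" "e Base \<cdot> x = a \<cdot> q"
      "e Base \<cdot> y = b \<cdot> q" "e Base \<cdot> z = c \<cdot> q"
      using triple_lift[OF Conn_equivalence[OF A] Conn_equivalence[OF A] W(2) W(2) eB W(3) W(3)
          d[unfolded conn_dom_def Q_rel], folded conn_dom_def] .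
    note q' = cover_hom[OF q(1)] and dh = conn_dom_hom[OF Q d, unfolded Q_Base] and dh' = conn_dom_hom[OF A q(2)]
    have l: "leg1 (rel_part s B) \<cdot> m (Rel s) = m Base \<cdot> leg1 (rel_part s Q)"
      "leg2 (rel_part s B) \<cdot> m (Rel s) = m Base \<cdot> leg2 (rel_part s Q)" for s
      unfolding Q_rel using W(4,5) .
    have mR: "m (Rel s) \<in> hom C (apex (rel_part s Q)) (apex (rel_part s B))" for s
      using m(2)[of "Rel s"] unfolding Q_rel W(1) by simp
    have "related C (rel_part s Q) T v w \<Longrightarrow> related C (rel_part s B) T (m Base \<cdot> v) (m Base \<cdot> w)" for s v w
      using related_map[OF Conn_relation[OF Q] Conn_relation[OF B] m(2)[of Base, folded Q_Base] mR l] .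
    hence d': "conn_dom C B T (m Base \<cdot> a) (m Base \<cdot> b) (m Base \<cdot> c)" using d by (simp add: conn_dom_iff)
    have mE: "m Base \<cdot> (e Base \<cdot> w) = arr_part Base F \<cdot> w" if "w \<in> hom C T' (obj_part Base A)" for w
      using reassoc[OF me eB m(2) that] .
    have mq: "(m Base \<cdot> w) \<cdot> q = m Base \<cdot> (w \<cdot> q)" if "w \<in> hom C T (I Base)" for w
      using Comp_assoc[OF q' that m(2)] by simp
    note ah = conn_app_hom[OF Q d, unfolded Q_Base]
    have "(m Base \<cdot> conn_app C Q T a b c) \<cdot> q = m Base \<cdot> (e Base \<cdot> conn_app C A T' x y z)"
      using mq[OF ah] conn_app_comp[OF Q d q'] e_app[OF q(2)] q(3-5) by simp
    also have "\<dots> = conn_app C B T' (arr_part Base F \<cdot> x) (arr_part Base F \<cdot> y) (arr_part Base F \<cdot> z)"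
      using mE[OF conn_app_hom[OF A q(2)]] DF(6)[OF q(2)] by simp
    also have "\<dots> = conn_app C B T' ((m Base \<cdot> a) \<cdot> q) ((m Base \<cdot> b) \<cdot> q) ((m Base \<cdot> c) \<cdot> q)"
      using mE[OF dh'(1)] mE[OF dh'(2)] mE[OF dh'(3)] mq[OF dh(1)] mq[OF dh(2)] mq[OF dh(3)] q(3-5) by simp
    also have "\<dots> = conn_app C B T (m Base \<cdot> a) (m Base \<cdot> b) (m Base \<cdot> c) \<cdot> q"
      using conn_app_comp[OF B d' q'] .
    finally show "m Base \<cdot> conn_app C Q T a b c = conn_app C B T (m Base \<cdot> a) (m Base \<cdot> b) (m Base \<cdot> c)"
      using cover_epi[OF q(1) Comp_in_hom[OF ah m(2)] conn_app_hom[OF B d']] by blast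
  qed blast
  from that[OF E(1) M(1) E(2) M(2) Q_obj] show ?thesis .
qed

text \<open>Let \<open>F\<close> be M E, its componentwise image factorisation. The parts of
  \<open>M\<close> being monic, \<open>E\<close> equalises the pair coequalised by \<open>F\<close>,
  hence is U F for some \<open>U\<close>. Cancelling \<open>F\<close> in M U F = F gives a right
  inverse of \<open>M\<close>, so each part of \<open>M\<close> is invertible.\<close>

lemma Conn_regular_epi_part:
  assumes F: "F \<in> hom (Conn C) A B" and r: "regular_epi (Conn C) F"
  shows "cover C (arr_part k F) (obj_part k A) (obj_part k B)"
proof -
  interpret K: category "Conn C" by (rule category_Conn)
  note DF = Conn_homD[OF F]
  have "\<exists>I e m. cover C e (obj_part k A) I \<and> monic C m \<and> m \<in> hom C I (obj_part k B) \<and> m \<cdot> e = arr_part k F" for k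
    using image_factorisation[OF DF(3)[of k]] by metis
  then obtain I e m where i: "\<And>k. cover C (e k) (obj_part k A) (I k)" "\<And>k. monic C (m k)"
    "\<And>k. m k \<in> hom C (I k) (obj_part k B)" "\<And>k. m k \<cdot> e k = arr_part k F"
    by metis
  obtain Q E M where Q: "E \<in> hom (Conn C) A Q" "M \<in> hom (Conn C) Q B" "\<And>k. arr_part k E = e k"
    "\<And>k. arr_part k M = m k" "\<And>k. obj_part k Q = I k"
    using Conn_image[OF F i] by blast
  obtain G1 G2 where co: "is_coequaliser (Conn C) G1 G2 F" using r unfolding regular_epi_def by blast
  have dom: "Dom (Conn C) F = A" "Cod (Conn C) F = B" using F by (auto simp: hom_iff)
  note KD = K.is_coequaliserD[OF co, unfolded dom]
  have "E \<cdot>\<^bsub>Conn C\<^esub> G1 = E \<cdot>\<^bsub>Conn C\<^esub> G2"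
  proof (rule Conn_hom_eqI[OF Conn_Comp_hom[OF KD(1) Q(1)] Conn_Comp_hom[OF KD(2) Q(1)]])
    fix k
    note g = Conn_homD(3)[OF KD(1), of k] Conn_homD(3)[OF KD(2), of k] and e' = cover_hom[OF i(1)[of k]]
    have Fg: "arr_part k F \<cdot> arr_part k G1 = arr_part k F \<cdot> arr_part k G2" using KD(4) arr_part_Comp by metis
    have "m k \<cdot> (e k \<cdot> arr_part k G1) = m k \<cdot> (e k \<cdot> arr_part k G2)"
      using reassoc[OF i(4) e' i(3) g(1)] reassoc[OF i(4) e' i(3) g(2)] Fg by simp
    moreover have "Dom C (m k) = I k" using i(3)[of k] by (simp add: hom_iff)
    ultimately show "arr_part k (E \<cdot>\<^bsub>Conn C\<^esub> G1) = arr_part k (E \<cdot>\<^bsub>Conn C\<^esub> G2)"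
      unfolding arr_part_Comp Q(3)
      using monicD[OF i(2)[of k], of "e k \<cdot> arr_part k G1" _ "e k \<cdot> arr_part k G2"]
        Comp_in_hom[OF g(1) e'] Comp_in_hom[OF g(2) e'] by simp
  qed
  then obtain U where U: "U \<in> hom (Conn C) B Q" "U \<cdot>\<^bsub>Conn C\<^esub> F = E"
    using K.coequaliser_lift[OF co, unfolded dom, OF Q(1)] by blast
  have ME: "M \<cdot>\<^bsub>Conn C\<^esub> E = F"
    using Conn_Comp_hom[OF Q(1,2)] F by (rule Conn_hom_eqI) (simp add: arr_part_Comp Q(3,4) i(4))
  have "(M \<cdot>\<^bsub>Conn C\<^esub> U) \<cdot>\<^bsub>Conn C\<^esub> F = Ide (Conn C) B \<cdot>\<^bsub>Conn C\<^esub> F"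
    using K.Comp_assoc[OF F U(1) Q(2)] U(2) ME K.Comp_Ide_left[OF F] by simp
  hence MU: "M \<cdot>\<^bsub>Conn C\<^esub> U = Ide (Conn C) B"
    using K.regular_epi_cancel[OF r, unfolded dom, OF Conn_Comp_hom[OF U(1) Q(2)] Conn_Ide_hom[OF DF(2)]] by blast
  have "m k \<cdot> arr_part k U = Ide C (obj_part k B)"
    using arg_cong[OF MU, of "arr_part k"] by (simp add: arr_part_Comp arr_part_Ide Q(4))
  moreover have "arr_part k U \<in> hom C (obj_part k B) (I k)" using Conn_homD(3)[OF U(1), of k] Q(5) by simp
  ultimately show ?thesis using regular_epi_iso_comp[OF i(1)[of k] i(2)[of k] i(3)[of k], of "arr_part k U"] i(4) by simp
qed

text \<open>The kernel pair of \<open>F\<close> exists and is componentwise, each part of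
  \<open>F\<close> coequalises its own kernel pair, and \<open>Conn_coequaliser\<close> reassembles
  the parts.\<close>

lemma Conn_regular_epiI:
  assumes F: "F \<in> hom (Conn C) A B" and r: "\<And>k. regular_epi C (arr_part k F)"
  shows "regular_epi (Conn C) F"
proof -
  interpret K: category "Conn C" by (rule category_Conn)
  obtain P where P: "is_pullback (Conn C) F F P"
    using K.finitely_complete_pullback[OF Conn_finitely_complete, of F F] F by (auto simp: hom_iff)
  note D = K.is_pullbackD[OF P]
  have "is_coequaliser (Conn C) (leg1 P) (leg2 P) F"
  proof (rule Conn_coequaliser[OF F])
    show "leg1 P \<in> hom (Conn C) (apex P) A" "leg2 P \<in> hom (Conn C) (apex P) A" using D F by (auto simp: hom_iff)
    show "is_coequaliser C (arr_part k (leg1 P)) (arr_part k (leg2 P)) (arr_part k F)" for k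
      using regular_epi_kernel_coequaliser[OF r part_pullback[OF P, of k]] by simp
  qed
  thus ?thesis unfolding regular_epi_def by blast
qed

text \<open>Makes relations, composites and equivalences of connectors visible in \<open>C\<close>.
  Preservation of regular epimorphisms is the clause that relies on the Goursat law, through the
  construction of images.\<close>

lemma part_exact_functor: "exact_functor (Conn C) C (obj_part k) (arr_part k)"
proof (intro exact_functor.intro exact_functor_axioms.intro)
  show "category (Conn C)" by (rule category_Conn)
  show "category C" by unfold_locales
  show "is_functor (Conn C) C (obj_part k) (arr_part k)" by (rule part_functor)
  show "is_pullback C (arr_part k F) (arr_part k G)
      \<lparr>apex = obj_part k (apex P), leg1 = arr_part k (leg1 P), leg2 = arr_part k (leg2 P)\<rparr>"
    if "is_pullback (Conn C) F G P" for F G P using part_pullback[OF that] .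
  show "is_product C (obj_part k A) (obj_part k B)
      \<lparr>apex = obj_part k (apex P), leg1 = arr_part k (leg1 P), leg2 = arr_part k (leg2 P)\<rparr>"
    if "is_product (Conn C) A B P" for A B P using part_product[OF that] .
  show "regular_epi C (arr_part k E)" if E: "regular_epi (Conn C) E" for E
  proof -
    have "E \<in> hom (Conn C) (Dom (Conn C) E) (Cod (Conn C) E)"
      using category.regular_epi_arr[OF category_Conn E] by (simp add: hom_iff)
    from Conn_regular_epi_part[OF this E] show ?thesis by (simp add: cover_def)
  qed
qed

text \<open>Stability combines both directions of the componentwise description of regular
  epimorphisms with part-wise pullbacks in \<open>C\<close>.\<close>

lemma regular_category_Conn: "regular_category (Conn C)"
proof (intro regular_category.intro regular_category_axioms.intro)
  show "category (Conn C)" by (rule category_Conn)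
  interpret K: category "Conn C" by (rule category_Conn)
  show "finitely_complete (Conn C)" by (rule Conn_finitely_complete)
  show "regular_epi (Conn C) (leg2 P)" if P: "is_pullback (Conn C) E G P" and E: "regular_epi (Conn C) E" for E G P
  proof (rule Conn_regular_epiI[OF K.is_pullbackD(6)[OF P]])
    show "regular_epi C (arr_part k (leg2 P))" for k
      using regular_epi_stable[OF part_pullback[OF P, of k]] exact_functor.U_regular_epi[OF part_exact_functor E] by simp
  qed
  show "\<exists>E. is_coequaliser (Conn C) (leg1 P) (leg2 P) E" if P: "is_pullback (Conn C) F F P" for F P
  proof -
    note D = K.is_pullbackD[OF P]
    obtain A B where AB: "A = Dom (Conn C) F" "B = Cod (Conn C) F" by blast
    have F: "F \<in> hom (Conn C) A B" using D(1) by (simp add: hom_iff AB)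
    note DF = Conn_homD[OF F]
    have dom: "Dom C (arr_part k F) = obj_part k A" "Cod C (arr_part k F) = obj_part k B" for k
      using DF(3) by (auto simp: hom_iff)
    have l: "leg1 P \<in> hom (Conn C) (apex P) A" "leg2 P \<in> hom (Conn C) (apex P) A" using D(5,6) AB by auto
    \<comment> \<open>In each component the coequaliser of the kernel pair is the epic part of an
      image factorisation; feeding exactly these factorisations to \<open>Conn_image\<close> turns
      the three coequalisers into one arrow of connectors.\<close>
    have "\<exists>e m. is_coequaliser C (arr_part k (leg1 P)) (arr_part k (leg2 P)) e \<and> Dom C e = obj_part k A \<and>
        m \<in> hom C (Cod C e) (obj_part k B) \<and> m \<cdot> e = arr_part k F \<and> monic C m" for k
    proof -
      note Pk = part_pullback[OF P, of k]
      obtain e where e: "is_coequaliser C (arr_part k (leg1 P)) (arr_part k (leg2 P)) e"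
        using kernel_pair_coequaliser[OF Pk] by auto
      have De: "Dom C e = obj_part k A"
        using e Conn_homD(3)[OF l(1), of k] by (auto simp: is_coequaliser_def hom_iff)
      have "arr_part k F \<cdot> arr_part k (leg1 P) = arr_part k F \<cdot> arr_part k (leg2 P)"
        using is_pullbackD(7)[OF Pk] by simp
      then obtain m where m: "m \<in> hom C (Cod C e) (obj_part k B)" "m \<cdot> e = arr_part k F"
        using coequaliser_lift[OF e, unfolded De, OF DF(3)] by blast
      have "monic C m" using coequaliser_kernel_monic[OF Pk, of e m] e m dom by simp
      with e De m show ?thesis by blast
    qed
    then obtain e m where em: "\<And>k. is_coequaliser C (arr_part k (leg1 P)) (arr_part k (leg2 P)) (e k)"
      "\<And>k. Dom C (e k) = obj_part k A" "\<And>k. m k \<in> hom C (Cod C (e k)) (obj_part k B)"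
      "\<And>k. m k \<cdot> e k = arr_part k F" "\<And>k. monic C (m k)"
      by metis
    have cov: "cover C (e k) (obj_part k A) (Cod C (e k))" for k
      using em(1,2)[of k] is_coequaliserD(3)[OF em(1), of k] by (auto simp: cover_def regular_epi_def)
    obtain Q E M where Q: "E \<in> hom (Conn C) A Q" "M \<in> hom (Conn C) Q B" "\<And>k. arr_part k E = e k"
      "\<And>k. arr_part k M = m k" "\<And>k. obj_part k Q = Cod C (e k)"
      using Conn_image[OF F cov em(5) em(3) em(4)] by blast
    have "is_coequaliser (Conn C) (leg1 P) (leg2 P) E"
      using Q(1) l by (rule Conn_coequaliser) (simp add: Q(3) em(1))
    thus ?thesis ..
  qed
qed

lemma goursat_category_Conn: "goursat_category (Conn C)"
proof (intro goursat_category.intro goursat_category_axioms.intro)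
  show "regular_category (Conn C)" by (rule regular_category_Conn)
  interpret K: regular_category "Conn C" by (rule regular_category_Conn)
  fix X R S SR RSR RS SRS
  assume X: "X \<in> Obj (Conn C)" and R: "is_equivalence (Conn C) X R" and S: "is_equivalence (Conn C) X S"
    and SR: "is_composite (Conn C) X X X S R SR" and RSR: "is_composite (Conn C) X X X R SR RSR"
    and RS: "is_composite (Conn C) X X X R S RS" and SRS: "is_composite (Conn C) X X X S RS SRS"
  let ?U = "\<lambda>k Q. \<lparr>apex = obj_part k (apex Q), leg1 = arr_part k (leg1 Q), leg2 = arr_part k (leg2 Q)\<rparr>"
  note UE = exact_functor.U_equivalence[OF part_exact_functor] and UC = exact_functor.U_composite[OF part_exact_functor]
  \<comment> \<open>One use of the law in \<open>C\<close> for each component; the three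
    isomorphisms obtained are a priori unrelated.\<close>
  have "same_relation C (?U k RSR) (?U k SRS)" for k
    using goursat[OF obj_part_Obj[OF X] UE[OF R] UE[OF S] UC[OF SR] UC[OF RSR] UC[OF RS] UC[OF SRS]] .
  hence "\<exists>i j. i \<in> hom C (obj_part k (apex RSR)) (obj_part k (apex SRS)) \<and>
      arr_part k (leg1 SRS) \<cdot> i = arr_part k (leg1 RSR) \<and> arr_part k (leg2 SRS) \<cdot> i = arr_part k (leg2 RSR) \<and>
      j \<in> hom C (obj_part k (apex SRS)) (obj_part k (apex RSR)) \<and>
      j \<cdot> i = Ide C (obj_part k (apex RSR)) \<and> i \<cdot> j = Ide C (obj_part k (apex SRS))" for k
    unfolding same_relation_def isomorphism_def by (fastforce simp: hom_iff)
  then obtain i j where i: "\<And>k. i k \<in> hom C (obj_part k (apex RSR)) (obj_part k (apex SRS))"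
      "\<And>k. arr_part k (leg1 SRS) \<cdot> i k = arr_part k (leg1 RSR)" "\<And>k. arr_part k (leg2 SRS) \<cdot> i k = arr_part k (leg2 RSR)"
    and j: "\<And>k. j k \<in> hom C (obj_part k (apex SRS)) (obj_part k (apex RSR))"
      "\<And>k. j k \<cdot> i k = Ide C (obj_part k (apex RSR))" "\<And>k. i k \<cdot> j k = Ide C (obj_part k (apex SRS))"
    by metis
  note relR = K.composite_relation[OF RSR] and relS = K.composite_relation[OF SRS]
  note DR = K.is_relationD[OF relR] and DS = K.is_relationD[OF relS]
  have UR: "is_relation C (obj_part k X) (obj_part k X) (?U k RSR)"
    and US: "is_relation C (obj_part k X) (obj_part k X) (?U k SRS)" for k
    using exact_functor.U_relation[OF part_exact_functor relR] exact_functor.U_relation[OF part_exact_functor relS] .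
  obtain H where H: "H \<in> hom (Conn C) (apex RSR) (apex SRS)" "\<And>k. arr_part k H = i k"
    using Conn_relation_lift[OF DS(4,5) DR(4,5) i US] by blast
  \<comment> \<open>The inverses commute with the legs as well, so they too assemble to an arrow of
    connectors; that the two arrows are mutually inverse is then checked part by part.\<close>
  have ji: "arr_part k (leg1 RSR) \<cdot> j k = arr_part k (leg1 SRS)" "arr_part k (leg2 RSR) \<cdot> j k = arr_part k (leg2 SRS)" for k
    using reassoc[OF i(2) i(1) Conn_homD(3)[OF DS(4)] j(1)] reassoc[OF i(3) i(1) Conn_homD(3)[OF DS(5)] j(1)] j(3)
      Comp_Ide_right[OF Conn_homD(3)[OF DS(4)]] Comp_Ide_right[OF Conn_homD(3)[OF DS(5)]] by simp_all
  obtain H' where H': "H' \<in> hom (Conn C) (apex SRS) (apex RSR)" "\<And>k. arr_part k H' = j k"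
    using Conn_relation_lift[OF DR(4,5) DS(4,5) j(1) ji UR] by blast
  have dom: "H \<in> Arr (Conn C)" "Dom (Conn C) H = apex RSR" "Cod (Conn C) H = apex SRS"
    using H(1) by (simp_all add: hom_iff)
  have "H' \<cdot>\<^bsub>Conn C\<^esub> H = Ide (Conn C) (apex RSR)"
    using Conn_Comp_hom[OF H(1) H'(1)] Conn_Ide_hom[OF DR(3)]
    by (rule Conn_hom_eqI) (simp add: arr_part_Comp arr_part_Ide H(2) H'(2) j(2))
  moreover have "H \<cdot>\<^bsub>Conn C\<^esub> H' = Ide (Conn C) (apex SRS)"
    using Conn_Comp_hom[OF H'(1) H(1)] Conn_Ide_hom[OF DS(3)]
    by (rule Conn_hom_eqI) (simp add: arr_part_Comp arr_part_Ide H(2) H'(2) j(3))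
  ultimately have "isomorphism (Conn C) H"
    unfolding isomorphism_def dom(2,3) using dom(1) H'(1) by blast
  moreover have "leg1 SRS \<cdot>\<^bsub>Conn C\<^esub> H = leg1 RSR"
    using Conn_Comp_hom[OF H(1) DS(4)] DR(4) by (rule Conn_hom_eqI) (simp add: arr_part_Comp H(2) i(2))
  moreover have "leg2 SRS \<cdot>\<^bsub>Conn C\<^esub> H = leg2 RSR"
    using Conn_Comp_hom[OF H(1) DS(5)] DR(5) by (rule Conn_hom_eqI) (simp add: arr_part_Comp H(2) i(3))
  ultimately show "same_relation (Conn C) RSR SRS" using H(1) unfolding same_relation_def by blast
qed

end

theorem theorem3p10:
  fixes C :: "('o, 'a) cat"
  assumes "regular_category C"
    and "goursat_category C"
  shows "goursat_category (Conn C)"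
  using assms(2) by (rule goursat_category.goursat_category_Conn)

end
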